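(* (1) Let $C$ be a binary doubly even self-dual code of length $96$ with minimum weight $16$. Then $C_{20}$ (also $C_{76}$) is a combinatorial $2$-design. (2) Let $L\subset\mathbb{R}^{240}$ be an even unimodular lattice of rank $240$ with minimum norm $20$. Then $L_{22}$, if non-empty, supports a spherical $5$-design.
   Context: Codes. A binary linear code $C$ of length $n$ is a linear subspace of $\mathbb{F}_2^n$; it is self-dual if $C=C^\perp$ with respect to $(x,y)=\sum_i x_iy_i$, and doubly even if all weights are divisible by $4$, where $\mathrm{supp}(x)=\{i\mid x_i\ne0\}$ and $\mathrm{wt}(x)=|\mathrm{supp}(x)|$. The minimum weight is the smallest weight of a nonzero codeword. Put $C_\ell=\{c\in C\mid \mathrm{wt}(c)=\ell\}$. Combinatorial designs. A pair $(\Omega,\mathcal{B})$, with $\Omega$ a finite set and $\mathcal{B}$ a set (no repeated blocks) of $k$-element subsets of $\Omega$ (blocks), is a combinatorial $t$-design if there is a number $\lambda$ such that any $t$ points of $\Omega$ are contained in precisely $\lambda$ blocks. $C_\ell$ is said to be a combinatorial $t$-design if $(\{1,\dots,n\},\{\mathrm{supp}(x)\mid x\in C_\ell\})$ is one. An empty $C_\ell$ satisfies this trivially with $\lambda=0$. Lattices. A lattice $L\subset\mathbb{R}^n$ is the $\mathbb{Z}$-span of a basis of $\mathbb{R}^n$. It is integral if $(x,y)\in\mathbb{Z}$ for all $x,y\in L$ (standard inner product), even if moreover $(x,x)\in2\mathbb{Z}$ for all $x\in L$, and unimodular if it is integral and equals its dual lattice $\{y\in\mathbb{R}^n\mid (y,x)\in\mathbb{Z}\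 \forall x\in L\}$. The minimum norm of $L$ is $\min\{(x,x)\mid 0\ne x\in L\}$. Put $L_\ell=\{x\in L\mid (x,x)=\ell\}$. Spherical designs. A finite nonempty set $X\subset S^{n-1}$ (the unit sphere of $\mathbb{R}^n$) is a spherical $t$-design if $\frac{1}{|X|}\sum_{x\in X}f(x)=\frac{1}{|S^{n-1}|}\int_{S^{n-1}}f\,d\sigma$ for all polynomials $f$ in $n$ variables of degree at most $t$. $L_\ell$ (with $\ell>0$) supports a spherical $t$-design if $\frac{1}{\sqrt{\ell}}L_\ell$ is a spherical $t$-design in $S^{n-1}$. *)

theory Defs
  imports "HOL-Analysis.Analysis" "HOL-Library.Z2"
begin

text \<open>The field with two elements is the type \<^typ>\<open>bit\<close>, so that a code of length \<open>n\<close> is a set of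
  vectors of type \<open>bit ^ 'n\<close> with \<open>CARD('n) = n\<close>.\<close>

definition supp :: "bit ^ 'n \<Rightarrow> 'n set" where
  "supp x = {i. x $ i \<noteq> 0}"

definition wt :: "bit ^ 'n \<Rightarrow> nat" where
  "wt x = card (supp x)"

definition linear_code :: "(bit ^ 'n) set \<Rightarrow> bool" where
  "linear_code C \<longleftrightarrow> vec.subspace C"

definition dual_code :: "(bit ^ 'n) set \<Rightarrow> (bit ^ 'n) set" where
  "dual_code C = {y. \<forall>x\<in>C. scalar_product x y = 0}"

definition self_dual_code :: "(bit ^ 'n) set \<Rightarrow> bool" where
  "self_dual_code C \<longleftrightarrow> C = dual_code C"

definition doubly_even_code :: "(bit ^ 'n) set \<Rightarrow> bool" where
  "doubly_even_code C \<longleftrightarrow> (\<forall>c\<in>C. 4 dvd wt c)"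

definition has_minimum_weight :: "(bit ^ 'n) set \<Rightarrow> nat \<Rightarrow> bool" where
  "has_minimum_weight C d \<longleftrightarrow> (\<exists>c\<in>C. c \<noteq> 0 \<and> wt c = d) \<and> (\<forall>c\<in>C. c \<noteq> 0 \<longrightarrow> d \<le> wt c)"

definition codewords_of_weight :: "(bit ^ 'n) set \<Rightarrow> nat \<Rightarrow> (bit ^ 'n) set" where
  "codewords_of_weight C l = {c \<in> C. wt c = l}"

definition combinatorial_design :: "nat \<Rightarrow> 'a set \<Rightarrow> 'a set set \<Rightarrow> bool" where
  "combinatorial_design t \<Omega> \<B> \<longleftrightarrow>
     finite \<Omega> \<and>
     (\<exists>k. \<forall>b\<in>\<B>. b \<subseteq> \<Omega> \<and> card b = k) \<and>
     (\<exists>lam. \<forall>T. T \<subseteq> \<Omega> \<and> card T = t \<longrightarrow> card {b \<in> \<B>. T \<subseteq> b} = lam)"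

definition is_combinatorial_design :: "nat \<Rightarrow> (bit ^ 'n) set \<Rightarrow> bool" where
  "is_combinatorial_design t D \<longleftrightarrow> combinatorial_design t (UNIV :: 'n set) (supp ` D)"

definition lattice_in_space :: "(real ^ 'n) set \<Rightarrow> bool" where
  "lattice_in_space L \<longleftrightarrow>
     (\<exists>B. independent B \<and> span B = (UNIV :: (real ^ 'n) set) \<and>
          L = {\<Sum>b\<in>B. of_int (c b) *\<^sub>R b | c :: real ^ 'n \<Rightarrow> int. True})"

definition integral_lattice :: "(real ^ 'n) set \<Rightarrow> bool" where
  "integral_lattice L \<longleftrightarrow> lattice_in_space L \<and> (\<forall>x\<in>L. \<forall>y\<in>L. x \<bullet> y \<in> \<int>)"

definition even_lattice :: "(real ^ 'n) set \<Rightarrow> bool" where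
  "even_lattice L \<longleftrightarrow> integral_lattice L \<and> (\<forall>x\<in>L. \<exists>m::int. x \<bullet> x = 2 * of_int m)"

definition dual_lattice :: "(real ^ 'n) set \<Rightarrow> (real ^ 'n) set" where
  "dual_lattice L = {y. \<forall>x\<in>L. y \<bullet> x \<in> \<int>}"

definition unimodular_lattice :: "(real ^ 'n) set \<Rightarrow> bool" where
  "unimodular_lattice L \<longleftrightarrow> integral_lattice L \<and> L = dual_lattice L"

definition has_minimum_norm :: "(real ^ 'n) set \<Rightarrow> real \<Rightarrow> bool" where
  "has_minimum_norm L m \<longleftrightarrow> (\<exists>x\<in>L. x \<noteq> 0 \<and> x \<bullet> x = m) \<and> (\<forall>x\<in>L. x \<noteq> 0 \<longrightarrow> m \<le> x \<bullet> x)"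

definition shell :: "(real ^ 'n) set \<Rightarrow> real \<Rightarrow> (real ^ 'n) set" where
  "shell L l = {x \<in> L. x \<bullet> x = l}"

text \<open>The surface measure of the unit sphere, given by polar coordinates: the measure of a Borel
  set \<open>A\<close> is \<open>n\<close> times the volume of the cone \<open>{r x | 0 < r < 1, x \<in> A}\<close>
  (see \<open>emeasure_sphere_measure\<close>). Recall that \<open>sgn x\<close> is the unit vector \<open>x / norm x\<close>. The
  origin has to be left out, since \<open>sgn 0 = 0\<close> does not lie on the sphere.\<close>

definition sphere_measure :: "'a::euclidean_space measure" where
  "sphere_measure =
     scale_measure (of_nat DIM('a))
       (distr (restrict_space lborel (ball 0 1 - {0})) (restrict_space borel (sphere 0 1)) sgn)"

lemma space_sphere_measure [simp]: "space sphere_measure = sphere 0 1"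
  by (simp add: sphere_measure_def space_scale_measure space_restrict_space)

lemma sets_sphere_measure [measurable_cong]:
  "sets sphere_measure = sets (restrict_space borel (sphere 0 1))"
  by (simp add: sphere_measure_def)

lemma measurable_sgn_punctured_ball:
  "(sgn :: 'a \<Rightarrow> 'a::euclidean_space) \<in>
     restrict_space lborel (ball 0 1 - {0}) \<rightarrow>\<^sub>M restrict_space borel (sphere 0 1)"
proof (rule measurable_restrict_space2)
  show "(sgn :: 'a \<Rightarrow> 'a) \<in> space (restrict_space lborel (ball 0 1 - {0})) \<rightarrow> sphere 0 1"
    by (auto simp: space_restrict_space norm_sgn)
  have "(\<lambda>x::'a. inverse (norm x) *\<^sub>R x) \<in> borel_measurable borel"
    by measurable
  then show "(sgn :: 'a \<Rightarrow> 'a) \<in> restrict_space lborel (ball 0 1 - {0}) \<rightarrow>\<^sub>M borel"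
    by (intro measurable_restrict_space1) (simp add: sgn_div_norm[abs_def])
qed

lemma emeasure_sphere_measure:
  fixes A :: "'a::euclidean_space set"
  assumes "A \<in> sets borel" "A \<subseteq> sphere 0 1"
  shows "emeasure sphere_measure A =
           of_nat DIM('a) * emeasure lborel {x \<in> ball 0 1 - {0}. sgn x \<in> A}"
proof -
  have A: "A \<in> sets (restrict_space borel (sphere 0 1))"
    using assms by (auto simp: sets_restrict_space_iff)
  have "emeasure (restrict_space lborel (ball 0 1 - {0})) {x \<in> ball 0 1 - {0}. sgn x \<in> A} =
        emeasure lborel {x \<in> ball 0 1 - {0::'a}. sgn x \<in> A}"
    by (rule emeasure_restrict_space) auto
  moreover have "sgn -` A \<inter> (ball 0 1 - {0}) = {x \<in> ball 0 1 - {0}. sgn x \<in> A}"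
    by auto
  ultimately show ?thesis
    unfolding sphere_measure_def
    by (simp only: emeasure_scale_measure emeasure_distr[OF measurable_sgn_punctured_ball A]
        space_restrict_space space_lborel space_borel Int_UNIV_right)
qed

lemma measure_sphere_measure_sphere:
  "measure (sphere_measure :: 'a measure) (sphere 0 1) =
     DIM('a::euclidean_space) * measure lborel (ball (0::'a) 1)"
proof -
  have "{x \<in> ball 0 1 - {0::'a}. sgn x \<in> sphere 0 1} = ball 0 1 - {0}"
    by (auto simp: norm_sgn)
  moreover have "emeasure lborel (ball 0 1 - {0::'a}) = emeasure lborel (ball (0::'a) 1)"
    by (rule emeasure_Diff_null_set) auto
  ultimately show ?thesis
    by (simp add: measure_def emeasure_sphere_measure enn2real_mult)
qed

definition sphere_average :: "('a::euclidean_space \<Rightarrow> real) \<Rightarrow> real" where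
  "sphere_average f =
     (1 / measure (sphere_measure :: 'a measure) (sphere 0 1)) * (LINT x|sphere_measure. f x)"

definition poly_fun_degree_le :: "nat \<Rightarrow> (real ^ 'n \<Rightarrow> real) \<Rightarrow> bool" where
  "poly_fun_degree_le t f \<longleftrightarrow>
     (\<exists>c :: ('n \<Rightarrow> nat) \<Rightarrow> real.
        \<forall>x. f x = (\<Sum>a | (\<Sum>i\<in>UNIV. a i) \<le> t. c a * (\<Prod>i\<in>UNIV. x $ i ^ a i)))"

lemma finite_exponents: "finite {a :: 'n::finite \<Rightarrow> nat. (\<Sum>i\<in>UNIV. a i) \<le> t}"
proof (rule finite_subset)
  show "{a :: 'n \<Rightarrow> nat. (\<Sum>i\<in>UNIV. a i) \<le> t} \<subseteq> UNIV \<rightarrow>\<^sub>E {..t}"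
  proof
    fix a :: "'n \<Rightarrow> nat"
    assume "a \<in> {a. (\<Sum>i\<in>UNIV. a i) \<le> t}"
    moreover have "a i \<le> (\<Sum>i\<in>UNIV. a i)" for i
      by (rule member_le_sum) auto
    ultimately show "a \<in> UNIV \<rightarrow>\<^sub>E {..t}"
      by (auto intro: order_trans)
  qed
  show "finite ((UNIV :: 'n set) \<rightarrow>\<^sub>E {..t})"
    by (rule finite_PiE) auto
qed

definition spherical_design :: "nat \<Rightarrow> (real ^ 'n) set \<Rightarrow> bool" where
  "spherical_design t X \<longleftrightarrow>
     finite X \<and> X \<noteq> {} \<and> X \<subseteq> sphere 0 1 \<and>
     (\<forall>f. poly_fun_degree_le t f \<longrightarrow> (1 / card X) * (\<Sum>x\<in>X. f x) = sphere_average f)"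

definition supports_spherical_design :: "nat \<Rightarrow> (real ^ 'n) set \<Rightarrow> real \<Rightarrow> bool" where
  "supports_spherical_design t L l \<longleftrightarrow>
     l > 0 \<and> spherical_design t ((\<lambda>x. (1 / sqrt l) *\<^sub>R x) ` shell L l)"

end

theory Submission
  imports Defs "HOL-Probability.Probability" "HOL-Complex_Analysis.Conformal_Mappings"
    "HOL-Computational_Algebra.Polynomial"
begin

text \<open>Both parts follow one pattern. A design property says that certain sums over a layer (the
  codewords of weight \<open>20\<close>, the lattice vectors of norm \<open>22\<close>) vanish. Such a sum is a coefficient
  of a generating function with a functional equation from Poisson summation, and extremality
  leaves so few unknown coefficients that this equation forces the second one to be \<open>0\<close>.

  Codes. For distinct coordinates let \<open>D_w\<close> be the sum of \<open>c_i - c_l\<close> and \<open>E_w\<close> the sum of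
  \<open>(c_i - c_l) (c_k - c_m)\<close> over the codewords \<open>c\<close> of weight \<open>w\<close>. The MacWilliams identity
  (\<open>macwilliams_self_dual_code\<close>) says that \<open>P(y) = \<Sum> D_w y^(w-1)\<close> and \<open>Q(y) = \<Sum> E_w y^(w-2)\<close>
  reproduce themselves, up to explicit factors, under \<open>y \<mapsto> (1-y)/(1+y)\<close>. Only the weights
  \<open>16, 20, ..., 80\<close> contribute, so \<open>P(y) = y^15 R(y^4)\<close> with \<open>degree R \<le> 16\<close>; the transform turns
  \<open>y^15\<close> into \<open>(1-y)^15\<close>, hence \<open>(1-z)^15\<close> divides \<open>R(z)\<close>. Since the code contains the all-one
  word, \<open>R\<close> is antisymmetric, so it is a multiple of \<open>(1-z)^15 (1+z)\<close>, and at the fixed point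
  \<open>y = sqrt 2 - 1\<close> the equation reads \<open>P(y) = - P(y)\<close>. So \<open>P = 0\<close>. In the same way
  \<open>Q(y) = y^14 (1-z)^14 (a + b z + a z^2)\<close> with \<open>z = y^4\<close>; comparing the values at \<open>1/3\<close> and \<open>1/2\<close>
  gives \<open>b = 14 a\<close>, which is \<open>E_20 = 0\<close>. That the sums \<open>D_20\<close> and \<open>E_20\<close> vanish for all choices of
  coordinates implies the \<open>2\<close>-design property, and complements give the weight \<open>76\<close>.

  Lattices. Poisson summation (\<open>poisson_unimodular_lattice\<close>) is applied to Gaussians centred at
  \<open>s \<alpha>\<close> for unit vectors \<open>\<alpha>\<close>. For a combination of unit vectors whose power sums
  \<open>\<Sum> \<epsilon>_j (x \<bullet> \<alpha>_j)^i\<close> have vanishing Gaussian moments for \<open>i < k\<close>, the leading Taylor coefficient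
  at \<open>s = 0\<close> shows that the theta series weighted by the \<open>k\<close>-th power sum is modular of weight
  \<open>120 + k\<close>. This covers \<open>(x \<bullet> \<alpha>)^2 - (x \<bullet> \<beta>)^2\<close> and the fourth powers of \<open>\<alpha>, \<beta>\<close> minus those of
  \<open>\<gamma>, \<delta>\<close> if the squares balance. Such a form \<open>f\<close> begins with \<open>a x^20 + b x^22\<close>, where
  \<open>x = e^(\<pi> \<i> z)\<close>. Multiplication by \<open>(E_4^3 - 984 \<Delta>) / \<Delta>^11\<close> for \<open>k = 2\<close> and by \<open>E_4 E_6 / \<Delta>^11\<close>
  for \<open>k = 4\<close> yields a form of weight \<open>2\<close> with expansion \<open>a x^(-2) + b + ...\<close>: the multiples of
  \<open>a\<close> in the constant term cancel, because \<open>720 - 984 + 264 = 0\<close> and \<open>240 - 504 + 264 = 0\<close>. A form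
  of weight \<open>2\<close> has constant term \<open>0\<close> (\<open>weight_two_constant_term\<close>), so \<open>b = 0\<close>.

  So the second and fourth power sums over the layer satisfy the same relations as averages over
  the sphere, and these relations together with the symmetry \<open>x \<mapsto> -x\<close> determine the averages of
  \<open>(x \<bullet> \<alpha>)^k\<close> for \<open>k \<le> 5\<close> (\<open>moments_unit\<close>). By polarization all polynomials of degree at most \<open>5\<close>
  then have the same average (\<open>means_agree_on_polynomials\<close>).\<close>

section \<open>Poisson summation over self-dual codes\<close>

instance bit :: finite
proof
  have "(UNIV :: bit set) = {0, 1}"
    by auto
  then show "finite (UNIV :: bit set)"
    by (metis finite.emptyI finite_insert)
qed

text \<open>The nontrivial character of the additive group of the field with two elements.\<close>

definition bit_sign :: "bit \<Rightarrow> real" where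
  "bit_sign b = (if b = 0 then 1 else - 1)"

definition bit_val :: "bit \<Rightarrow> real" where
  "bit_val b = (if b = 0 then 0 else 1)"

lemma bit_sign_simps [simp]: "bit_sign 0 = 1" "bit_sign 1 = - 1"
  by (auto simp: bit_sign_def)

lemma bit_val_simps [simp]: "bit_val 0 = 0" "bit_val 1 = 1"
  by (auto simp: bit_val_def)

lemma bit_sign_add: "bit_sign (a + b) = bit_sign a * bit_sign b"
  by (cases a; cases b) auto

lemma bit_sign_sum: "bit_sign (\<Sum>i\<in>A. f i) = (\<Prod>i\<in>A. bit_sign (f i))"
  by (induction A rule: infinite_finite_induct) (simp_all only: sum.infinite sum.empty sum.insert
    prod.infinite prod.empty prod.insert bit_sign_add bit_sign_simps not_False_eq_True)

lemma sum_vec_prod: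
  fixes g :: "'n::finite \<Rightarrow> bit \<Rightarrow> real"
  shows "(\<Sum>x\<in>UNIV. \<Prod>i\<in>UNIV. g i (x $ i)) = (\<Prod>i\<in>UNIV. g i 0 + g i 1)"
proof -
  have "(\<Prod>i\<in>UNIV. g i 0 + g i 1) = (\<Prod>i\<in>UNIV. \<Sum>b\<in>UNIV. g i b)"
  proof -
    have UNIV_bit: "(UNIV :: bit set) = {0, 1}" by auto
    have "(\<Sum>b\<in>UNIV. g i b) = g i 0 + g i 1" for i
      unfolding UNIV_bit by simp
    then show ?thesis by simp
  qed
  also have "\<dots> = (\<Sum>h\<in>PiE UNIV (\<lambda>_. UNIV). \<Prod>i\<in>UNIV. g i (h i))"
    by (rule prod_sum_PiE) auto
  also have "\<dots> = (\<Sum>x\<in>UNIV. \<Prod>i\<in>UNIV. g i (x $ i))"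
    by (rule sum.reindex_bij_witness[of _ "\<lambda>x i. x $ i" vec_lambda]) auto
  finally show ?thesis ..
qed

text \<open>Orthogonality of characters: translation by a codeword \<open>d\<close> that is not orthogonal to \<open>x\<close>
  permutes the code and changes the sign of every summand.\<close>

lemma sum_bit_sign_code:
  assumes "linear_code C"
  shows "(\<Sum>c\<in>C. bit_sign (scalar_product c x)) =
           (if x \<in> dual_code C then real (card C) else 0)"
proof (cases "x \<in> dual_code C")
  case True
  then have "bit_sign (scalar_product c x) = 1" if "c \<in> C" for c
    using that by (simp add: dual_code_def)
  then show ?thesis using True by simp
next
  case False
  then obtain d where d: "d \<in> C" "scalar_product d x = 1"
    by (auto simp: dual_code_def)
  have add: "scalar_product (c + d) x = scalar_product c x + scalar_product d x" for c
    unfolding scalar_product_def sum.distrib[symmetric]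
    by (simp only: vector_add_component distrib_right)
  have sub: "vec.subspace C"
    using assms by (simp add: linear_code_def)
  have dd: "c + d + d = c" for c :: "bit ^ 'a"
    by (simp add: vec_eq_iff add.assoc)
  have "(\<Sum>c\<in>C. bit_sign (scalar_product c x)) = (\<Sum>c\<in>C. bit_sign (scalar_product (c + d) x))"
    by (rule sum.reindex_bij_witness[of _ "\<lambda>c. c + d" "\<lambda>c. c + d"])
       (auto simp: dd vec.subspace_add[OF sub] d)
  also have "\<dots> = - (\<Sum>c\<in>C. bit_sign (scalar_product c x))"
    by (simp only: add bit_sign_add d bit_sign_simps mult_minus1_right sum_negf)
  finally show ?thesis using False by simp
qed

text \<open>Multiplied out, the product on the right is the Fourier transform of \<open>x \<mapsto> \<Prod>i. g i (x $ i)\<close>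
  at \<open>c\<close>. Summed over the code, orthogonality of characters keeps only the \<open>x\<close> in the dual code,
  which is the code itself. The local factors \<open>g i\<close> may depend on \<open>i\<close>, so that single coordinates
  can be marked.\<close>

lemma poisson_self_dual_code:
  fixes g :: "'n::finite \<Rightarrow> bit \<Rightarrow> real"
  assumes "linear_code C" "self_dual_code C"
  shows "real (card C) * (\<Sum>c\<in>C. \<Prod>i\<in>UNIV. g i (c $ i)) =
           (\<Sum>c\<in>C. \<Prod>i\<in>UNIV. g i 0 + bit_sign (c $ i) * g i 1)"
proof -
  have "(\<Sum>c\<in>C. \<Prod>i\<in>UNIV. g i 0 + bit_sign (c $ i) * g i 1) =
        (\<Sum>c\<in>C. \<Prod>i\<in>UNIV. bit_sign (c $ i * 0) * g i 0 + bit_sign (c $ i * 1) * g i 1)"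
    by (simp only: mult_zero_right mult_1_right bit_sign_simps mult_1_left)
  also have "\<dots> = (\<Sum>c\<in>C. \<Sum>x\<in>UNIV. \<Prod>i\<in>UNIV. bit_sign (c $ i * x $ i) * g i (x $ i))"
    by (subst sum_vec_prod) (rule refl)
  also have "\<dots> = (\<Sum>c\<in>C. \<Sum>x\<in>UNIV. bit_sign (scalar_product c x) * (\<Prod>i\<in>UNIV. g i (x $ i)))"
    by (simp only: scalar_product_def bit_sign_sum prod.distrib)
  also have "\<dots> = (\<Sum>x\<in>UNIV. (\<Sum>c\<in>C. bit_sign (scalar_product c x)) * (\<Prod>i\<in>UNIV. g i (x $ i)))"
    by (subst sum.swap) (simp add: sum_distrib_right)
  also have "\<dots> = (\<Sum>x\<in>UNIV. if x \<in> C then real (card C) * (\<Prod>i\<in>UNIV. g i (x $ i)) else 0)"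
    using assms(2) by (intro sum.cong refl)
      (simp add: sum_bit_sign_code[OF assms(1)] self_dual_code_def)
  also have "\<dots> = real (card C) * (\<Sum>c\<in>C. \<Prod>i\<in>UNIV. g i (c $ i))"
    by (simp add: sum_distrib_left sum.If_cases)
  finally show ?thesis ..
qed

lemma card_self_dual_code:
  fixes C :: "(bit ^ 'n::finite) set"
  assumes "linear_code C" "self_dual_code C"
  shows "card C ^ 2 = 2 ^ CARD('n)"
proof -
  have 0: "0 \<in> C"
    using assms(1) by (simp add: linear_code_def vec.subspace_0)
  have eq: "(\<Prod>i\<in>UNIV. 1 + bit_sign (c $ i)) = (if c = 0 then 2 ^ CARD('n) else 0)" for c :: "bit ^ 'n"
    by (auto simp: vec_eq_iff bit_sign_def intro!: prod_zero)
  have "real (card C) * real (card C) = 2 ^ CARD('n)"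
    using poisson_self_dual_code[OF assms, of "\<lambda>_ _. 1"] 0 by (simp add: eq)
  then have "real (card C ^ 2) = real (2 ^ CARD('n))"
    by (simp add: power2_eq_square)
  then show ?thesis by (simp only: of_nat_eq_iff)
qed

text \<open>The MacWilliams identity for the weight enumerator in which the coordinates in \<open>T\<close> carry
  individual factors: outside \<open>T\<close> the local factor is \<open>1\<close> at \<open>0\<close> and \<open>y\<close> at \<open>1\<close>, with transform
  \<open>1 + y\<close> at \<open>0\<close> and \<open>1 - y\<close> at \<open>1\<close>.\<close>

lemma macwilliams_self_dual_code:
  fixes g :: "'n::finite \<Rightarrow> bit \<Rightarrow> real" and y :: real
  assumes "linear_code C" "self_dual_code C"
  shows "real (card C) * (\<Sum>c\<in>C. (\<Prod>i\<in>T. g i (c $ i)) * y ^ card (supp c - T)) =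
           (\<Sum>c\<in>C. (\<Prod>i\<in>T. g i 0 + bit_sign (c $ i) * g i 1) *
              ((1 + y) ^ (CARD('n) - card T - card (supp c - T)) * (1 - y) ^ card (supp c - T)))"
proof -
  define g' where "g' = (\<lambda>i b. if i \<in> T then g i b else if b = 0 then 1 else y)"
  have split: "(\<Prod>i\<in>UNIV. F i) = (\<Prod>i\<in>T. F i) * ((\<Prod>i\<in>- T - supp c. F i) * (\<Prod>i\<in>supp c - T. F i))"
    for F :: "'n \<Rightarrow> real" and c :: "bit ^ 'n"
  proof -
    have "(\<Prod>i\<in>UNIV. F i) = (\<Prod>i\<in>T. F i) * (\<Prod>i\<in>- T. F i)"
      by (metis Compl_eq_Diff_UNIV finite_code mult.commute prod.subset_diff subset_UNIV)
    also have "(\<Prod>i\<in>- T. F i) = (\<Prod>i\<in>- T - supp c. F i) * (\<Prod>i\<in>supp c - T. F i)"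
      by (subst prod.union_disjoint[symmetric]) (auto intro!: prod.cong)
    finally show ?thesis .
  qed
  have card: "card (- T - supp c) = CARD('n) - card T - card (supp c - T)" for c :: "bit ^ 'n"
  proof -
    have "card (- T) = CARD('n) - card T"
      by (metis Compl_eq_Diff_UNIV card_Diff_subset finite_code subset_UNIV)
    moreover have "- T - supp c = - T - (supp c - T)" by auto
    moreover have "card (- T - (supp c - T)) = card (- T) - card (supp c - T)"
      by (rule card_Diff_subset) auto
    ultimately show ?thesis by simp
  qed
  have l: "(\<Prod>i\<in>UNIV. g' i (c $ i)) = (\<Prod>i\<in>T. g i (c $ i)) * y ^ card (supp c - T)" for c
  proof -
    have "(\<Prod>i\<in>- T - supp c. g' i (c $ i)) = 1"
      by (rule prod.neutral) (auto simp: g'_def supp_def)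
    moreover have "(\<Prod>i\<in>supp c - T. g' i (c $ i)) = (\<Prod>i\<in>supp c - T. y)"
      by (rule prod.cong) (auto simp: g'_def supp_def)
    moreover have "(\<Prod>i\<in>T. g' i (c $ i)) = (\<Prod>i\<in>T. g i (c $ i))"
      by (rule prod.cong) (auto simp: g'_def)
    ultimately show ?thesis by (simp add: split[of _ c])
  qed
  have r: "(\<Prod>i\<in>UNIV. g' i 0 + bit_sign (c $ i) * g' i 1) =
      (\<Prod>i\<in>T. g i 0 + bit_sign (c $ i) * g i 1) *
        ((1 + y) ^ (CARD('n) - card T - card (supp c - T)) * (1 - y) ^ card (supp c - T))" for c
  proof -
    have "(\<Prod>i\<in>- T - supp c. g' i 0 + bit_sign (c $ i) * g' i 1) = (\<Prod>i\<in>- T - supp c. 1 + y)"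
      by (rule prod.cong) (auto simp: g'_def supp_def)
    moreover have "(\<Prod>i\<in>supp c - T. g' i 0 + bit_sign (c $ i) * g' i 1) = (\<Prod>i\<in>supp c - T. 1 - y)"
      by (rule prod.cong) (auto simp: g'_def supp_def)
    moreover have "(\<Prod>i\<in>T. g' i 0 + bit_sign (c $ i) * g' i 1) =
        (\<Prod>i\<in>T. g i 0 + bit_sign (c $ i) * g i 1)"
      by (rule prod.cong) (auto simp: g'_def)
    ultimately show ?thesis by (simp add: split[of _ c] card)
  qed
  show ?thesis
    using poisson_self_dual_code[OF assms, of g'] by (simp add: l r)
qed

section \<open>Polynomials with a MacWilliams functional equation\<close>

lemma pcompose_power: "pcompose (p ^ n) q = pcompose p q ^ n" for p :: "real poly"
  by (induction n) (auto simp: pcompose_mult pcompose_1)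

text \<open>The polynomial \<open>y^N - 1\<close> has a simple zero at \<open>1\<close>, so substituting \<open>z = y^N\<close> preserves the
  order of vanishing at \<open>1\<close>.\<close>

lemma power_dvd_pcompose_monom_imp_dvd:
  fixes R :: "real poly"
  assumes "N > 0" "[:-1, 1:] ^ m dvd monom 1 k * pcompose R (monom 1 N)"
  shows "[:-1, 1:] ^ m dvd R"
proof (cases "R = 0")
  case False
  obtain S where S: "R = [:-1, 1:] ^ order 1 R * S" "\<not> [:-1, 1:] dvd S"
    using order_decomp[OF False, of 1] by auto
  define o1 where "o1 = order 1 R"
  have R: "R = [:-1, 1:] ^ o1 * S"
    using S(1) by (simp add: o1_def)
  have "poly (monom 1 N + [:-1:]) (1::real) = 0"
    by (simp add: poly_monom)
  then have "[:-1, 1:] dvd monom (1::real) N + [:-1:]"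
    by (subst (asm) poly_eq_0_iff_dvd) simp
  then obtain V where V: "monom (1::real) N + [:-1:] = [:-1, 1:] * V"
    by (elim dvdE)
  \<comment> \<open>The derivative at \<open>1\<close> shows that the zero is simple.\<close>
  have "poly (pderiv (monom (1::real) N + [:-1:])) 1 = poly (pderiv ([:-1, 1:] * V)) 1"
    by (simp only: V)
  then have V1: "poly V 1 = real N"
    by (simp add: pderiv_add pderiv_diff pderiv_mult pderiv_monom poly_monom pderiv_pCons)
  define U where "U = monom 1 k * (V ^ o1 * pcompose S (monom 1 N))"
  have "pcompose [:-1, 1:] (monom (1::real) N) = [:-1, 1:] * V"
    unfolding V[symmetric] by (simp add: pcompose_pCons)
  then have "monom 1 k * pcompose R (monom 1 N) = [:-1, 1:] ^ o1 * U"
    by (subst R) (simp only: U_def pcompose_mult pcompose_power power_mult_distrib mult_ac)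
  then have dvd: "[:-1, 1:] ^ m dvd [:-1, 1:] ^ o1 * U"
    using assms by simp
  have "poly S 1 \<noteq> 0"
    using S(2) by (simp add: poly_eq_0_iff_dvd)
  then have U1: "poly U 1 \<noteq> 0"
    using V1 assms by (simp add: U_def poly_monom poly_pcompose)
  have "m \<le> o1"
  proof (rule ccontr)
    assume "\<not> m \<le> o1"
    then have "[:-1, 1:] ^ Suc o1 dvd [:-1, 1:] ^ o1 * U"
      using dvd by (meson not_less_eq_eq power_le_dvd)
    then have "[:-1, 1:] dvd U"
      unfolding power_Suc2 by (subst (asm) dvd_times_left_cancel_iff) auto
    then show False
      using U1 by (simp add: poly_eq_0_iff_dvd)
  qed
  then show ?thesis
    by (subst R) (simp add: dvd_mult2 le_imp_power_dvd)
qed simp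

text \<open>On the right-hand side every summand contains \<open>(1-y)^k\<close>, so the left-hand side vanishes at
  \<open>1\<close> to order \<open>k\<close>. As a polynomial in \<open>z = y^4\<close> it inherits this zero, and its degree leaves few
  degrees of freedom.\<close>

lemma macwilliams_divisibility:
  fixes r :: "nat \<Rightarrow> real"
  assumes "K \<noteq> 0" "k \<le> N"
    and "\<And>y. K * (\<Sum>j\<le>N. r j * y ^ (k + 4 * j)) =
              s * (\<Sum>j\<le>N. r j * ((1 + y) ^ (e j) * (1 - y) ^ (k + 4 * j)))"
  obtains q where "(\<Sum>j\<le>N. monom (r j) j) = [:-1, 1:] ^ k * q" "degree q \<le> N - k"
proof -
  define R where "R = (\<Sum>j\<le>N. monom (r j) j)"
  define S where "S = smult (s * (-1) ^ k) (\<Sum>j\<le>N. smult (r j) ([:1, 1:] ^ e j * [:1, -1:] ^ (4 * j)))"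
  have "smult K (monom 1 k * pcompose R (monom 1 4)) = [:-1, 1:] ^ k * S"
  proof (rule poly_eq_poly_eq_iff[THEN iffD1], rule ext)
    fix y :: real
    have "poly (smult K (monom 1 k * pcompose R (monom 1 4))) y =
          K * (\<Sum>j\<le>N. r j * y ^ (k + 4 * j))"
      by (simp add: R_def poly_pcompose poly_sum poly_monom sum_distrib_left power_add mult_ac
          flip: power_mult)
    also have "\<dots> = s * (\<Sum>j\<le>N. r j * ((1 + y) ^ (e j) * (1 - y) ^ (k + 4 * j)))"
      by (rule assms)
    also have "(1 - y) ^ k = (-1) ^ k * (y - 1) ^ k"
      by (metis minus_diff_eq mult_minus1 power_mult_distrib)
    then have "s * (\<Sum>j\<le>N. r j * ((1 + y) ^ (e j) * (1 - y) ^ (k + 4 * j))) =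
       poly ([:-1, 1:] ^ k * S) y"
      by (simp add: S_def poly_sum power_add sum_distrib_left mult_ac)
    finally show "poly (smult K (monom 1 k * pcompose R (monom 1 4))) y = poly ([:-1, 1:] ^ k * S) y" .
  qed
  then have "[:-1, 1:] ^ k dvd smult K (monom 1 k * pcompose R (monom 1 4))"
    by simp
  then have "[:-1, 1:] ^ k dvd monom 1 k * pcompose R (monom 1 4)"
    using assms(1) by (simp add: dvd_smult_iff)
  then have "[:-1, 1:] ^ k dvd R"
    by (intro power_dvd_pcompose_monom_imp_dvd[of 4 k k R]) auto
  then obtain q where q: "R = [:-1, 1:] ^ k * q"
    by (elim dvdE)
  have "degree q \<le> N - k"
  proof (cases "q = 0")
    case False
    have "degree R = k + degree q"
      unfolding q using False by (subst degree_mult_eq) (auto simp: degree_power_eq)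
    moreover have "degree R \<le> N"
      unfolding R_def by (intro degree_sum_le) (auto intro: order_trans[OF degree_monom_le])
    ultimately show ?thesis by simp
  qed simp
  with q show ?thesis
    using that by (simp add: R_def)
qed

lemma degree_le_2_cases:
  assumes "degree (q :: real poly) \<le> 2"
  obtains a b c where "q = [:a, b, c:]"
proof -
  have "q = [:coeff q 0, coeff q 1, coeff q 2:]"
    by (rule poly_eqI)
      (use assms in \<open>auto simp: coeff_pCons numeral_2_eq_2 coeff_eq_0 split: nat.splits\<close>)
  then show ?thesis using that by blast
qed

text \<open>What divisibility and antisymmetry leave is \<open>a (z-1)^15 (z+1)\<close> with \<open>z = y^4\<close>. The
  transformation \<open>y \<mapsto> (1-y)/(1+y)\<close> fixes \<open>sqrt 2 - 1\<close>, where the equation says that the value is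
  its own negative; but the remaining factors do not vanish there, so \<open>a = 0\<close>.\<close>

lemma odd_macwilliams_vanishes:
  fixes r :: "nat \<Rightarrow> real"
  assumes sym: "r 16 = - r 0"
    and eq: "\<And>y. 2 ^ 48 * (\<Sum>j\<le>16. r j * y ^ (15 + 4 * j)) =
              - 2 * (\<Sum>j\<le>16. r j * ((1 + y) ^ (79 - 4 * j) * (1 - y) ^ (15 + 4 * j)))"
    and j: "j \<le> 16"
  shows "r j = 0"
proof -
  obtain q where q: "(\<Sum>j\<le>16. monom (r j) j) = [:-1, 1:] ^ 15 * q" "degree q \<le> 1"
    using macwilliams_divisibility[of "2 ^ 48" 15 16 r "-2" "\<lambda>j. 79 - 4 * j"] eq by auto
  have "degree q \<le> 2" using q(2) by simp
  then obtain a b c where abc: "q = [:a, b, c:]" by (rule degree_le_2_cases)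
  with q(2) have "c = 0" by (auto split: if_splits)
  with abc have q': "q = [:a, b:]" by simp
  have coeff: "r i = coeff ([:-1, 1:] ^ 15 * q) i" if "i \<le> 16" for i
    unfolding q(1)[symmetric] using that by (simp add: coeff_sum sum.delta)
  have "r 0 = - a"
    by (subst coeff) (simp_all add: q' numeral_eq_Suc)
  moreover have "r 16 = b"
    by (subst coeff) (simp_all add: q' numeral_eq_Suc)
  ultimately have "b = a" using sym by simp
  define y :: real where "y = sqrt 2 - 1"
  have y: "0 < y" "y < 1" "1 - y = y * (1 + y)" "(1 + y) ^ 2 = 2"
    using real_sqrt_less_mono[of 1 2] real_sqrt_less_mono[of 2 4]
    by (auto simp: y_def algebra_simps power2_eq_square)
  have eval: "(\<Sum>j\<le>16. r j * y ^ (15 + 4 * j)) = y ^ 15 * ((y ^ 4 - 1) ^ 15 * (a + a * y ^ 4))"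
  proof -
    have "(\<Sum>j\<le>16. r j * y ^ (15 + 4 * j)) = y ^ 15 * poly (\<Sum>j\<le>16. monom (r j) j) (y ^ 4)"
      by (simp add: poly_sum poly_monom sum_distrib_left power_add mult_ac flip: power_mult)
    then show ?thesis
      unfolding q(1) q' \<open>b = a\<close> by (simp add: algebra_simps)
  qed
  have "(1 + y) ^ (79 - 4 * j) * (1 - y) ^ (15 + 4 * j) = 2 ^ 47 * y ^ (15 + 4 * j)" if "j \<le> 16" for j
  proof -
    have "(1 + y) ^ (79 - 4 * j) * (1 - y) ^ (15 + 4 * j) =
        y ^ (15 + 4 * j) * ((1 + y) ^ ((79 - 4 * j) + (15 + 4 * j)))"
      by (simp only: y(3) power_mult_distrib power_add mult_ac)
    also have "(79 - 4 * j) + (15 + 4 * j) = 2 * 47"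
      using that by simp
    finally show ?thesis
      by (simp only: power_mult y(4) mult_ac)
  qed
  then have "2 ^ 48 * (\<Sum>j\<le>16. r j * y ^ (15 + 4 * j)) =
      - 2 * (\<Sum>j\<le>16. r j * (2 ^ 47 * y ^ (15 + 4 * j)))"
    unfolding eq by simp
  also have "\<dots> = - (2 ^ 48) * (\<Sum>j\<le>16. r j * y ^ (15 + 4 * j))"
    unfolding sum_distrib_left by (rule sum.cong) auto
  finally have "(\<Sum>j\<le>16. r j * y ^ (15 + 4 * j)) = 0"
    by simp
  moreover have "y ^ 4 < 1" "y ^ 4 > 0" using y by (auto simp: power_less_one_iff)
  ultimately have "a + a * y ^ 4 = 0"
    using y(1) unfolding eval by (simp del: distrib_left)
  then have "a * (1 + y ^ 4) = 0"
    by (simp add: distrib_left)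
  moreover have "1 + y ^ 4 > 0" using \<open>y ^ 4 > 0\<close> by linarith
  ultimately have "a = 0" by simp
  then show ?thesis
    using coeff[OF j] by (simp add: q' \<open>b = a\<close>)
qed

text \<open>What divisibility and symmetry leave is \<open>(z-1)^14 (a + b z + a z^2)\<close> with \<open>z = y^4\<close>, in
  which the coefficient of \<open>z\<close> is \<open>b - 14 a\<close>. The functional equation exchanges \<open>1/3\<close> and \<open>1/2\<close>,
  and comparing the two values gives \<open>b = 14 a\<close>.\<close>

lemma even_macwilliams_second_coefficient:
  fixes r :: "nat \<Rightarrow> real"
  assumes sym: "r 16 = r 0"
    and eq: "\<And>y. 2 ^ 48 * (\<Sum>j\<le>16. r j * y ^ (14 + 4 * j)) =
              4 * (\<Sum>j\<le>16. r j * ((1 + y) ^ (78 - 4 * j) * (1 - y) ^ (14 + 4 * j)))"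
  shows "r 1 = 0"
proof -
  obtain q where q: "(\<Sum>j\<le>16. monom (r j) j) = [:-1, 1:] ^ 14 * q" "degree q \<le> 2"
    using macwilliams_divisibility[of "2 ^ 48" 14 16 r "4" "\<lambda>j. 78 - 4 * j"] eq by auto
  obtain a b c where abc: "q = [:a, b, c:]"
    using q(2) by (rule degree_le_2_cases)
  have coeff: "r i = coeff ([:-1, 1:] ^ 14 * q) i" if "i \<le> 16" for i
    unfolding q(1)[symmetric] using that by (simp add: coeff_sum sum.delta)
  have "r 0 = a"
    by (subst coeff) (simp_all add: abc numeral_eq_Suc)
  moreover have "r 16 = c"
    by (subst coeff) (simp_all add: abc numeral_eq_Suc)
  ultimately have "c = a" using sym by simp
  have r1: "r 1 = b - 14 * a"
    by (subst coeff) (simp_all add: abc numeral_eq_Suc)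
  have eval: "(\<Sum>j\<le>16. r j * y ^ (14 + 4 * j)) = y ^ 14 * ((y ^ 4 - 1) ^ 14 * (a + b * y ^ 4 + a * y ^ 8))"
    for y
  proof -
    have "(\<Sum>j\<le>16. r j * y ^ (14 + 4 * j)) = y ^ 14 * poly (\<Sum>j\<le>16. monom (r j) j) (y ^ 4)"
      by (simp add: poly_sum poly_monom sum_distrib_left power_add mult_ac flip: power_mult)
    also have "y ^ 8 = y ^ 4 * y ^ 4" by (simp flip: power_add)
    then have "y ^ 14 * poly (\<Sum>j\<le>16. monom (r j) j) (y ^ 4) =
       y ^ 14 * ((y ^ 4 - 1) ^ 14 * (a + b * y ^ 4 + a * y ^ 8))"
      unfolding q(1) abc \<open>c = a\<close> by (simp add: algebra_simps)
    finally show ?thesis .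
  qed
  \<comment> \<open>The image of \<open>1/3\<close> under \<open>y \<mapsto> (1-y)/(1+y)\<close> is \<open>1/2\<close>.\<close>
  have "(1 + 1 / 3) ^ (78 - 4 * j) * (1 - 1 / 3) ^ (14 + 4 * j) =
      (4 / 3) ^ 92 * (1 / 2 :: real) ^ (14 + 4 * j)" if "j \<le> 16" for j
  proof -
    have "(1 + 1 / 3) ^ (78 - 4 * j) * (1 - 1 / 3) ^ (14 + 4 * j) =
        (4 / 3) ^ (78 - 4 * j) * (4 / 3 * (1 / 2 :: real)) ^ (14 + 4 * j)"
      by simp
    also have "\<dots> = (4 / 3) ^ ((78 - 4 * j) + (14 + 4 * j)) * (1 / 2) ^ (14 + 4 * j)"
      by (simp only: power_mult_distrib power_add mult_ac)
    also have "(78 - 4 * j) + (14 + 4 * j) = 92" using that by simp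
    finally show ?thesis .
  qed
  then have "2 ^ 48 * (\<Sum>j\<le>16. r j * (1 / 3) ^ (14 + 4 * j)) =
      4 * (\<Sum>j\<le>16. r j * ((4 / 3) ^ 92 * (1 / 2) ^ (14 + 4 * j)))"
    unfolding eq by simp
  also have "\<dots> = 4 * (4 / 3) ^ 92 * (\<Sum>j\<le>16. r j * (1 / 2) ^ (14 + 4 * j))"
    unfolding sum_distrib_left by (rule sum.cong) (simp_all only: mult_ac)
  finally have "2 ^ 48 * ((1/3) ^ 14 * (((1/3) ^ 4 - 1) ^ 14 * (a + b * (1/3) ^ 4 + a * (1/3) ^ 8))) =
     4 * (4 / 3) ^ 92 * ((1/2) ^ 14 * (((1/2) ^ 4 - 1) ^ 14 * (a + b * (1/2) ^ 4 + a * (1/2) ^ 8)))"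
    by (simp only: eval)
  then have "b = 14 * a"
    by (simp add: field_simps)
  then show ?thesis using r1 by simp
qed

section \<open>Extremal codes of length 96\<close>

lemma bit_val_add_one: "bit_val (b + 1) = 1 - bit_val b"
  by (cases b) auto

lemma bit_sign_eq_bit_val: "bit_sign b = 1 - 2 * bit_val b"
  by (cases b) auto

lemma one_mem_self_dual_code:
  assumes "self_dual_code C" "doubly_even_code C"
  shows "1 \<in> C"
proof -
  have "scalar_product c 1 = 0" if "c \<in> C" for c
  proof -
    have "bit_sign (scalar_product c 1) = (\<Prod>i\<in>UNIV. bit_sign (c $ i))"
      by (simp only: scalar_product_def bit_sign_sum one_index mult_1_right)
    also have "\<dots> = (\<Prod>i\<in>supp c. bit_sign (c $ i))"
      by (rule prod.mono_neutral_right) (auto simp: supp_def)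
    also have "\<dots> = (\<Prod>i\<in>supp c. - 1)"
      by (rule prod.cong) (auto simp: supp_def)
    also have "\<dots> = 1"
      using that assms(2) by (auto simp: doubly_even_code_def wt_def elim!: dvdE)
    finally show ?thesis
      by (auto simp: bit_sign_def split: if_splits)
  qed
  then have "1 \<in> dual_code C"
    by (simp add: dual_code_def)
  then show ?thesis
    using assms(1) by (simp add: self_dual_code_def)
qed

lemma supp_add_one: "supp (c + 1) = - supp c"
  by (auto simp: supp_def)

lemma wt_add_one: "wt (c + 1) = CARD('n) - wt c" for c :: "bit ^ 'n::finite"
  unfolding wt_def supp_add_one
  by (metis Compl_eq_Diff_UNIV card_Diff_subset finite_code subset_UNIV)

lemma add_one_add_one [simp]: "c + 1 + 1 = (c :: bit ^ 'n::finite)"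
  by (simp add: vec_eq_iff add.assoc)

lemma add_one_mem_code:
  assumes "linear_code C" "self_dual_code C" "doubly_even_code C" "c \<in> C"
  shows "c + 1 \<in> C"
  using assms one_mem_self_dual_code[of C] vec.subspace_add[of C c 1]
  by (simp add: linear_code_def)

locale self_dual_code_96_16 =
  fixes C :: "(bit ^ 96) set"
  assumes linear: "linear_code C" and self_dual: "self_dual_code C"
    and doubly_even: "doubly_even_code C" and min_weight: "has_minimum_weight C 16"
begin

text \<open>Complements of codewords are codewords, so the minimum weight also bounds the weights from
  above.\<close>

lemma weight_cases:
  assumes "c \<in> C" "c \<noteq> 0" "c \<noteq> 1"
  obtains j where "j \<le> 16" "wt c = 16 + 4 * j"
proof -
  have "wt c \<ge> 16"
    using assms min_weight by (auto simp: has_minimum_weight_def)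
  moreover have "c + 1 \<noteq> 0"
    using assms(3) by (metis add_0 add_one_add_one)
  then have "wt (c + 1) \<ge> 16"
    using add_one_mem_code[OF linear self_dual doubly_even assms(1)] min_weight
    by (auto simp: has_minimum_weight_def)
  then have "wt c \<le> 80"
    by (simp add: wt_add_one)
  moreover have "4 dvd wt c"
    using assms doubly_even by (auto simp: doubly_even_code_def)
  then obtain m where "wt c = 4 * m" by (elim dvdE)
  ultimately show ?thesis
    by (intro that[of "m - 4"]) auto
qed

lemma sum_by_weight:
  fixes \<phi> :: "bit ^ 96 \<Rightarrow> real"
  assumes "\<phi> 0 = 0" "\<phi> 1 = 0"
  shows "(\<Sum>c\<in>C. \<phi> c * G (wt c)) =
           (\<Sum>j\<le>16. (\<Sum>c\<in>codewords_of_weight C (16 + 4 * j). \<phi> c) * G (16 + 4 * j))"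
proof -
  have "(\<Sum>j\<le>16. (\<Sum>c\<in>codewords_of_weight C (16 + 4 * j). \<phi> c) * G (16 + 4 * j)) =
        (\<Sum>j\<le>16. \<Sum>c\<in>codewords_of_weight C (16 + 4 * j). \<phi> c * G (wt c))"
    by (intro sum.cong refl) (simp add: sum_distrib_right codewords_of_weight_def)
  also have "\<dots> = (\<Sum>c\<in>(\<Union>j\<in>{..16}. codewords_of_weight C (16 + 4 * j)). \<phi> c * G (wt c))"
    by (rule sum.UNION_disjoint[symmetric]) (auto simp: codewords_of_weight_def)
  also have "\<dots> = (\<Sum>c\<in>C. \<phi> c * G (wt c))"
  proof (rule sum.mono_neutral_left)
    show "\<forall>c\<in>C - (\<Union>j\<in>{..16}. codewords_of_weight C (16 + 4 * j)). \<phi> c * G (wt c) = 0"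
    proof
      fix c assume c: "c \<in> C - (\<Union>j\<in>{..16}. codewords_of_weight C (16 + 4 * j))"
      then have "c = 0 \<or> c = 1"
        using weight_cases[of c] by (auto simp: codewords_of_weight_def)
      then show "\<phi> c * G (wt c) = 0" using assms by auto
    qed
  qed (auto simp: codewords_of_weight_def)
  finally show ?thesis ..
qed

lemma card_code: "real (card C) = 2 ^ 48"
proof -
  have "card C ^ 2 = (2 ^ 48) ^ 2"
    using card_self_dual_code[OF linear self_dual] by simp
  then have "card C = 2 ^ 48"
    by (rule power2_eq_imp_eq) auto
  then show ?thesis by simp
qed

lemma sum_complement:
  fixes \<phi> :: "bit ^ 96 \<Rightarrow> real"
  assumes "w \<le> 96"
  shows "(\<Sum>c\<in>codewords_of_weight C (96 - w). \<phi> c) = (\<Sum>c\<in>codewords_of_weight C w. \<phi> (c + 1))"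
  by (rule sum.reindex_bij_witness[of _ "\<lambda>c. c + 1" "\<lambda>c. c + 1"])
     (use assms in \<open>auto simp: codewords_of_weight_def wt_add_one
        intro!: add_one_mem_code[OF linear self_dual doubly_even]\<close>)

text \<open>The function \<open>\<phi> c = c_i - c_l\<close> lives on the codewords that contain exactly one of the two
  coordinates; it is the difference of two products of local factors, to which the MacWilliams
  identity applies. Replacing a codeword by its complement changes the sign of \<open>\<phi>\<close>.\<close>

lemma coordinate_sums_equal:
  assumes "w = 20 \<or> w = 76"
  shows "(\<Sum>c\<in>codewords_of_weight C w. bit_val (c $ i)) = (\<Sum>c\<in>codewords_of_weight C w. bit_val (c $ l))"
proof (cases "i = l")
  case False
  define \<phi> :: "bit ^ 96 \<Rightarrow> real" where "\<phi> = (\<lambda>c. bit_val (c $ i) - bit_val (c $ l))"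
  define r where "r = (\<lambda>j. \<Sum>c\<in>codewords_of_weight C (16 + 4 * j). \<phi> c)"
  have card: "card (supp c - {i, l}) = wt c - 1" if "\<phi> c \<noteq> 0" for c
  proof -
    have "card (supp c - {i, l}) = card (supp c) - card (supp c \<inter> {i, l})"
      by (rule card_Diff_subset_Int) auto
    also have "supp c \<inter> {i, l} = {i} \<or> supp c \<inter> {i, l} = {l}"
      using that by (auto simp: \<phi>_def supp_def bit_val_def split: if_splits)
    then have "card (supp c \<inter> {i, l}) = 1" by auto
    finally show ?thesis by (simp add: wt_def)
  qed
  have half: "2 ^ 48 * (\<Sum>c\<in>C. bit_val (c $ i) * (1 - bit_val (c $ l)) * y ^ card (supp c - {i, l})) =
        (\<Sum>c\<in>C. bit_sign (c $ i) * ((1 + y) ^ (94 - card (supp c - {i, l})) * (1 - y) ^ card (supp c - {i, l})))"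
    if "i \<noteq> l" for i l and y :: real
    using macwilliams_self_dual_code[OF linear self_dual,
        of "\<lambda>m b. if m = i then bit_val b else 1 - bit_val b" "{i, l}" y] that
    by (simp add: card_code)
  have eq: "2 ^ 48 * (\<Sum>j\<le>16. r j * y ^ (15 + 4 * j)) =
              - 2 * (\<Sum>j\<le>16. r j * ((1 + y) ^ (79 - 4 * j) * (1 - y) ^ (15 + 4 * j)))" for y
  proof -
    have "(\<Sum>j\<le>16. r j * y ^ (15 + 4 * j)) = (\<Sum>c\<in>C. \<phi> c * y ^ (wt c - 1))"
      unfolding r_def by (subst sum_by_weight) (auto simp: \<phi>_def)
    also have "\<dots> = (\<Sum>c\<in>C. \<phi> c * y ^ card (supp c - {i, l}))"
    proof (rule sum.cong)
      fix c show "\<phi> c * y ^ (wt c - 1) = \<phi> c * y ^ card (supp c - {i, l})"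
        using card[of c] by (cases "\<phi> c = 0") auto
    qed simp
    also have "\<dots> = (\<Sum>c\<in>C. bit_val (c $ i) * (1 - bit_val (c $ l)) * y ^ card (supp c - {i, l})) -
        (\<Sum>c\<in>C. bit_val (c $ l) * (1 - bit_val (c $ i)) * y ^ card (supp c - {l, i}))"
      by (simp add: \<phi>_def sum_subtractf[symmetric] insert_commute algebra_simps)
    finally have "2 ^ 48 * (\<Sum>j\<le>16. r j * y ^ (15 + 4 * j)) =
       (\<Sum>c\<in>C. bit_sign (c $ i) * ((1 + y) ^ (94 - card (supp c - {i, l})) * (1 - y) ^ card (supp c - {i, l}))) -
       (\<Sum>c\<in>C. bit_sign (c $ l) * ((1 + y) ^ (94 - card (supp c - {l, i})) * (1 - y) ^ card (supp c - {l, i})))"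
      using half[OF False, of y] half[OF False[symmetric], of y] by (simp only: right_diff_distrib)
    also have "\<dots> = - 2 * (\<Sum>c\<in>C. \<phi> c * ((1 + y) ^ (94 - card (supp c - {i, l})) * (1 - y) ^ card (supp c - {i, l})))"
      unfolding sum_subtractf[symmetric] sum_distrib_left
      by (rule sum.cong) (simp_all add: \<phi>_def insert_commute bit_sign_eq_bit_val algebra_simps)
    also have "(\<Sum>c\<in>C. \<phi> c * ((1 + y) ^ (94 - card (supp c - {i, l})) * (1 - y) ^ card (supp c - {i, l}))) =
      (\<Sum>c\<in>C. \<phi> c * ((1 + y) ^ (94 - (wt c - 1)) * (1 - y) ^ (wt c - 1)))"
    proof (rule sum.cong)
      fix c show "\<phi> c * ((1 + y) ^ (94 - card (supp c - {i, l})) * (1 - y) ^ card (supp c - {i, l})) =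
         \<phi> c * ((1 + y) ^ (94 - (wt c - 1)) * (1 - y) ^ (wt c - 1))"
        using card[of c] by (cases "\<phi> c = 0") auto
    qed simp
    also have "\<dots> = (\<Sum>j\<le>16. r j * ((1 + y) ^ (79 - 4 * j) * (1 - y) ^ (15 + 4 * j)))"
      unfolding r_def by (subst sum_by_weight) (auto simp: \<phi>_def)
    finally show ?thesis .
  qed
  have "\<phi> (c + 1) = - \<phi> c" for c
    unfolding \<phi>_def vector_add_component one_index bit_val_add_one by simp
  then have sym: "r 16 = - r 0"
    unfolding r_def using sum_complement[of 16 \<phi>] by (simp add: sum_negf)
  have "r 1 = 0" "r 15 = 0"
    using odd_macwilliams_vanishes[of r, OF sym eq] by auto
  then show ?thesis
    using assms by (auto simp: r_def \<phi>_def sum_subtractf)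
qed simp

text \<open>The function \<open>\<phi> c = (c_i - c_l) (c_k - c_m)\<close> lives on the codewords that meet each of the
  pairs \<open>{i, l}\<close> and \<open>{k, m}\<close> in exactly one coordinate, hence \<open>T\<close> in two. It is an alternating
  sum of four products of local factors, and it is invariant under complementation.\<close>

lemma quadruple_sum_eq_0:
  assumes "distinct [i, l, k, m]"
  shows "(\<Sum>c\<in>codewords_of_weight C 20.
           (bit_val (c $ i) - bit_val (c $ l)) * (bit_val (c $ k) - bit_val (c $ m))) = 0"
proof -
  define \<phi> :: "bit ^ 96 \<Rightarrow> real"
    where "\<phi> = (\<lambda>c. (bit_val (c $ i) - bit_val (c $ l)) * (bit_val (c $ k) - bit_val (c $ m)))"
  define r where "r = (\<lambda>j. \<Sum>c\<in>codewords_of_weight C (16 + 4 * j). \<phi> c)"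
  define T where "T = {i, l, k, m}"
  define d where "d = (\<lambda>c. card (supp c - T))"
  have card: "d c = wt c - 2" if "\<phi> c \<noteq> 0" for c
  proof -
    have "d c = card (supp c) - card (supp c \<inter> T)"
      unfolding d_def by (rule card_Diff_subset_Int) auto
    have "supp c \<inter> T \<in> {{i, k}, {i, m}, {l, k}, {l, m}}"
      using that by (auto simp: \<phi>_def supp_def bit_val_def T_def split: if_splits)
    moreover have "\<forall>S\<in>{{i, k}, {i, m}, {l, k}, {l, m}}. card S = 2"
      using assms by simp
    ultimately have "card (supp c \<inter> T) = 2" by blast
    with \<open>d c = card (supp c) - card (supp c \<inter> T)\<close> show ?thesis
      by (simp add: wt_def)
  qed
  have quarter: "2 ^ 48 * (\<Sum>c\<in>C. bit_val (c $ i) * (1 - bit_val (c $ l)) *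
        (bit_val (c $ k) * (1 - bit_val (c $ m))) * y ^ d c) =
        (\<Sum>c\<in>C. bit_sign (c $ i) * bit_sign (c $ k) * ((1 + y) ^ (92 - d c) * (1 - y) ^ d c))"
    if "distinct [i, l, k, m]" "T = {i, l, k, m}" for i l k m and y :: real
  proof -
    have "l \<noteq> i" "k \<noteq> i" "m \<noteq> i" "l \<noteq> k" "m \<noteq> l" "m \<noteq> k"
      using that(1) by auto
    then show ?thesis
    using macwilliams_self_dual_code[OF linear self_dual,
        of "\<lambda>n b. if n = i \<or> n = k then bit_val b else 1 - bit_val b" T y] that
    by (simp add: card_code d_def mult.assoc)
  qed
  have eq: "2 ^ 48 * (\<Sum>j\<le>16. r j * y ^ (14 + 4 * j)) =
              4 * (\<Sum>j\<le>16. r j * ((1 + y) ^ (78 - 4 * j) * (1 - y) ^ (14 + 4 * j)))" for y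
  proof -
    let ?L = "\<lambda>i l k m. \<Sum>c\<in>C. bit_val (c $ i) * (1 - bit_val (c $ l)) *
        (bit_val (c $ k) * (1 - bit_val (c $ m))) * y ^ d c"
    let ?R = "\<lambda>i k. \<Sum>c\<in>C. bit_sign (c $ i) * bit_sign (c $ k) * ((1 + y) ^ (92 - d c) * (1 - y) ^ d c)"
    have "(\<Sum>j\<le>16. r j * y ^ (14 + 4 * j)) = (\<Sum>c\<in>C. \<phi> c * y ^ (wt c - 2))"
      unfolding r_def by (subst sum_by_weight) (auto simp: \<phi>_def)
    also have "\<dots> = (\<Sum>c\<in>C. \<phi> c * y ^ d c)"
    proof (rule sum.cong)
      fix c show "\<phi> c * y ^ (wt c - 2) = \<phi> c * y ^ d c"
        using card[of c] by (cases "\<phi> c = 0") auto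
    qed simp
    also have "\<dots> = ?L i l k m - ?L i l m k - ?L l i k m + ?L l i m k"
      unfolding sum_subtractf[symmetric] sum.distrib[symmetric]
      by (rule sum.cong) (simp_all add: \<phi>_def algebra_simps)
    finally have e: "(\<Sum>j\<le>16. r j * y ^ (14 + 4 * j)) = ?L i l k m - ?L i l m k - ?L l i k m + ?L l i m k" .
    have "2 ^ 48 * ?L i l k m = ?R i k" "2 ^ 48 * ?L i l m k = ?R i m"
      "2 ^ 48 * ?L l i k m = ?R l k" "2 ^ 48 * ?L l i m k = ?R l m"
      by (rule quarter; use assms in \<open>auto simp: T_def\<close>)+
    moreover have "K * (a - b - c + d) = A - B - C + D"
      if "K * a = A" "K * b = B" "K * c = C" "K * d = D" for K a b c d A B C D :: real
      using that by (simp add: algebra_simps)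
    ultimately have "2 ^ 48 * (\<Sum>j\<le>16. r j * y ^ (14 + 4 * j)) = ?R i k - ?R i m - ?R l k + ?R l m"
      unfolding e by blast
    also have "\<dots> = 4 * (\<Sum>c\<in>C. \<phi> c * ((1 + y) ^ (92 - d c) * (1 - y) ^ d c))"
      unfolding sum_subtractf[symmetric] sum.distrib[symmetric] sum_distrib_left
      by (rule sum.cong) (simp_all add: \<phi>_def bit_sign_eq_bit_val algebra_simps)
    also have "(\<Sum>c\<in>C. \<phi> c * ((1 + y) ^ (92 - d c) * (1 - y) ^ d c)) =
      (\<Sum>c\<in>C. \<phi> c * ((1 + y) ^ (92 - (wt c - 2)) * (1 - y) ^ (wt c - 2)))"
    proof (rule sum.cong)
      fix c show "\<phi> c * ((1 + y) ^ (92 - d c) * (1 - y) ^ d c) =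
         \<phi> c * ((1 + y) ^ (92 - (wt c - 2)) * (1 - y) ^ (wt c - 2))"
        using card[of c] by (cases "\<phi> c = 0") auto
    qed simp
    also have "\<dots> = (\<Sum>j\<le>16. r j * ((1 + y) ^ (78 - 4 * j) * (1 - y) ^ (14 + 4 * j)))"
      unfolding r_def by (subst sum_by_weight) (auto simp: \<phi>_def)
    finally show ?thesis .
  qed
  have "\<phi> (c + 1) = \<phi> c" for c
    unfolding \<phi>_def vector_add_component one_index bit_val_add_one by (simp add: algebra_simps)
  then have sym: "r 16 = r 0"
    unfolding r_def using sum_complement[of 16 \<phi>] by simp
  have "r 1 = 0"
    using even_macwilliams_second_coefficient[of r, OF sym eq] by auto
  then show ?thesis
    by (simp add: r_def \<phi>_def)
qed

text \<open>The quadruple sums say that \<open>\<Lambda> i l - \<Lambda> m l\<close> is independent of \<open>l\<close> outside \<open>{i, m}\<close>. Summed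
  over all \<open>l\<close> this difference is \<open>0\<close>, because all row sums of \<open>\<Lambda>\<close> agree, and the two terms with
  \<open>l \<in> {i, m}\<close> cancel because the diagonal of \<open>\<Lambda>\<close> is constant; so \<open>94\<close> equal terms add up to \<open>0\<close>.\<close>

lemma pair_sum_swap:
  fixes i k m :: 96
  defines "\<Lambda> \<equiv> \<lambda>i k :: 96. \<Sum>c\<in>codewords_of_weight C 20. bit_val (c $ i) * bit_val (c $ k)"
  assumes "i \<noteq> k" "m \<noteq> k"
  shows "\<Lambda> i k = \<Lambda> m k"
proof (cases "i = m")
  case False
  define S where "S = (\<lambda>i :: 96. \<Sum>c\<in>codewords_of_weight C 20. bit_val (c $ i))"
  have \<Lambda>_commute: "\<Lambda> i k = \<Lambda> k i" for i k
    by (simp add: \<Lambda>_def mult.commute)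
  have row: "(\<Sum>l\<in>UNIV. \<Lambda> i l) = 20 * S i" for i
  proof -
    have "(\<Sum>l\<in>UNIV. bit_val (c $ l)) = 20" if "c \<in> codewords_of_weight C 20" for c
    proof -
      have "(\<Sum>l\<in>UNIV. bit_val (c $ l)) = (\<Sum>l\<in>supp c. bit_val (c $ l))"
        by (rule sum.mono_neutral_right) (auto simp: supp_def)
      also have "\<dots> = (\<Sum>l\<in>supp c. 1)"
        by (rule sum.cong) (auto simp: supp_def)
      also have "\<dots> = 20"
        using that by (simp add: codewords_of_weight_def wt_def)
      finally show ?thesis .
    qed
    then have "(\<Sum>c\<in>codewords_of_weight C 20. bit_val (c $ i) * (\<Sum>l\<in>UNIV. bit_val (c $ l))) = 20 * S i"
      by (simp add: S_def sum_distrib_left mult.commute)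
    then show ?thesis
      unfolding \<Lambda>_def by (subst sum.swap) (simp add: sum_distrib_left)
  qed
  have diag: "\<Lambda> i i = S i" for i
    unfolding \<Lambda>_def S_def by (intro sum.cong refl) (simp add: bit_val_def)
  have S: "S i = S l" for i l
    using coordinate_sums_equal[of 20 i l] by (simp add: S_def)
  have exchange: "\<Lambda> i l - \<Lambda> m l = \<Lambda> i k - \<Lambda> m k" if "l \<notin> {i, m, k}" for l
  proof -
    have "distinct [i, m, k, l]" using that False assms(2,3) by auto
    from quadruple_sum_eq_0[OF this] show ?thesis
      by (simp add: \<Lambda>_def algebra_simps sum.distrib sum_subtractf)
  qed
  have "(\<Sum>l\<in>UNIV - {i, m, k}. \<Lambda> i l - \<Lambda> m l) = (\<Sum>l\<in>UNIV - {i, m, k}. \<Lambda> i k - \<Lambda> m k)"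
    by (rule sum.cong) (use exchange in auto)
  also have "\<dots> = 93 * (\<Lambda> i k - \<Lambda> m k)"
    using False assms(2,3) by (simp add: card_Diff_subset)
  finally have "(\<Sum>l\<in>UNIV - {i, m, k}. \<Lambda> i l - \<Lambda> m l) = 93 * (\<Lambda> i k - \<Lambda> m k)" .
  moreover have "(\<Sum>l\<in>UNIV. \<Lambda> i l - \<Lambda> m l) =
      (\<Sum>l\<in>UNIV - {i, m, k}. \<Lambda> i l - \<Lambda> m l) + (\<Sum>l\<in>{i, m, k}. \<Lambda> i l - \<Lambda> m l)"
    by (rule sum.subset_diff) auto
  moreover have "(\<Sum>l\<in>{i, m, k}. \<Lambda> i l - \<Lambda> m l) = \<Lambda> i k - \<Lambda> m k"
    using False assms(2,3) by (simp add: diag \<Lambda>_commute[of m i] S[of i m])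
  moreover have "(\<Sum>l\<in>UNIV. \<Lambda> i l - \<Lambda> m l) = 0"
    by (simp add: sum_subtractf row S[of i m])
  ultimately show ?thesis by simp
qed simp

lemma pair_sum_constant:
  fixes i k i' k' :: 96
  assumes "i \<noteq> k" "i' \<noteq> k'"
  shows "(\<Sum>c\<in>codewords_of_weight C 20. bit_val (c $ i) * bit_val (c $ k)) =
         (\<Sum>c\<in>codewords_of_weight C 20. bit_val (c $ i') * bit_val (c $ k'))" (is "?\<Lambda> i k = ?\<Lambda> i' k'")
proof -
  have comm: "?\<Lambda> i k = ?\<Lambda> k i" for i k by (simp add: mult.commute)
  have "card {k, k'} < card (UNIV :: 96 set)"
    using card_insert_le_m1[of 2 "{k'}" k] by (simp add: card_insert_if)
  then obtain m where m: "m \<notin> {k, k'}"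
    by (metis UNIV_eq_I less_irrefl)
  have "?\<Lambda> i k = ?\<Lambda> m k"
    by (rule pair_sum_swap) (use assms m in auto)
  also have "?\<Lambda> m k = ?\<Lambda> k m" by (rule comm)
  also have "?\<Lambda> k m = ?\<Lambda> k' m"
    by (rule pair_sum_swap) (use assms m in auto)
  also have "\<dots> = ?\<Lambda> m k'" by (rule comm)
  also have "?\<Lambda> m k' = ?\<Lambda> i' k'"
    by (rule pair_sum_swap) (use assms m in auto)
  finally show ?thesis .
qed

text \<open>Inclusion and exclusion for the complements, which are the codewords of weight \<open>20\<close>.\<close>

lemma pair_sum_constant_76:
  fixes i k i' k' :: 96
  assumes "i \<noteq> k" "i' \<noteq> k'"
  shows "(\<Sum>c\<in>codewords_of_weight C 76. bit_val (c $ i) * bit_val (c $ k)) =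
         (\<Sum>c\<in>codewords_of_weight C 76. bit_val (c $ i') * bit_val (c $ k'))"
proof -
  let ?D = "codewords_of_weight C 20"
  have *: "(\<Sum>c\<in>codewords_of_weight C 76. bit_val (c $ i) * bit_val (c $ k)) =
        real (card ?D) - (\<Sum>c\<in>?D. bit_val (c $ i)) - (\<Sum>c\<in>?D. bit_val (c $ k)) +
        (\<Sum>c\<in>?D. bit_val (c $ i) * bit_val (c $ k))" for i k
  proof -
    have "(\<Sum>c\<in>codewords_of_weight C 76. bit_val (c $ i) * bit_val (c $ k)) =
      (\<Sum>c\<in>?D. bit_val ((c + 1) $ i) * bit_val ((c + 1) $ k))"
      using sum_complement[of 20 "\<lambda>c. bit_val (c $ i) * bit_val (c $ k)"] by simp
    also have "\<dots> = (\<Sum>c\<in>?D. 1 - bit_val (c $ i) - bit_val (c $ k) + bit_val (c $ i) * bit_val (c $ k))"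
      unfolding vector_add_component one_index bit_val_add_one
      by (intro sum.cong refl) (simp add: algebra_simps)
    finally show ?thesis
      by (simp add: sum.distrib sum_subtractf)
  qed
  show ?thesis
    unfolding * using pair_sum_constant[OF assms] coordinate_sums_equal[of 20 i i']
      coordinate_sums_equal[of 20 k k'] by simp
qed

text \<open>A codeword is determined by its support, so the pair sum counts the blocks through \<open>i\<close> and
  \<open>k\<close>.\<close>

lemma is_combinatorial_designI_pair_sums:
  assumes "\<And>i k i' k' :: 96. i \<noteq> k \<Longrightarrow> i' \<noteq> k' \<Longrightarrow>
       (\<Sum>c\<in>codewords_of_weight C w. bit_val (c $ i) * bit_val (c $ k)) =
       (\<Sum>c\<in>codewords_of_weight C w. bit_val (c $ i') * bit_val (c $ k'))"
  shows "is_combinatorial_design 2 (codewords_of_weight C w)"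
proof -
  have count: "real (card {b \<in> supp ` codewords_of_weight C w. {i, k} \<subseteq> b}) =
       (\<Sum>c\<in>codewords_of_weight C w. bit_val (c $ i) * bit_val (c $ k))" for i k
  proof -
    have inj: "inj (supp :: bit ^ 96 \<Rightarrow> 96 set)"
    proof (rule injI)
      fix c d :: "bit ^ 96" assume "supp c = supp d"
      then have mem: "i \<in> supp c \<longleftrightarrow> i \<in> supp d" for i by simp
      have "c $ i = d $ i" for i
        using mem[of i] by (cases "c $ i"; cases "d $ i") (auto simp: supp_def)
      then show "c = d" by (simp add: vec_eq_iff)
    qed
    have "{b \<in> supp ` codewords_of_weight C w. {i, k} \<subseteq> b} =
        supp ` {c \<in> codewords_of_weight C w. {i, k} \<subseteq> supp c}" by blast
    then have "real (card {b \<in> supp ` codewords_of_weight C w. {i, k} \<subseteq> b}) =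
        real (card {c \<in> codewords_of_weight C w. {i, k} \<subseteq> supp c})"
      using card_image[OF inj_on_subset[OF inj subset_UNIV]] by simp
    also have "\<dots> = (\<Sum>c\<in>codewords_of_weight C w. if {i, k} \<subseteq> supp c then 1 else 0)"
      by (simp only: sum.If_cases finite_code) (simp add: Int_def)
    also have "\<dots> = (\<Sum>c\<in>codewords_of_weight C w. bit_val (c $ i) * bit_val (c $ k))"
      by (intro sum.cong refl) (auto simp: supp_def bit_val_def)
    finally show ?thesis .
  qed
  have "\<exists>lam. \<forall>T. T \<subseteq> UNIV \<and> card T = 2 \<longrightarrow>
      card {b \<in> supp ` codewords_of_weight C w. T \<subseteq> b} = lam"
  proof (intro exI allI impI)
    fix T :: "96 set"
    assume "T \<subseteq> UNIV \<and> card T = 2"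
    then obtain i k where T: "T = {i, k}" "i \<noteq> k"
      by (auto simp: card_2_iff)
    have "real (card {b \<in> supp ` codewords_of_weight C w. T \<subseteq> b}) =
        real (card {b \<in> supp ` codewords_of_weight C w. {0, 1} \<subseteq> b})"
      unfolding T(1) count by (rule assms) (use T in auto)
    then show "card {b \<in> supp ` codewords_of_weight C w. T \<subseteq> b} =
        card {b \<in> supp ` codewords_of_weight C w. {0, 1} \<subseteq> b}" by simp
  qed
  moreover have "\<exists>k. \<forall>b\<in>supp ` codewords_of_weight C w. b \<subseteq> UNIV \<and> card b = k"
    by (auto simp: codewords_of_weight_def wt_def)
  ultimately show ?thesis
    by (simp add: is_combinatorial_design_def combinatorial_design_def)
qed

theorem two_designs:
  "is_combinatorial_design 2 (codewords_of_weight C 20)"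
  "is_combinatorial_design 2 (codewords_of_weight C 76)"
  by (rule is_combinatorial_designI_pair_sums, rule pair_sum_constant; assumption)
     (rule is_combinatorial_designI_pair_sums, rule pair_sum_constant_76; assumption)

end

section \<open>Fundamental domains and Gaussians\<close>

text \<open>The domain is the half-open parallelepiped spanned by a basis: rounding down the coordinates
  of a vector moves it there in exactly one way.\<close>

lemma lattice_fundamental_domain:
  fixes L :: "(real ^ 'n::finite) set"
  assumes "lattice_in_space L"
  obtains B D where
    "finite B" "B \<subseteq> L" "\<And>y. \<lbrakk>\<And>b. b \<in> B \<Longrightarrow> y \<bullet> b \<in> \<int>\<rbrakk> \<Longrightarrow> y \<in> dual_lattice L"
    "0 \<in> L" "\<And>x y. x \<in> L \<Longrightarrow> y \<in> L \<Longrightarrow> x + y \<in> L" "\<And>x. x \<in> L \<Longrightarrow> - x \<in> L" "countable L"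
    "D \<in> sets borel" "bounded D" "\<And>v. \<exists>!x. x \<in> L \<and> v + x \<in> D"
proof -
  from assms obtain B where B: "independent B" "span B = (UNIV :: (real ^ 'n) set)"
    and L: "L = {\<Sum>b\<in>B. of_int (c b) *\<^sub>R b | c :: real ^ 'n \<Rightarrow> int. True}"
    by (auto simp: lattice_in_space_def)
  have fin: "finite B"
    using B(1) by (rule independent_imp_finite)
  define r where "r = (\<lambda>v b. representation B v b)"
  have r_sum: "(\<Sum>b\<in>B. r v b *\<^sub>R b) = v" for v
    unfolding r_def by (rule real_vector.sum_representation_eq) (use B fin in auto)
  have r_unique: "r v b = f b" if "b \<in> B" "v = (\<Sum>b\<in>B. f b *\<^sub>R b)" for v b f
  proof -
    define f' where "f' = (\<lambda>b. if b \<in> B then f b else 0)"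
    have "representation B v = f'"
    proof (rule real_vector.representation_eqI)
      show "finite {b. f' b \<noteq> 0}"
        by (rule finite_subset[OF _ fin]) (auto simp: f'_def)
      have "(\<Sum>b | f' b \<noteq> 0. f' b *\<^sub>R b) = (\<Sum>b\<in>B. f b *\<^sub>R b)"
        by (rule sum.mono_neutral_cong_left) (auto simp: f'_def fin split: if_splits)
      then show "(\<Sum>b | f' b \<noteq> 0. f' b *\<^sub>R b) = v"
        using that(2) by simp
    qed (use B in \<open>auto simp: f'_def split: if_splits\<close>)
    then show ?thesis using that(1) by (simp add: r_def f'_def)
  qed
  have lin: "linear (\<lambda>v. r v b)" for b
    unfolding r_def
    by (rule linearI) (use B in \<open>auto simp: real_vector.representation_add real_vector.representation_scale\<close>)
  have cont: "continuous_on UNIV (\<lambda>v. r v b)" for b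
    using lin by (intro linear_continuous_on) (simp add: linear_conv_bounded_linear)
  define D where "D = (\<Inter>b\<in>B. {v. 0 \<le> r v b} \<inter> {v. r v b < 1})"
  have D_borel: "D \<in> sets borel"
  proof (cases "B = {}")
    case True then show ?thesis by (simp add: D_def)
  next
    case False
    have "{v. 0 \<le> r v b} \<in> sets borel" "{v. r v b < 1} \<in> sets borel" for b
      by (intro borel_closed closed_Collect_le borel_open open_Collect_less continuous_on_const cont)+
    then show ?thesis
      unfolding D_def by (intro sets.finite_INT sets.Int fin False)
  qed
  have D_bounded: "bounded D"
    unfolding bounded_iff
  proof (intro exI ballI)
    fix v assume v: "v \<in> D"
    have "norm v = norm (\<Sum>b\<in>B. r v b *\<^sub>R b)" by (simp add: r_sum)
    also have "\<dots> \<le> (\<Sum>b\<in>B. norm (r v b *\<^sub>R b))" by (rule norm_sum)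
    also have "\<dots> \<le> (\<Sum>b\<in>B. norm b)"
    proof (rule sum_mono)
      fix b assume "b \<in> B"
      then have "\<bar>r v b\<bar> \<le> 1" using v by (auto simp: D_def)
      then show "norm (r v b *\<^sub>R b) \<le> norm b"
        by (simp add: mult_left_le_one_le)
    qed
    finally show "norm v \<le> (\<Sum>b\<in>B. norm b)" .
  qed
  have L_iff: "x \<in> L \<longleftrightarrow> (\<forall>b\<in>B. r x b \<in> \<int>)" for x
  proof
    assume "x \<in> L"
    then obtain c :: "real ^ 'n \<Rightarrow> int" where c: "x = (\<Sum>b\<in>B. of_int (c b) *\<^sub>R b)"
      using L by auto
    then show "\<forall>b\<in>B. r x b \<in> \<int>"
      using r_unique[OF _ c] by auto
  next
    assume *: "\<forall>b\<in>B. r x b \<in> \<int>"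
    have "x = (\<Sum>b\<in>B. r x b *\<^sub>R b)" by (simp add: r_sum)
    also have "\<dots> = (\<Sum>b\<in>B. of_int (\<lfloor>r x b\<rfloor>) *\<^sub>R b)"
      using * by (intro sum.cong) (auto simp: of_int_floor elim!: Ints_cases)
    finally have "x = (\<Sum>b\<in>B. of_int \<lfloor>r x b\<rfloor> *\<^sub>R b)" .
    then show "x \<in> L" unfolding L by (intro CollectI exI[of _ "\<lambda>b. \<lfloor>r x b\<rfloor>"] conjI TrueI)
  qed
  have r_add: "r (v + w) b = r v b + r w b" and r_minus: "r (- v) b = - r v b" and r_0: "r 0 b = 0"
    for v w b
    by (rule linear_add[OF lin] linear_neg[OF lin] linear_0[OF lin])+
  have unique: "\<exists>!x. x \<in> L \<and> v + x \<in> D" for v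
  proof (rule ex1I)
    define x where "x = (\<Sum>b\<in>B. of_int (- \<lfloor>r v b\<rfloor>) *\<^sub>R b)"
    have rx: "r x b = of_int (- \<lfloor>r v b\<rfloor>)" if "b \<in> B" for b
      by (rule r_unique[OF that]) (simp add: x_def)
    show "x \<in> L \<and> v + x \<in> D"
      by (auto simp: L_iff rx D_def r_add) linarith+
    fix y assume y: "y \<in> L \<and> v + y \<in> D"
    have "r y b = r x b" if b: "b \<in> B" for b
    proof -
      obtain m where m: "r y b = of_int m"
        using y b by (auto simp: L_iff elim!: Ints_cases)
      have "0 \<le> r v b + r y b" "r v b + r y b < 1"
        using y b by (auto simp: D_def r_add)
      then have "m = - \<lfloor>r v b\<rfloor>" unfolding m by linarith
      then show ?thesis using rx[OF b] m by simp
    qed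
    then have "(\<Sum>b\<in>B. r y b *\<^sub>R b) = (\<Sum>b\<in>B. r x b *\<^sub>R b)" by (intro sum.cong) auto
    then show "y = x" by (simp add: r_sum)
  qed
  have "countable L"
  proof -
    have "L \<subseteq> (\<lambda>f. \<Sum>b\<in>B. of_int (f b) *\<^sub>R b) ` (PiE B (\<lambda>_. UNIV :: int set))"
    proof
      fix x assume "x \<in> L"
      then obtain c :: "real ^ 'n \<Rightarrow> int" where c: "x = (\<Sum>b\<in>B. of_int (c b) *\<^sub>R b)"
        using L by auto
      also have "\<dots> = (\<Sum>b\<in>B. of_int (restrict c B b) *\<^sub>R b)" by (rule sum.cong) auto
      finally have "x = (\<Sum>b\<in>B. of_int (restrict c B b) *\<^sub>R b)" .
      moreover have "restrict c B \<in> PiE B (\<lambda>_. UNIV :: int set)" by simp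
      ultimately show "x \<in> (\<lambda>f. \<Sum>b\<in>B. of_int (f b) *\<^sub>R b) ` (PiE B (\<lambda>_. UNIV :: int set))"
        by (rule image_eqI)
    qed
    moreover have "countable (PiE B (\<lambda>_. UNIV :: int set))"
      using fin by (intro countable_PiE) auto
    ultimately show ?thesis
      by (meson countable_image countable_subset)
  qed
  moreover have "B \<subseteq> L"
  proof
    fix b assume b: "b \<in> B"
    have "(\<Sum>b'\<in>B. of_int (if b' = b then 1 else 0) *\<^sub>R b') = (\<Sum>b'\<in>B. if b' = b then b' else 0)"
      by (rule sum.cong) auto
    also have "\<dots> = b" using b fin by simp
    finally have "b = (\<Sum>b'\<in>B. of_int (if b' = b then 1 else 0) *\<^sub>R b')" ..
    then show "b \<in> L"
      unfolding L by (intro CollectI exI[of _ "\<lambda>b'. if b' = b then 1 else 0"] conjI TrueI)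
  qed
  moreover have "y \<in> dual_lattice L" if "\<And>b. b \<in> B \<Longrightarrow> y \<bullet> b \<in> \<int>" for y
  proof -
    have "y \<bullet> (\<Sum>b\<in>B. of_int (c b) *\<^sub>R b) \<in> \<int>" for c :: "real ^ 'n \<Rightarrow> int"
      unfolding inner_sum_right inner_scaleR_right by (intro Ints_sum Ints_mult Ints_of_int that)
    then show ?thesis
      unfolding dual_lattice_def L by blast
  qed
  moreover have "0 \<in> L" "\<And>x y. x \<in> L \<Longrightarrow> y \<in> L \<Longrightarrow> x + y \<in> L" "\<And>x. x \<in> L \<Longrightarrow> - x \<in> L"
    by (simp_all add: L_iff r_add r_minus r_0)
  ultimately show ?thesis
    using fin D_borel D_bounded unique by (intro that[of B D]) blast+
qed

lemma nn_integral_count_space_infsum: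
  fixes f :: "'a \<Rightarrow> real"
  assumes "f summable_on A" "\<And>x. x \<in> A \<Longrightarrow> 0 \<le> f x"
  shows "(\<integral>\<^sup>+x. ennreal (f x) \<partial>count_space A) = ennreal (infsum f A)"
proof -
  have 1: "(\<lambda>x. norm (f x)) summable_on A"
    using assms(1) by (rule summable_on_cong[THEN iffD1, rotated]) (use assms(2) in simp)
  note abs = abs_summable_equivalent[THEN iffD1, OF 1]
  have "(\<integral>\<^sup>+x. ennreal (f x) \<partial>count_space A) = ennreal (infsetsum f A)"
    by (rule nn_integral_conv_infsetsum[OF abs]) (use assms(2) in auto)
  also have "infsetsum f A = infsum f A"
    by (rule infsetsum_infsum[OF abs])
  finally show ?thesis .
qed

text \<open>After rescaling this is the characteristic function of the standard normal distribution.\<close>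

lemma gaussian_fourier_real:
  fixes a t :: real
  assumes "t > 0"
  shows "integrable lborel (\<lambda>x. complex_of_real (exp (- pi * t * x\<^sup>2)) * iexp (2 * pi * a * x))" (is ?int)
    and "(LINT x|lborel. complex_of_real (exp (- pi * t * x\<^sup>2)) * iexp (2 * pi * a * x)) =
           complex_of_real (exp (- pi * a\<^sup>2 / t) / sqrt t)" (is ?eq)
proof -
  define c where "c = 1 / sqrt (2 * pi * t)"
  have c: "c > 0" "c\<^sup>2 = 1 / (2 * pi * t)"
    using assms by (auto simp: c_def power_divide real_sqrt_pow2)
  define s where "s = 2 * pi * a * c"
  let ?f = "\<lambda>x. complex_of_real (exp (- pi * t * x\<^sup>2)) * iexp (2 * pi * a * x)"
  have conv: "?f (0 + c * x) = complex_of_real (sqrt (2 * pi)) * (std_normal_density x *\<^sub>R iexp (s * x))" for x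
  proof -
    have e: "- pi * t * (c * x)\<^sup>2 = - x\<^sup>2 / 2"
      using assms by (simp add: power_mult_distrib c(2) field_simps)
    have "complex_of_real (sqrt (2 * pi)) * (std_normal_density x *\<^sub>R iexp (s * x)) =
        complex_of_real (sqrt (2 * pi) * std_normal_density x) * iexp (s * x)"
      by (simp add: scaleR_conv_of_real)
    also have "sqrt (2 * pi) * std_normal_density x = exp (- pi * t * (c * x)\<^sup>2)"
      unfolding e by (simp add: std_normal_density_def)
    finally show ?thesis unfolding s_def by (simp only: add_0 mult_ac)
  qed
  have int': "integrable lborel (\<lambda>x. std_normal_density x *\<^sub>R iexp (s * x))"
    by (rule Bochner_Integration.integrable_bound[of _ std_normal_density])
       (auto intro!: integrable_normal_density)
  have "integrable lborel (\<lambda>x. ?f (0 + c * x))"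
    unfolding conv using int' by (intro integrable_mult_right) auto
  then show ?int
    using lborel_integrable_real_affine_iff[of c ?f 0] c(1) by simp
  have "(LINT x|lborel. ?f x) = \<bar>c\<bar> *\<^sub>R (LINT x|lborel. ?f (0 + c * x))"
    using c(1) by (intro lborel_integral_real_affine) auto
  also have "(LINT x|lborel. ?f (0 + c * x)) =
      complex_of_real (sqrt (2 * pi)) * (LINT x|lborel. std_normal_density x *\<^sub>R iexp (s * x))"
    unfolding conv by (rule integral_mult_right_zero)
  also have "(LINT x|lborel. std_normal_density x *\<^sub>R iexp (s * x)) = char std_normal_distribution s"
    unfolding char_def by (subst integral_density) auto
  also have "\<dots> = complex_of_real (exp (- (s\<^sup>2) / 2))"
    by (simp add: char_std_normal_distribution)
  also have "- (s\<^sup>2) / 2 = - pi * a\<^sup>2 / t"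
    using assms by (simp add: s_def power_mult_distrib c(2)) (simp add: power2_eq_square field_simps)
  also have "\<bar>c\<bar> *\<^sub>R (complex_of_real (sqrt (2 * pi)) * complex_of_real (exp (- pi * a\<^sup>2 / t))) =
      complex_of_real (exp (- pi * a\<^sup>2 / t) / sqrt t)"
    using assms by (simp add: c_def scaleR_conv_of_real real_sqrt_mult)
  finally show ?eq .
qed

text \<open>Gaussian and character are products over the coordinates, and Lebesgue measure is a product
  measure.\<close>

lemma gaussian_fourier:
  fixes y :: "'a::euclidean_space" and t :: real
  assumes "t > 0"
  shows "integrable lborel (\<lambda>v. complex_of_real (exp (- pi * t * (v \<bullet> v))) * iexp (2 * pi * (y \<bullet> v)))" (is ?int)
    and "(LINT v|lborel. complex_of_real (exp (- pi * t * (v \<bullet> v))) * iexp (2 * pi * (y \<bullet> v))) =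
           complex_of_real (exp (- pi * (y \<bullet> y) / t) / sqrt t ^ DIM('a))" (is ?eq)
proof -
  interpret P: product_sigma_finite "\<lambda>_::'a. lborel :: real measure"
    by (simp add: product_sigma_finite_def lborel.sigma_finite_measure_axioms)
  let ?f = "\<lambda>v. complex_of_real (exp (- pi * t * (v \<bullet> v))) * iexp (2 * pi * (y \<bullet> v))"
  let ?h = "\<lambda>b x. complex_of_real (exp (- pi * t * x\<^sup>2)) * iexp (2 * pi * (y \<bullet> b) * x)"
  let ?S = "\<lambda>f. \<Sum>b\<in>Basis. f b *\<^sub>R (b :: 'a)"
  have prod: "?f (?S g) = (\<Prod>b\<in>Basis. ?h b (g b))" for g
  proof -
    have b: "?S g \<bullet> b = g b" if "b \<in> Basis" for b using that by simp
    have "?S g \<bullet> ?S g = (\<Sum>b\<in>Basis. (g b)\<^sup>2)"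
      by (subst euclidean_inner) (simp add: power2_eq_square)
    moreover have "y \<bullet> ?S g = (\<Sum>b\<in>Basis. (y \<bullet> b) * g b)"
      by (subst euclidean_inner) simp
    ultimately have "?f (?S g) = complex_of_real (exp (\<Sum>b\<in>Basis. - pi * t * (g b)\<^sup>2)) *
        exp (\<Sum>b\<in>Basis. \<i> * complex_of_real (2 * pi * (y \<bullet> b) * g b))"
      by (simp only: sum_distrib_left of_real_sum mult.assoc)
    then show ?thesis
      by (simp only: exp_sum finite_Basis of_real_prod prod.distrib)
  qed
  have S [measurable]: "?S \<in> (\<Pi>\<^sub>M b\<in>Basis. lborel) \<rightarrow>\<^sub>M borel"
    by measurable
  have "integrable (\<Pi>\<^sub>M b\<in>Basis. lborel) (\<lambda>g. ?f (?S g))"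
    unfolding prod by (rule P.product_integrable_prod) (simp_all only: finite_Basis gaussian_fourier_real(1)[OF assms])
  then show ?int
    by (subst lborel_eq, subst integrable_distr_eq) auto
  have "(LINT v|lborel. ?f v) = (LINT g|(\<Pi>\<^sub>M b\<in>Basis. lborel). ?f (?S g))"
    by (subst lborel_eq, subst integral_distr) auto
  also have "\<dots> = (\<Prod>b\<in>Basis. LINT x|lborel. ?h b x)"
    unfolding prod by (rule P.product_integral_prod) (simp_all only: finite_Basis gaussian_fourier_real(1)[OF assms])
  also have "\<dots> = (\<Prod>b\<in>Basis. complex_of_real (exp (- pi * (y \<bullet> b)\<^sup>2 / t) / sqrt t))"
    by (intro prod.cong gaussian_fourier_real(2) assms refl)
  also have "\<dots> = complex_of_real (exp (- pi * (y \<bullet> y) / t) / sqrt t ^ DIM('a))"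
  proof -
    have "(\<Sum>b\<in>Basis. - pi * (y \<bullet> b)\<^sup>2 / t) = - pi * (y \<bullet> y) / t"
      by (subst (2) euclidean_inner) (simp only: sum_distrib_left sum_divide_distrib power2_eq_square)
    then have "exp (- pi * (y \<bullet> y) / t) = (\<Prod>b\<in>Basis. exp (- pi * (y \<bullet> b)\<^sup>2 / t))"
      by (simp only: exp_sum[symmetric] finite_Basis)
    then show ?thesis
      by (simp only: of_real_prod[symmetric] prod_dividef prod_constant)
  qed
  finally show ?eq .
qed

section \<open>Unfolding integrals over a lattice\<close>

lemma nn_integral_lborel_shift:
  fixes f :: "'a::euclidean_space \<Rightarrow> ennreal"
  assumes [measurable]: "f \<in> borel_measurable borel"
  shows "(\<integral>\<^sup>+v. f (c + v) \<partial>lborel) = (\<integral>\<^sup>+v. f v \<partial>lborel)"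
proof -
  have "(\<integral>\<^sup>+v. f v \<partial>lborel) = (\<integral>\<^sup>+v. f v \<partial>distr lborel borel ((+) c))"
    by (simp add: lborel_distr_plus)
  also have "\<dots> = (\<integral>\<^sup>+v. f (c + v) \<partial>lborel)"
    by (rule nn_integral_distr) auto
  finally show ?thesis ..
qed

lemma gaussian_integral:
  assumes "t > 0"
  shows "integrable lborel (\<lambda>v::'a::euclidean_space. exp (- pi * t * (v \<bullet> v)))"
    and "(\<integral>\<^sup>+v. ennreal (exp (- pi * t * (v \<bullet> v))) \<partial>(lborel :: 'a measure)) = ennreal (1 / sqrt t ^ DIM('a))"
proof -
  have i: "integrable lborel (\<lambda>v::'a. complex_of_real (exp (- pi * t * (v \<bullet> v))))"
    and e: "(LINT v|lborel. complex_of_real (exp (- pi * t * (v \<bullet> (v::'a))))) = complex_of_real (1 / sqrt t ^ DIM('a))"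
    using gaussian_fourier[OF assms, of "0 :: 'a"] by simp_all
  show int: "integrable lborel (\<lambda>v::'a. exp (- pi * t * (v \<bullet> v)))"
    using i by (simp only: complex_of_real_integrable_eq)
  have "complex_of_real (LINT v|lborel. exp (- pi * t * (v \<bullet> (v::'a)))) = complex_of_real (1 / sqrt t ^ DIM('a))"
    using e by (simp only: integral_complex_of_real)
  then have "(LINT v|lborel. exp (- pi * t * (v \<bullet> (v::'a)))) = 1 / sqrt t ^ DIM('a)"
    by (simp only: of_real_eq_iff)
  then show "(\<integral>\<^sup>+v. ennreal (exp (- pi * t * (v \<bullet> v))) \<partial>(lborel :: 'a measure)) = ennreal (1 / sqrt t ^ DIM('a))"
    by (subst nn_integral_eq_integral[OF int]) auto
qed

text \<open>What Fourier analysis on the torus needs to know about a lattice \<open>L\<close> with a finite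
  generating set \<open>B\<close>: it is a countable group with a bounded Borel fundamental domain \<open>D\<close>.\<close>

locale lattice_cell =
  fixes L B D :: "(real ^ 'n::finite) set"
  assumes fin_B: "finite B" and B_L: "B \<subseteq> L"
    and dual_B: "\<And>y. \<lbrakk>\<And>b. b \<in> B \<Longrightarrow> y \<bullet> b \<in> \<int>\<rbrakk> \<Longrightarrow> y \<in> dual_lattice L"
    and zero_L: "0 \<in> L" and add_L: "\<And>x y. x \<in> L \<Longrightarrow> y \<in> L \<Longrightarrow> x + y \<in> L"
    and minus_L: "\<And>x. x \<in> L \<Longrightarrow> - x \<in> L" and countable_L: "countable L"
    and D_borel [measurable]: "D \<in> sets borel" and D_bounded: "bounded D"
    and D_unique: "\<And>v. \<exists>!x. x \<in> L \<and> v + x \<in> D"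
begin

text \<open>The translates of \<open>D\<close> tile the space. Nonnegativity allows the sum over \<open>L\<close> and the integral
  to be exchanged before any convergence is known, so this can serve to prove convergence.\<close>

lemma nn_integral_unfold:
  fixes f :: "real ^ 'n \<Rightarrow> ennreal"
  assumes [measurable]: "f \<in> borel_measurable borel"
  shows "(\<integral>\<^sup>+v. f v \<partial>lborel) = (\<integral>\<^sup>+v. (\<integral>\<^sup>+x. f (v + x) \<partial>count_space L) * indicator D v \<partial>lborel)"
proof -
  have single: "f v = (\<integral>\<^sup>+x. f v * indicator D (v + x) \<partial>count_space L)" for v
  proof -
    obtain x0 where x0: "x0 \<in> L" "v + x0 \<in> D" "\<And>x. x \<in> L \<Longrightarrow> v + x \<in> D \<Longrightarrow> x = x0"
      using D_unique[of v] by auto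
    have "(\<integral>\<^sup>+x. f v * indicator D (v + x) \<partial>count_space L) = (\<Sum>x\<in>{x0}. f v * indicator D (v + x))"
      by (rule nn_integral_count_space') (use x0(1,3) in \<open>force simp: indicator_def\<close>)+
    then show ?thesis using x0(2) by simp
  qed
  have "(\<integral>\<^sup>+v. f v \<partial>lborel) = (\<integral>\<^sup>+v. (\<integral>\<^sup>+x. f v * indicator D (v + x) \<partial>count_space L) \<partial>lborel)"
    by (subst single) (rule refl)
  also have "\<dots> = (\<integral>\<^sup>+x. (\<integral>\<^sup>+v. f v * indicator D (v + x) \<partial>lborel) \<partial>count_space L)"
    by (rule nn_integral_count_space_nn_integral[OF countable_L]) measurable
  also have "\<dots> = (\<integral>\<^sup>+x. (\<integral>\<^sup>+v. f (v + - x) * indicator D v \<partial>lborel) \<partial>count_space L)"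
  proof (rule nn_integral_cong)
    fix x
    have "(\<integral>\<^sup>+v. f v * indicator D (v + x) \<partial>lborel) = (\<integral>\<^sup>+v. f (- x + v) * indicator D ((- x + v) + x) \<partial>lborel)"
      by (rule nn_integral_lborel_shift[symmetric]) measurable
    then show "(\<integral>\<^sup>+v. f v * indicator D (v + x) \<partial>lborel) = (\<integral>\<^sup>+v. f (v + - x) * indicator D v \<partial>lborel)"
      by (simp add: add.commute)
  qed
  also have "\<dots> = (\<integral>\<^sup>+x. (\<integral>\<^sup>+v. f (v + x) * indicator D v \<partial>lborel) \<partial>count_space L)"
    by (rule nn_integral_bij_count_space[of uminus L L])
       (auto intro!: bij_betwI[of _ _ _ uminus] minus_L)
  also have "\<dots> = (\<integral>\<^sup>+v. (\<integral>\<^sup>+x. f (v + x) * indicator D v \<partial>count_space L) \<partial>lborel)"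
    by (rule nn_integral_count_space_nn_integral[OF countable_L, symmetric]) measurable
  also have "\<dots> = (\<integral>\<^sup>+v. (\<integral>\<^sup>+x. f (v + x) \<partial>count_space L) * indicator D v \<partial>lborel)"
    by (simp add: nn_integral_multc)
  finally show ?thesis .
qed

text \<open>By unfolding, the integral over \<open>D\<close> of the Gaussian sums with centre \<open>v\<close> is the Gaussian
  integral, so the sum is finite for at least one \<open>v\<close>. Moving the centre to \<open>0\<close> costs a constant
  factor and a factor \<open>2\<close> in the exponent, as \<open>|v + x|^2 \<le> 2 |v|^2 + 2 |x|^2\<close>.\<close>

lemma gaussian_summable:
  assumes "t > 0"
  shows "(\<lambda>x. exp (- t * (x \<bullet> x))) summable_on L"
proof -
  define s where "s = t / (2 * pi)"
  have s: "s > 0" using assms by (simp add: s_def)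
  let ?g = "\<lambda>v :: real ^ 'n. ennreal (exp (- pi * s * (v \<bullet> v)))"
  have "(\<integral>\<^sup>+v. ?g v \<partial>lborel) = (\<integral>\<^sup>+v. (\<integral>\<^sup>+x. ?g (v + x) \<partial>count_space L) * indicator D v \<partial>lborel)"
    by (rule nn_integral_unfold[of ?g]) measurable
  moreover define c where "c = 1 / sqrt s ^ CARD('n)"
  ultimately have eq: "(\<integral>\<^sup>+v. (\<integral>\<^sup>+x. ?g (v + x) \<partial>count_space L) * indicator D v \<partial>lborel) = ennreal c"
    using gaussian_integral(2)[OF s, where 'a = "real ^ 'n"] by simp
  have c: "c > 0" using s by (simp add: c_def)
  have "\<exists>v. (\<integral>\<^sup>+x. ?g (v + x) \<partial>count_space L) \<noteq> \<infinity>"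
  proof (rule ccontr)
    assume "\<not> ?thesis"
    then have "(\<integral>\<^sup>+v. (\<integral>\<^sup>+x. ?g (v + x) \<partial>count_space L) * indicator D v \<partial>lborel) =
        (\<integral>\<^sup>+v. \<infinity> * indicator D v \<partial>(lborel :: (real ^ 'n) measure))" by simp
    also have "\<dots> = \<infinity> * emeasure lborel D"
      by (subst nn_integral_cmult_indicator) auto
    finally show False
      unfolding eq using c
      by (auto simp: ennreal_top_mult ennreal_eq_0_iff split: if_splits)
  qed
  then obtain v where v: "(\<integral>\<^sup>+x. ?g (v + x) \<partial>count_space L) \<noteq> \<infinity>" by blast
  define K where "K = exp (t * (v \<bullet> v)) * enn2real (\<integral>\<^sup>+x. ?g (v + x) \<partial>count_space L)"
  have "(\<Sum>x\<in>X. exp (- t * (x \<bullet> x))) \<le> K" if X: "finite X" "X \<subseteq> L" for X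
  proof -
    have "ennreal (\<Sum>x\<in>X. exp (- pi * s * ((v + x) \<bullet> (v + x)))) = (\<Sum>x\<in>X. ?g (v + x))"
      by (simp add: sum_ennreal)
    also have "\<dots> = (\<integral>\<^sup>+x. ?g (v + x) * indicator X x \<partial>count_space L)"
      using X by (subst nn_integral_count_space'[of X]) auto
    also have "\<dots> \<le> (\<integral>\<^sup>+x. ?g (v + x) \<partial>count_space L)"
      by (rule nn_integral_mono) (auto simp: indicator_def)
    finally have le: "(\<Sum>x\<in>X. exp (- pi * s * ((v + x) \<bullet> (v + x)))) \<le>
        enn2real (\<integral>\<^sup>+x. ?g (v + x) \<partial>count_space L)"
      using v by (cases "\<integral>\<^sup>+x. ?g (v + x) \<partial>count_space L") auto
    have "(\<Sum>x\<in>X. exp (- t * (x \<bullet> x))) \<le> (\<Sum>x\<in>X. exp (t * (v \<bullet> v)) * exp (- pi * s * ((v + x) \<bullet> (v + x))))"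
    proof (rule sum_mono)
      fix x
      have "(v + x) \<bullet> (v + x) \<le> 2 * (v \<bullet> v) + 2 * (x \<bullet> x)"
        using inner_ge_zero[of "v - x"] by (simp add: algebra_simps inner_commute)
      then have "t * ((v + x) \<bullet> (v + x)) \<le> t * (2 * (v \<bullet> v) + 2 * (x \<bullet> x))"
        using assms by (intro mult_left_mono) auto
      then have "- t * (x \<bullet> x) \<le> t * (v \<bullet> v) + - pi * s * ((v + x) \<bullet> (v + x))"
        by (simp add: s_def algebra_simps)
      then show "exp (- t * (x \<bullet> x)) \<le> exp (t * (v \<bullet> v)) * exp (- pi * s * ((v + x) \<bullet> (v + x)))"
        by (simp add: exp_add[symmetric])
    qed
    also have "\<dots> \<le> K"
      unfolding K_def sum_distrib_left[symmetric] using le by (intro mult_left_mono) auto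
    finally show ?thesis .
  qed
  then show ?thesis
    by (intro nonneg_bdd_above_summable_on) (auto simp: bdd_above_def)
qed

lemma gaussian_shift_bound:
  fixes v x :: "real ^ 'n"
  assumes "t > 0"
  shows "exp (- t * ((v + x) \<bullet> (v + x))) \<le> exp (t * (v \<bullet> v)) * exp (- (t / 2) * (x \<bullet> x))"
proof -
  have "x \<bullet> x \<le> 2 * ((v + x) \<bullet> (v + x)) + 2 * (v \<bullet> v)"
    using inner_ge_zero[of "2 *\<^sub>R v + x"] by (simp add: algebra_simps inner_commute)
  then have "t / 2 * (x \<bullet> x) \<le> t / 2 * (2 * ((v + x) \<bullet> (v + x)) + 2 * (v \<bullet> v))"
    using assms by (intro mult_left_mono) auto
  then show ?thesis
    by (simp add: exp_add[symmetric] algebra_simps)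
qed

lemma gaussian_shift_summable:
  assumes "t > 0"
  shows "(\<lambda>x. exp (- t * ((v + x) \<bullet> (v + x)))) summable_on L"
proof (rule summable_on_comparison_test)
  show "(\<lambda>x. exp (t * (v \<bullet> v)) * exp (- (t / 2) * (x \<bullet> x))) summable_on L"
    by (intro summable_on_cmult_right gaussian_summable) (use assms in auto)
qed (use gaussian_shift_bound[OF assms] in auto)

definition theta_sum :: "real \<Rightarrow> real ^ 'n \<Rightarrow> real" where
  "theta_sum t v = (\<Sum>\<^sub>\<infinity>x\<in>L. exp (- pi * t * ((v + x) \<bullet> (v + x))))"

lemma theta_sum_periodic:
  assumes "z \<in> L"
  shows "theta_sum t (v + z) = theta_sum t v"
  unfolding theta_sum_def add.assoc
proof (rule infsum_reindex_bij_betw[of "(+) z" L L "\<lambda>x. exp (- pi * t * ((v + x) \<bullet> (v + x)))"])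
  show "bij_betw ((+) z) L L"
    by (rule bij_betwI[of _ _ _ "(+) (- z)"]) (auto intro!: add_L minus_L assms)
qed

lemma theta_sum_continuous:
  assumes "t > 0"
  shows "continuous_on UNIV (theta_sum t)"
proof -
  have "continuous_on (cball 0 R) (theta_sum t)" for R
  proof -
    have "uniform_limit (cball 0 R) (\<lambda>X v. \<Sum>x\<in>X. exp (- pi * t * ((v + x) \<bullet> (v + x))))
        (\<lambda>v. \<Sum>\<^sub>\<infinity>x\<in>L. exp (- pi * t * ((v + x) \<bullet> (v + x)))) (finite_subsets_at_top L)"
    proof (rule Weierstrass_m_test_general)
      show "(\<lambda>x. exp (pi * t * R\<^sup>2) * exp (- (pi * t / 2) * (x \<bullet> x))) summable_on L"
        by (intro summable_on_cmult_right gaussian_summable) (use assms in auto)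
      fix x v assume "v \<in> cball (0 :: real ^ 'n) R"
      then have "norm v \<le> R" by simp
      then have "v \<bullet> v \<le> R\<^sup>2"
        unfolding dot_square_norm by (intro power_mono) auto
      then have "exp (pi * t * (v \<bullet> v)) \<le> exp (pi * t * R\<^sup>2)"
        using assms by (auto intro!: mult_left_mono)
      moreover have "exp (- pi * t * ((v + x) \<bullet> (v + x))) \<le> exp (pi * t * (v \<bullet> v)) * exp (- (pi * t / 2) * (x \<bullet> x))"
        using gaussian_shift_bound[of "pi * t" v x] assms by simp
      ultimately show "norm (exp (- pi * t * ((v + x) \<bullet> (v + x)))) \<le> exp (pi * t * R\<^sup>2) * exp (- (pi * t / 2) * (x \<bullet> x))"
        by (auto intro: order_trans mult_right_mono)
    qed
    then show ?thesis
      unfolding theta_sum_def[abs_def]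
      by (rule uniform_limit_theorem[rotated]) (auto intro!: always_eventually continuous_intros)
  qed
  then have "continuous (at v) (theta_sum t)" for v
    by (rule continuous_on_interior[of "cball 0 (norm v + 1)"]) (simp add: interior_cball)
  then show ?thesis
    by (simp add: continuous_at_imp_continuous_on)
qed

definition cell_measure :: "(real ^ 'n) measure" where
  "cell_measure = restrict_space lborel D"

lemma finite_measure_cell: "finite_measure cell_measure"
proof
  have "emeasure lborel D < \<infinity>"
    using D_bounded by (rule emeasure_bounded_finite)
  then show "emeasure cell_measure (space cell_measure) \<noteq> \<infinity>"
    by (simp add: cell_measure_def space_restrict_space emeasure_restrict_space)
qed

lemma space_cell_measure: "space cell_measure = D"
  by (simp add: cell_measure_def space_restrict_space)

lemma measurable_cell: "f \<in> borel_measurable borel \<Longrightarrow> f \<in> borel_measurable cell_measure"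
  unfolding cell_measure_def by (rule measurable_restrict_space1) simp

lemma integrable_cell:
  fixes f :: "real ^ 'n \<Rightarrow> 'b::{banach, second_countable_topology}"
  assumes "continuous_on UNIV f"
  shows "integrable cell_measure f"
proof -
  have "compact (f ` closure D)"
    using D_bounded by (intro compact_continuous_image continuous_on_subset[OF assms]) auto
  then obtain K where K: "\<And>v. v \<in> D \<Longrightarrow> norm (f v) \<le> K"
  proof -
    from \<open>compact (f ` closure D)\<close> have "bounded (f ` closure D)" by (rule compact_imp_bounded)
    then obtain K where "\<forall>w\<in>f ` closure D. norm w \<le> K" unfolding bounded_iff by blast
    then show ?thesis using that[of K] closure_subset[of D] by blast
  qed
  show ?thesis
    by (rule finite_measure.integrable_const_bound[OF finite_measure_cell, of _ K])
       (auto simp: space_cell_measure intro!: K AE_I2 measurable_cell borel_measurable_continuous_onI assms)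
qed

text \<open>Unfolding against a periodic factor \<open>e\<close>, which the summation over \<open>L\<close> does not affect.\<close>

lemma integral_unfold_nonneg:
  fixes e G :: "real ^ 'n \<Rightarrow> real"
  assumes G: "G \<in> borel_measurable borel" "\<And>v. 0 \<le> G v"
    and sum: "\<And>v. (\<lambda>x. G (v + x)) summable_on L"
    and sum_meas: "(\<lambda>v. \<Sum>\<^sub>\<infinity>x\<in>L. G (v + x)) \<in> borel_measurable borel"
    and e: "e \<in> borel_measurable borel" "\<And>v. 0 \<le> e v" "\<And>v x. x \<in> L \<Longrightarrow> e (v + x) = e v"
  shows "(LINT v|lborel. G v * e v) = (LINT v|cell_measure. (\<Sum>\<^sub>\<infinity>x\<in>L. G (v + x)) * e v)"
proof -
  note [measurable] = G(1) e(1) sum_meas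
  have nonneg: "0 \<le> (\<Sum>\<^sub>\<infinity>x\<in>L. G (v + x))" for v
    by (rule infsum_nonneg) (rule G)
  have "(\<integral>\<^sup>+v. ennreal (G v * e v) \<partial>lborel) =
      (\<integral>\<^sup>+v. (\<integral>\<^sup>+x. ennreal (G (v + x) * e (v + x)) \<partial>count_space L) * indicator D v \<partial>lborel)"
    by (rule nn_integral_unfold) measurable
  also have "\<dots> = (\<integral>\<^sup>+v. ennreal ((\<Sum>\<^sub>\<infinity>x\<in>L. G (v + x)) * e v) * indicator D v \<partial>lborel)"
  proof (rule nn_integral_cong, rule arg_cong2[where f = "(*)"])
    fix v
    have "(\<integral>\<^sup>+x. ennreal (G (v + x) * e (v + x)) \<partial>count_space L) =
        (\<integral>\<^sup>+x. ennreal (G (v + x) * e v) \<partial>count_space L)"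
      by (rule nn_integral_cong) (simp add: e)
    also have "\<dots> = ennreal (\<Sum>\<^sub>\<infinity>x\<in>L. G (v + x) * e v)"
      by (rule nn_integral_count_space_infsum) (auto intro!: summable_on_cmult_left sum mult_nonneg_nonneg G e)
    also have "(\<Sum>\<^sub>\<infinity>x\<in>L. G (v + x) * e v) = (\<Sum>\<^sub>\<infinity>x\<in>L. G (v + x)) * e v"
      by (rule infsum_cmult_left) (rule sum)
    finally show "(\<integral>\<^sup>+x. ennreal (G (v + x) * e (v + x)) \<partial>count_space L) =
      ennreal ((\<Sum>\<^sub>\<infinity>x\<in>L. G (v + x)) * e v)" .
  qed simp
  also have "\<dots> = (\<integral>\<^sup>+v. ennreal ((\<Sum>\<^sub>\<infinity>x\<in>L. G (v + x)) * e v) \<partial>cell_measure)"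
    unfolding cell_measure_def by (rule nn_integral_restrict_space[symmetric]) simp
  finally have "(\<integral>\<^sup>+v. ennreal (G v * e v) \<partial>lborel) =
      (\<integral>\<^sup>+v. ennreal ((\<Sum>\<^sub>\<infinity>x\<in>L. G (v + x)) * e v) \<partial>cell_measure)" .
  moreover have "(\<lambda>v. (\<Sum>\<^sub>\<infinity>x\<in>L. G (v + x)) * e v) \<in> borel_measurable cell_measure"
    by (rule measurable_cell) measurable
  ultimately show ?thesis
    using G(2) e(2) nonneg by (subst (1 2) integral_eq_nn_integral) auto
qed

end

section \<open>Fourier coefficients of theta sums\<close>

locale unimodular_cell = lattice_cell L B D for L B D :: "(real ^ 'n::finite) set" +
  assumes self_dual: "L = dual_lattice L"
begin

definition chr :: "real ^ 'n \<Rightarrow> real ^ 'n \<Rightarrow> complex" where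
  "chr z v = cis (2 * pi * (z \<bullet> v))"

definition periodic :: "(real ^ 'n \<Rightarrow> 'b) \<Rightarrow> bool" where
  "periodic f \<longleftrightarrow> (\<forall>x\<in>L. \<forall>v. f (v + x) = f v)"

lemma periodicD: "periodic f \<Longrightarrow> x \<in> L \<Longrightarrow> f (v + x) = f v"
  by (simp add: periodic_def)

lemma inner_Ints: "x \<in> L \<Longrightarrow> y \<in> L \<Longrightarrow> x \<bullet> y \<in> \<int>"
  using self_dual by (auto simp: dual_lattice_def)

lemma chr_add_left: "chr (y + z) v = chr y v * chr z v"
  and chr_add: "chr z (v + w) = chr z v * chr z w"
  by (simp_all add: chr_def inner_left_distrib inner_right_distrib distrib_left cis_mult)

lemma chr_zero [simp]: "chr 0 v = 1"
  by (simp add: chr_def)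

lemma norm_chr [simp]: "norm (chr z v) = 1"
  by (simp add: chr_def)

lemma continuous_chr: "continuous_on A (chr z)"
  unfolding chr_def[abs_def] by (intro continuous_intros)

lemma chr_lattice: "z \<in> L \<Longrightarrow> x \<in> L \<Longrightarrow> chr z x = 1"
  unfolding chr_def by (intro cis_multiple_2pi inner_Ints)

lemma periodic_chr: "z \<in> L \<Longrightarrow> periodic (chr z)"
  by (simp add: periodic_def chr_add chr_lattice)

lemma cell_representative:
  obtains x where "x \<in> L" "v + x \<in> D"
  using D_unique[of v] by auto

lemma periodic_bounded:
  fixes f :: "real ^ 'n \<Rightarrow> 'b::real_normed_vector"
  assumes "continuous_on UNIV f" "periodic f"
  obtains K where "K > 0" "\<And>v. norm (f v) \<le> K"
proof -
  have "compact (f ` closure D)"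
    using D_bounded by (intro compact_continuous_image continuous_on_subset[OF assms(1)]) auto
  then have "bounded (f ` closure D)" by (rule compact_imp_bounded)
  then obtain K where K: "K > 0" "\<forall>w\<in>f ` closure D. norm w \<le> K"
    unfolding bounded_pos by blast
  have "norm (f v) \<le> K" for v
  proof -
    obtain x where x: "x \<in> L" "v + x \<in> D" by (rule cell_representative)
    then have "norm (f (v + x)) \<le> K" using K closure_subset[of D] by blast
    then show ?thesis using periodicD[OF assms(2) x(1)] by simp
  qed
  with K that show ?thesis by blast
qed

text \<open>The translated domain is also a fundamental domain: the indicator of \<open>D + a\<close> sums up to \<open>1\<close>
  over \<open>L\<close>, so unfolding compares the integrals over the two domains. Adding a constant reduces to
  nonnegative functions.\<close>

lemma integral_cell_translate_real:
  fixes f :: "real ^ 'n \<Rightarrow> real"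
  assumes f: "continuous_on UNIV f" "periodic f"
  shows "(LINT v|cell_measure. f (v + a)) = (LINT v|cell_measure. f v)"
proof -
  obtain K where K: "K > 0" "\<And>v. norm (f v) \<le> K"
    by (rule periodic_bounded[OF f]) blast
  have [measurable]: "f \<in> borel_measurable borel"
    using f(1) by (rule borel_measurable_continuous_onI)
  define G :: "real ^ 'n \<Rightarrow> real" where "G = (\<lambda>v. indicator D (v - a))"
  have G_sum: "((\<lambda>x. G (v + x)) has_sum 1) L" for v
  proof -
    obtain x0 where x0: "x0 \<in> L" "v - a + x0 \<in> D" "\<And>x. x \<in> L \<Longrightarrow> v - a + x \<in> D \<Longrightarrow> x = x0"
      using D_unique[of "v - a"] by auto
    have "v + x0 - a \<in> D" using x0(2) by (simp add: algebra_simps)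
    then have "(\<Sum>x\<in>{x0}. G (v + x)) = 1" by (simp add: G_def)
    then have "((\<lambda>x. G (v + x)) has_sum 1) {x0}"
      by (metis finite.emptyI finite.insertI has_sum_finite)
    moreover have "((\<lambda>x. G (v + x)) has_sum 1) {x0} \<longleftrightarrow> ((\<lambda>x. G (v + x)) has_sum 1) L"
    proof (rule has_sum_cong_neutral)
      fix x assume "x \<in> L - {x0}"
      then have "v - a + x \<notin> D" using x0(3) by blast
      then show "G (v + x) = 0" by (simp add: G_def algebra_simps)
    qed (use x0(1) in auto)
    ultimately show ?thesis by (rule rev_iffD1)
  qed
  have sum1: "(\<Sum>\<^sub>\<infinity>x\<in>L. G (v + x)) = 1" for v
    using G_sum by (rule infsumI)
  have shift: "(LINT v|lborel. G v * g v) = (LINT v|cell_measure. g (v + a))"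
    if [measurable]: "g \<in> borel_measurable borel" for g :: "real ^ 'n \<Rightarrow> real"
  proof -
    have "(LINT v|lborel. G v * g v) = (LINT v|distr lborel borel ((+) a). G v * g v)"
      by (simp add: lborel_distr_plus)
    also have "\<dots> = (LINT v|lborel. G (a + v) * g (a + v))"
      unfolding G_def by (rule integral_distr) measurable
    also have "\<dots> = (LINT v|cell_measure. g (v + a))"
      unfolding cell_measure_def
      by (subst integral_restrict_space) (simp_all add: G_def add.commute)
    finally show ?thesis .
  qed
  have nonneg: "(LINT v|cell_measure. g (v + a)) = (LINT v|cell_measure. g v)"
    if "g \<in> borel_measurable borel" "\<And>v. 0 \<le> g v" "periodic g" for g :: "real ^ 'n \<Rightarrow> real"
  proof -
    have "(LINT v|lborel. G v * g v) = (LINT v|cell_measure. (\<Sum>\<^sub>\<infinity>x\<in>L. G (v + x)) * g v)"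
    proof (rule integral_unfold_nonneg)
      show "(\<lambda>x. G (v + x)) summable_on L" for v
        using G_sum by (rule has_sum_imp_summable)
      show "G \<in> borel_measurable borel" unfolding G_def by measurable
    qed (use that in \<open>auto simp: G_def sum1[unfolded G_def] periodic_def\<close>)
    then show ?thesis
      using shift[OF that(1)] by (simp add: sum1)
  qed
  have int: "integrable cell_measure f" "integrable cell_measure (\<lambda>v. f (v + a))"
    "integrable cell_measure (\<lambda>v. K)"
    by (intro integrable_cell continuous_intros f continuous_on_compose2[OF f(1)]; simp)+
  have "(LINT v|cell_measure. f (v + a) + K) = (LINT v|cell_measure. f v + K)"
  proof (rule nonneg)
    show "0 \<le> f v + K" for v using K(2)[of v] by (auto simp: abs_le_iff)
    show "periodic (\<lambda>v. f v + K)" using f(2) by (simp add: periodic_def)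
  qed measurable
  then show ?thesis
    using int by (simp add: Bochner_Integration.integral_add)
qed

lemma integral_cell_complex:
  fixes f :: "real ^ 'n \<Rightarrow> complex"
  assumes "continuous_on UNIV f"
  shows "(LINT v|cell_measure. f v) =
    Complex (LINT v|cell_measure. Re (f v)) (LINT v|cell_measure. Im (f v))"
  using integrable_cell[OF assms] by (simp add: complex_eq_iff)

lemma integral_cell_translate:
  fixes f :: "real ^ 'n \<Rightarrow> complex"
  assumes f: "continuous_on UNIV f" "periodic f"
  shows "(LINT v|cell_measure. f (v + a)) = (LINT v|cell_measure. f v)"
proof -
  have c: "continuous_on UNIV (\<lambda>v. f (v + a))"
    by (rule continuous_on_compose2[OF f(1)]) (auto intro!: continuous_intros)
  have "(LINT v|cell_measure. Re (f (v + a))) = (LINT v|cell_measure. Re (f v))"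
    "(LINT v|cell_measure. Im (f (v + a))) = (LINT v|cell_measure. Im (f v))"
    by (rule integral_cell_translate_real[of "\<lambda>v. Re (f v)"]
             integral_cell_translate_real[of "\<lambda>v. Im (f v)"];
        use f in \<open>auto intro!: continuous_intros simp: periodic_def\<close>)+
  then show ?thesis
    by (simp add: integral_cell_complex[OF c] integral_cell_complex[OF f(1)])
qed

definition cell_volume :: real where
  "cell_volume = measure cell_measure (space cell_measure)"

lemma integral_chr:
  assumes "z \<in> L"
  shows "(LINT v|cell_measure. chr z v) = (if z = 0 then of_real cell_volume else 0)"
proof (cases "z = 0")
  case True
  then show ?thesis
    by (simp add: cell_volume_def scaleR_conv_of_real)
next
  case False
  \<comment> \<open>Translation by \<open>a\<close> multiplies the character by \<open>-1\<close>.\<close>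
  define a where "a = (1 / (2 * (z \<bullet> z))) *\<^sub>R z"
  have "chr z a = - 1"
    using False by (simp add: chr_def a_def)
  then have "(LINT v|cell_measure. chr z (v + a)) = - (LINT v|cell_measure. chr z v)"
    by (simp add: chr_add)
  moreover have "(LINT v|cell_measure. chr z (v + a)) = (LINT v|cell_measure. chr z v)"
    by (rule integral_cell_translate[OF continuous_chr periodic_chr[OF assms]])
  ultimately show ?thesis using False by (simp add: eq_neg_iff_add_eq_0)
qed

text \<open>The theta sum is the sum of a Gaussian over all lattice translates, so unfolding applies;
  adding a constant makes \<open>e\<close> nonnegative.\<close>

lemma integral_theta_sum_real:
  fixes e :: "real ^ 'n \<Rightarrow> real"
  assumes t: "t > 0" and e: "continuous_on UNIV e" "periodic e"
  shows "(LINT v|lborel. exp (- pi * t * (v \<bullet> v)) * e v) = (LINT v|cell_measure. theta_sum t v * e v)"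
proof -
  let ?G = "\<lambda>v :: real ^ 'n. exp (- pi * t * (v \<bullet> v))"
  obtain K where K: "K > 0" "\<And>v. norm (e v) \<le> K"
    by (rule periodic_bounded[OF e]) blast
  have [measurable]: "e \<in> borel_measurable borel"
    using e(1) by (rule borel_measurable_continuous_onI)
  have meas: "theta_sum t \<in> borel_measurable borel"
    by (rule borel_measurable_continuous_onI[OF theta_sum_continuous[OF t]])
  have nonneg: "(LINT v|lborel. ?G v * g v) = (LINT v|cell_measure. theta_sum t v * g v)"
    if "g \<in> borel_measurable borel" "\<And>v. 0 \<le> g v" "periodic g" for g :: "real ^ 'n \<Rightarrow> real"
    unfolding theta_sum_def
  proof (rule integral_unfold_nonneg)
    show "(\<lambda>x. ?G (v + x)) summable_on L" for v
      using gaussian_shift_summable[of "pi * t" v] t by simp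
    show "(\<lambda>v. \<Sum>\<^sub>\<infinity>x\<in>L. ?G (v + x)) \<in> borel_measurable borel"
      using meas by (simp add: theta_sum_def[abs_def])
  qed (use that in \<open>auto simp: periodic_def\<close>)
  have G: "integrable lborel ?G"
    by (rule gaussian_integral(1)[OF t])
  have Ge: "integrable lborel (\<lambda>v. ?G v * e v)"
  proof (rule Bochner_Integration.integrable_bound[of _ "\<lambda>v. ?G v * K"])
    show "AE v in lborel. norm (?G v * e v) \<le> norm (?G v * K)"
      using K by (intro AE_I2) (auto simp: abs_mult intro!: mult_left_mono)
  qed (use G in auto)
  have "(LINT v|lborel. ?G v * (e v + K)) = (LINT v|cell_measure. theta_sum t v * (e v + K))"
  proof (rule nonneg)
    show "0 \<le> e v + K" for v using K(2)[of v] by (auto simp: abs_le_iff)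
    show "periodic (\<lambda>v. e v + K)" using e(2) by (simp add: periodic_def)
  qed measurable
  moreover have "(LINT v|lborel. ?G v * K) = (LINT v|cell_measure. theta_sum t v * K)"
    by (rule nonneg) (use K in \<open>auto simp: periodic_def\<close>)
  moreover have "integrable cell_measure (\<lambda>v. theta_sum t v * e v)" "integrable cell_measure (\<lambda>v. theta_sum t v * K)"
    by (intro integrable_cell continuous_intros theta_sum_continuous t e)+
  moreover have "(LINT v|lborel. ?G v * (e v + K)) = (LINT v|lborel. ?G v * e v) + (LINT v|lborel. ?G v * K)"
    unfolding distrib_left by (rule Bochner_Integration.integral_add[OF Ge]) (use G in simp)
  moreover have "(LINT v|cell_measure. theta_sum t v * (e v + K)) =
      (LINT v|cell_measure. theta_sum t v * e v) + (LINT v|cell_measure. theta_sum t v * K)"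
    unfolding distrib_left using calculation(3,4) by (rule Bochner_Integration.integral_add)
  ultimately show ?thesis by linarith
qed

text \<open>The Fourier coefficients of a periodization are values of the Fourier transform, here of a
  Gaussian.\<close>

lemma theta_sum_fourier:
  assumes t: "t > 0" and z: "z \<in> L"
  shows "(LINT v|cell_measure. of_real (theta_sum t v) * chr z v) =
           of_real (exp (- pi * (z \<bullet> z) / t) / sqrt t ^ CARD('n))"
proof -
  have c: "continuous_on UNIV (\<lambda>v. complex_of_real (theta_sum t v) * chr z v)"
    by (intro continuous_intros theta_sum_continuous t continuous_chr)
  let ?g = "\<lambda>v. complex_of_real (exp (- pi * t * (v \<bullet> v))) * chr z v"
  have g: "complex_of_real (exp (- pi * t * (v \<bullet> v))) * iexp (2 * pi * (z \<bullet> v)) = ?g v" for v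
    by (simp add: chr_def cis_conv_exp)
  note G = gaussian_fourier[OF t, of z, unfolded g]
  have "(LINT v|cell_measure. Re (of_real (theta_sum t v) * chr z v)) = Re (LINT v|lborel. ?g v)"
    using integral_theta_sum_real[OF t, of "\<lambda>v. Re (chr z v)"] periodic_chr[OF z]
    unfolding integral_Re[OF G(1), symmetric]
    by (simp add: periodic_def continuous_intros continuous_chr)
  moreover have "(LINT v|cell_measure. Im (of_real (theta_sum t v) * chr z v)) = Im (LINT v|lborel. ?g v)"
    using integral_theta_sum_real[OF t, of "\<lambda>v. Im (chr z v)"] periodic_chr[OF z]
    unfolding integral_Im[OF G(1), symmetric]
    by (simp add: periodic_def continuous_intros continuous_chr)
  ultimately have "(LINT v|cell_measure. of_real (theta_sum t v) * chr z v) = (LINT v|lborel. ?g v)"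
    unfolding integral_cell_complex[OF c] by (simp add: complex_eq_iff)
  also have "\<dots> = of_real (exp (- pi * (z \<bullet> z) / t) / sqrt t ^ CARD('n))"
    using G(2) by simp
  finally show ?thesis .
qed

text \<open>The Fourier series of the theta sum up to normalization. Its frequencies range over the dual
  lattice, which is \<open>L\<close> itself.\<close>

definition dual_theta :: "real \<Rightarrow> real ^ 'n \<Rightarrow> complex" where
  "dual_theta t v = (\<Sum>\<^sub>\<infinity>y\<in>L. of_real (exp (- pi * (y \<bullet> y) / t)) * chr y v)"

lemma dual_theta_uniform_limit:
  assumes "t > 0"
  shows "uniform_limit UNIV (\<lambda>X v. \<Sum>y\<in>X. of_real (exp (- pi * (y \<bullet> y) / t)) * chr y v)
           (dual_theta t) (finite_subsets_at_top L)"
  unfolding dual_theta_def[abs_def]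
proof (rule Weierstrass_m_test_general)
  show "(\<lambda>y. exp (- (pi / t) * (y \<bullet> y))) summable_on L"
    by (rule gaussian_summable) (use assms in auto)
qed (simp add: norm_mult)

lemma dual_theta_continuous:
  assumes "t > 0"
  shows "continuous_on UNIV (dual_theta t)"
  by (rule uniform_limit_theorem[OF _ dual_theta_uniform_limit[OF assms]])
     (auto intro!: always_eventually continuous_intros continuous_chr)

lemma dual_theta_periodic: "periodic (dual_theta t)"
  unfolding periodic_def dual_theta_def
  by (auto simp: chr_add chr_lattice intro!: infsum_cong)

text \<open>Uniform convergence reduces the integral to finite partial sums, for which orthogonality of
  characters applies.\<close>

lemma dual_theta_fourier:
  assumes t: "t > 0" and z: "z \<in> L"
  shows "(LINT v|cell_measure. dual_theta t v * chr z v) = of_real (cell_volume * exp (- pi * (z \<bullet> z) / t))"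
proof -
  let ?S = "\<lambda>X v. \<Sum>y\<in>X. of_real (exp (- pi * (y \<bullet> y) / t)) * chr y v"
  have int_S: "(LINT v|cell_measure. ?S X v * chr z v) = of_real (cell_volume * exp (- pi * (z \<bullet> z) / t))"
    if X: "finite X" "{- z} \<subseteq> X" "X \<subseteq> L" for X
  proof -
    have "(LINT v|cell_measure. ?S X v * chr z v) =
        (LINT v|cell_measure. (\<Sum>y\<in>X. of_real (exp (- pi * (y \<bullet> y) / t)) * chr (y + z) v))"
      by (simp add: chr_add_left sum_distrib_right mult.assoc)
    also have "\<dots> = (\<Sum>y\<in>X. LINT v|cell_measure. of_real (exp (- pi * (y \<bullet> y) / t)) * chr (y + z) v)"
      by (rule Bochner_Integration.integral_sum) (intro integrable_cell continuous_intros continuous_chr)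
    also have "\<dots> = (\<Sum>y\<in>X. if y = - z then of_real (exp (- pi * (z \<bullet> z) / t)) * of_real cell_volume else 0)"
    proof (rule sum.cong)
      fix y assume "y \<in> X"
      then have "y + z \<in> L" using X z by (auto intro: add_L)
      then show "(LINT v|cell_measure. of_real (exp (- pi * (y \<bullet> y) / t)) * chr (y + z) v) =
          (if y = - z then of_real (exp (- pi * (z \<bullet> z) / t)) * of_real cell_volume else 0)"
      proof (cases "y = - z")
        case True
        then show ?thesis by (simp add: cell_volume_def scaleR_conv_of_real)
      next
        case False
        then have "y + z \<noteq> 0" by (simp add: eq_neg_iff_add_eq_0)
        then show ?thesis using \<open>y + z \<in> L\<close> False by (simp add: integral_chr)
      qed
    qed simp
    also have "\<dots> = of_real (cell_volume * exp (- pi * (z \<bullet> z) / t))"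
      using X by (simp add: mult.commute)
    finally show ?thesis .
  qed
  define I where "I = (LINT v|cell_measure. dual_theta t v * chr z v)"
  have "norm (I - of_real (cell_volume * exp (- pi * (z \<bullet> z) / t))) \<le> \<epsilon> * cell_volume" if "\<epsilon> > 0" for \<epsilon>
  proof -
    have "\<forall>\<^sub>F X in finite_subsets_at_top L. \<forall>v\<in>UNIV. dist (?S X v) (dual_theta t v) < \<epsilon>"
      using dual_theta_uniform_limit[OF t] that unfolding uniform_limit_iff by blast
    moreover have "\<forall>\<^sub>F X in finite_subsets_at_top L. finite X \<and> {- z} \<subseteq> X \<and> X \<subseteq> L"
      unfolding eventually_finite_subsets_at_top
      by (intro exI[of _ "{- z}"]) (use z minus_L in auto)
    ultimately have "\<exists>X. (\<forall>v\<in>UNIV. dist (?S X v) (dual_theta t v) < \<epsilon>) \<and> finite X \<and> {- z} \<subseteq> X \<and> X \<subseteq> L"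
      by (intro eventually_happens'[OF finite_subsets_at_top_neq_bot]) (rule eventually_conj)
    then obtain X where X: "\<And>v. dist (?S X v) (dual_theta t v) < \<epsilon>" "finite X" "{- z} \<subseteq> X" "X \<subseteq> L"
      by auto
    have i1: "integrable cell_measure (\<lambda>v. dual_theta t v * chr z v)"
      by (intro integrable_cell continuous_intros dual_theta_continuous t continuous_chr)
    have i2: "integrable cell_measure (\<lambda>v. ?S X v * chr z v)"
      by (intro integrable_cell continuous_intros continuous_chr)
    have "I - of_real (cell_volume * exp (- pi * (z \<bullet> z) / t)) =
        (LINT v|cell_measure. dual_theta t v * chr z v - ?S X v * chr z v)"
      unfolding int_S[OF X(2-4), symmetric] I_def using i1 i2 by simp
    also have "norm \<dots> \<le> (LINT v|cell_measure. norm (dual_theta t v * chr z v - ?S X v * chr z v))"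
      by (rule integral_norm_bound)
    also have "\<dots> \<le> (LINT v|cell_measure. \<epsilon>)"
    proof (rule integral_mono)
      show "integrable cell_measure (\<lambda>v. norm (dual_theta t v * chr z v - ?S X v * chr z v))"
        using i1 i2 by auto
      show "integrable cell_measure (\<lambda>v. \<epsilon>)"
        by (intro integrable_cell continuous_intros)
      fix v
      have "dual_theta t v * chr z v - ?S X v * chr z v = (dual_theta t v - ?S X v) * chr z v"
        by (simp add: left_diff_distrib)
      then show "norm (dual_theta t v * chr z v - ?S X v * chr z v) \<le> \<epsilon>"
        using X(1)[of v] by (simp add: norm_mult dist_norm norm_minus_commute)
    qed
    also have "\<dots> = \<epsilon> * cell_volume" by (simp add: cell_volume_def)
    finally show ?thesis .
  qed
  note bound = this
  \<comment> \<open>A number that is at most \<open>\<epsilon> * cell_volume\<close> for all \<open>\<epsilon> > 0\<close> vanishes; the choice of \<open>\<epsilon>\<close> also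
    covers volume \<open>0\<close>.\<close>
  define d where "d = norm (I - of_real (cell_volume * exp (- pi * (z \<bullet> z) / t)))"
  have V: "cell_volume \<ge> 0" by (simp add: cell_volume_def)
  have "d \<le> 0"
  proof (rule ccontr)
    assume "\<not> d \<le> 0"
    then have "d \<le> d / (cell_volume + 1) * cell_volume"
      using V bound[of "d / (cell_volume + 1)"] by (simp add: d_def)
    then have "d * (cell_volume + 1) \<le> d * cell_volume"
      using V by (simp add: field_simps)
    then show False using \<open>\<not> d \<le> 0\<close> by (simp add: algebra_simps)
  qed
  then show ?thesis by (simp add: I_def d_def)
qed

end

section \<open>Poisson summation for unimodular lattices\<close>

lemma half_one_plus_cos_bounds:
  fixes x :: real
  shows "0 \<le> (1 + cos x) / 2" "(1 + cos x) / 2 \<le> 1"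
proof -
  have "0 \<le> (1 + c) / 2 \<and> (1 + c) / 2 \<le> 1" if "- 1 \<le> c" "c \<le> 1" for c :: real
    using that by simp
  from this[OF cos_ge_minus_one cos_le_one]
  show "0 \<le> (1 + cos x) / 2" "(1 + cos x) / 2 \<le> 1" by blast+
qed

context unimodular_cell
begin

inductive trig :: "(real ^ 'n \<Rightarrow> complex) \<Rightarrow> bool" where
  trig_chr: "z \<in> L \<Longrightarrow> trig (chr z)"
| trig_add: "trig p \<Longrightarrow> trig q \<Longrightarrow> trig (\<lambda>v. p v + q v)"
| trig_cmult: "trig p \<Longrightarrow> trig (\<lambda>v. c * p v)"

lemma trig_continuous: "trig p \<Longrightarrow> continuous_on UNIV p"
  by (induction rule: trig.induct) (auto intro!: continuous_intros continuous_chr)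

lemma trig_periodic: "trig p \<Longrightarrow> periodic p"
  by (induction rule: trig.induct) (use periodic_chr in \<open>auto simp: periodic_def\<close>)

lemma trig_const: "trig (\<lambda>_. c)"
  using trig_cmult[OF trig_chr[OF zero_L], of c] by simp

lemma trig_mult_chr: "trig p \<Longrightarrow> z \<in> L \<Longrightarrow> trig (\<lambda>v. p v * chr z v)"
proof (induction rule: trig.induct)
  case (trig_chr y)
  then show ?case
    using trig.trig_chr[OF add_L[of y z]] by (simp add: chr_add_left[abs_def])
next
  case (trig_add p q)
  then show ?case by (simp add: distrib_right trig.trig_add)
next
  case (trig_cmult p c)
  then show ?case by (simp add: mult.assoc trig.trig_cmult)
qed

lemma trig_mult: "trig q \<Longrightarrow> trig p \<Longrightarrow> trig (\<lambda>v. p v * q v)"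
proof (induction rule: trig.induct)
  case (trig_chr z)
  then show ?case by (intro trig_mult_chr)
next
  case (trig_add q q')
  then show ?case by (simp add: distrib_left trig.trig_add)
next
  case (trig_cmult q c)
  then show ?case using trig.trig_cmult[of "\<lambda>v. p v * q v" c] by (simp add: mult.left_commute)
qed

lemma trig_shift: "trig p \<Longrightarrow> trig (\<lambda>v. p (v - a))"
proof (induction rule: trig.induct)
  case (trig_chr z)
  then show ?case
    using trig.trig_cmult[OF trig.trig_chr[of z], of "chr z (- a)"]
    by (simp add: chr_add[of z _ "- a", simplified] mult.commute)
qed (auto intro: trig.intros)

text \<open>A product of one-dimensional kernels of Fejer type: a trigonometric polynomial with values
  in \<open>[0, 1]\<close> that takes the value \<open>1\<close> exactly on the lattice, so that its powers concentrate
  there.\<close>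

definition kernel :: "real ^ 'n \<Rightarrow> real" where
  "kernel v = (\<Prod>b\<in>B. (1 + cos (2 * pi * (b \<bullet> v))) / 2)"

lemma kernel_continuous: "continuous_on UNIV kernel"
  unfolding kernel_def[abs_def] by (intro continuous_intros) auto

lemma kernel_nonneg: "0 \<le> kernel v"
  unfolding kernel_def by (intro prod_nonneg half_one_plus_cos_bounds)

lemma kernel_le_1: "kernel v \<le> 1"
  unfolding kernel_def by (intro prod_le_1 conjI half_one_plus_cos_bounds)

lemma kernel_0: "kernel 0 = 1"
  by (simp add: kernel_def)

lemma kernel_eq_1:
  assumes "kernel v = 1"
  shows "v \<in> L"
proof -
  have "v \<bullet> b \<in> \<int>" if b: "b \<in> B" for b
  proof -
    let ?c = "\<lambda>b. (1 + cos (2 * pi * (b \<bullet> v))) / 2"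
    have "1 = ?c b * (\<Prod>b\<in>B - {b}. ?c b)"
      using assms b fin_B unfolding kernel_def by (subst prod.remove[symmetric]) auto
    also have "\<dots> \<le> ?c b * 1"
      by (intro mult_left_mono prod_le_1 conjI half_one_plus_cos_bounds)
    finally have "1 \<le> cos (2 * pi * (b \<bullet> v))" by (simp add: field_simps)
    then have "cos (2 * pi * (b \<bullet> v)) = 1" by (rule antisym[OF cos_le_one])
    then obtain n :: int where "2 * pi * (b \<bullet> v) = of_int n * 2 * pi"
      unfolding cos_one_2pi_int by blast
    then have "b \<bullet> v = of_int n" by simp
    then show ?thesis by (simp add: inner_commute)
  qed
  then show ?thesis using dual_B self_dual by blast
qed

lemma kernel_periodic: "periodic kernel"
  unfolding periodic_def
proof (intro ballI allI)
  fix x v assume x: "x \<in> L"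
  have "cos (2 * pi * (b \<bullet> (v + x))) = cos (2 * pi * (b \<bullet> v))" if "b \<in> B" for b
  proof -
    have "chr b (v + x) = chr b v"
      using that B_L x by (simp add: chr_add chr_lattice subset_iff)
    then show ?thesis by (simp add: chr_def complex_eq_iff)
  qed
  then show "kernel (v + x) = kernel v" by (simp add: kernel_def)
qed

lemma trig_kernel: "trig (\<lambda>v. of_real (kernel v))"
proof -
  have "trig (\<lambda>v. \<Prod>b\<in>X. (1 + complex_of_real (cos (2 * pi * (b \<bullet> v)))) / 2)" if "finite X" "X \<subseteq> B" for X
    using that
  proof (induction X rule: finite_induct)
    case empty
    then show ?case by (simp add: trig_const)
  next
    case (insert b X)
    have b: "b \<in> L" "- b \<in> L" using insert.prems B_L minus_L by auto
    have "(1 + complex_of_real (cos (2 * pi * (b \<bullet> v)))) / 2 =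
        1 / 2 + (1 / 4 * chr b v + 1 / 4 * chr (- b) v)" for v
      by (simp add: chr_def complex_eq_iff)
    then have "(\<lambda>v. (1 + complex_of_real (cos (2 * pi * (b \<bullet> v)))) / 2) =
        (\<lambda>v. 1 / 2 + (1 / 4 * chr b v + 1 / 4 * chr (- b) v))"
      by (intro ext)
    then have "trig (\<lambda>v. (1 + complex_of_real (cos (2 * pi * (b \<bullet> v)))) / 2)"
      using trig_add[OF trig_const[of "1 / 2"] trig_add[OF trig_cmult[OF trig_chr[OF b(1)], of "1 / 4"]
        trig_cmult[OF trig_chr[OF b(2)], of "1 / 4"]]] by (simp only:)
    then show ?case
      using trig_mult[OF insert.IH] insert.prems insert.hyps
      unfolding prod.insert[OF insert.hyps] by blast
  qed
  from this[OF fin_B] show ?thesis by (simp add: kernel_def)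
qed

lemma trig_kernel_power: "trig (\<lambda>v. of_real (kernel v ^ N))"
proof (induction N)
  case 0
  then show ?case by (simp add: trig_const)
next
  case (Suc N)
  then show ?case using trig_mult[OF Suc trig_kernel] by simp
qed

text \<open>Suppose \<open>h 0 = a > 0\<close>. Near the lattice \<open>h > a / 2\<close>, and even closer the kernel exceeds some
  \<open>s\<close>, whereas away from the lattice it is at most some \<open>r < s\<close> by compactness. So the integral
  against the \<open>N\<close>-th power is at least \<open>const * s^N - const * r^N\<close>, which is positive for large
  \<open>N\<close>.\<close>

lemma kernel_concentrates:
  fixes h :: "real ^ 'n \<Rightarrow> real"
  assumes h: "continuous_on UNIV h" "periodic h"
    and int: "\<And>N. (LINT v|cell_measure. h v * kernel v ^ N) = 0"
  shows "h 0 \<le> 0"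
proof (rule ccontr)
  assume "\<not> h 0 \<le> 0"
  define a where "a = h 0"
  have a: "a > 0" using \<open>\<not> h 0 \<le> 0\<close> by (simp add: a_def)
  obtain K where K: "K > 0" "\<And>v. norm (h v) \<le> K"
    by (rule periodic_bounded[OF h]) blast
  have "isCont h 0" using h(1) by (simp add: continuous_on_eq_continuous_at)
  then obtain \<delta> where \<delta>: "\<delta> > 0" "\<And>v. dist v 0 < \<delta> \<Longrightarrow> dist (h v) (h 0) < a / 2"
    unfolding continuous_at_eps_delta using a by (meson half_gt_zero)
  have tube: "\<exists>w. f v = f w \<and> dist w 0 < r" if "periodic f" "v \<in> (\<Union>x\<in>L. ball x r)"
    for f :: "real ^ 'n \<Rightarrow> real" and v r
  proof -
    from that obtain x where x: "x \<in> L" "dist x v < r" by auto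
    have "f (v + - x) = f v" by (rule periodicD[OF that(1) minus_L[OF x(1)]])
    then show ?thesis using x(2) by (intro exI[of _ "v - x"]) (simp add: dist_norm norm_minus_commute)
  qed
  define U where "U = (\<Union>x\<in>L. ball x \<delta>)"
  have hU: "h v > a / 2" if "v \<in> U" for v
  proof -
    obtain w where "h v = h w" "dist w 0 < \<delta>"
      using tube[OF h(2), of v \<delta>] \<open>v \<in> U\<close> unfolding U_def by blast
    then show ?thesis using \<delta>(2)[of w] unfolding dist_real_def a_def by linarith
  qed
  define Z where "Z = closure D - U"
  have "compact Z"
    unfolding Z_def U_def using D_bounded by (intro compact_diff) auto
  have kZ: "kernel v < 1" if "v \<in> Z" for v
    using kernel_eq_1[of v] kernel_le_1[of v] that \<delta>(1) by (force simp: Z_def U_def)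
  have "\<exists>r. 0 \<le> r \<and> r < 1 \<and> (\<forall>v\<in>Z. kernel v \<le> r)"
  proof (cases "Z = {}")
    case False
    then obtain w where w: "w \<in> Z" "\<forall>v\<in>Z. kernel v \<le> kernel w"
      using continuous_attains_sup[OF \<open>compact Z\<close> False continuous_on_subset[OF kernel_continuous]] by auto
    then show ?thesis using kZ kernel_nonneg by blast
  qed (auto intro: exI[of _ 0])
  then obtain r where r: "0 \<le> r" "r < 1" "\<And>v. v \<in> Z \<Longrightarrow> kernel v \<le> r" by blast
  define s where "s = (1 + r) / 2"
  have s: "r < s" "s < 1" "0 < s" using r by (auto simp: s_def)
  have "isCont kernel 0" using kernel_continuous by (simp add: continuous_on_eq_continuous_at)
  then obtain \<eta>' where \<eta>': "\<eta>' > 0" "\<And>v. dist v 0 < \<eta>' \<Longrightarrow> dist (kernel v) (kernel 0) < 1 - s"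
    unfolding continuous_at_eps_delta using s by (meson diff_gt_0_iff_gt)
  define \<eta> where "\<eta> = min \<delta> \<eta>'"
  have \<eta>: "\<eta> > 0" using \<delta> \<eta>' by (simp add: \<eta>_def)
  define W where "W = (\<Union>x\<in>L. ball x \<eta>)"
  have W_open: "open W" by (auto simp: W_def)
  then have W_borel [measurable]: "W \<in> sets borel" by (rule borel_open)
  have W_U: "W \<subseteq> U" by (force simp: W_def U_def \<eta>_def)
  have kW: "kernel v > s" if "v \<in> W" for v
  proof -
    obtain w where "kernel v = kernel w" "dist w 0 < \<eta>"
      using tube[OF kernel_periodic, of v \<eta>] \<open>v \<in> W\<close> unfolding W_def by blast
    then show ?thesis using \<eta>'(2)[of w] unfolding dist_real_def kernel_0 \<eta>_def by linarith
  qed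
  define m where "m = (LINT v|cell_measure. indicat_real W v)"
  have W_periodic: "v + x \<in> W \<longleftrightarrow> v \<in> W" if x: "x \<in> L" for v x
  proof -
    have "v + x \<in> W" if "x \<in> L" "v \<in> W" for x v
    proof -
      from that obtain y where "y \<in> L" "dist y v < \<eta>" by (auto simp: W_def)
      then show ?thesis using that
        by (auto simp: W_def dist_norm algebra_simps intro!: bexI[of _ "y + x"] add_L)
    qed
    from this[of x v] this[of "- x" "v + x"] show ?thesis using x minus_L by auto
  qed
  have ind_int: "integrable cell_measure (indicat_real W)"
    by (rule finite_measure.integrable_const_bound[OF finite_measure_cell, of _ 1])
       (auto simp: indicator_def intro!: measurable_cell)
  have "m > 0"
  proof (rule ccontr)
    assume "\<not> m > 0"
    moreover have "m \<ge> 0" by (simp add: m_def integral_nonneg)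
    ultimately have "m = 0" by simp
    then have "AE v in cell_measure. indicat_real W v = 0"
      unfolding m_def using ind_int by (subst (asm) integral_nonneg_eq_0_iff_AE) auto
    then have "AE v in lborel. v \<in> D \<longrightarrow> v \<notin> W"
      unfolding cell_measure_def by (subst (asm) AE_restrict_space_iff) (auto simp: indicator_def)
    then have "AE v in lborel. (\<integral>\<^sup>+x. indicator W (v + x) \<partial>count_space L) * indicator D v = (0 :: ennreal)"
    proof eventually_elim
      case (elim v)
      have "(\<integral>\<^sup>+x. indicator W (v + x) \<partial>count_space L) = (\<integral>\<^sup>+x. indicator W v \<partial>count_space L)"
        by (rule nn_integral_cong) (simp add: W_periodic indicator_def)
      then show ?case using elim by (auto simp: indicator_def)
    qed
    then have "(\<integral>\<^sup>+v. (\<integral>\<^sup>+x. indicator W (v + x) \<partial>count_space L) * indicator D v \<partial>lborel) = (\<integral>\<^sup>+v. 0 \<partial>(lborel :: (real ^ 'n) measure))"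
      by (rule nn_integral_cong_AE)
    moreover have "(\<integral>\<^sup>+v. indicator W v \<partial>lborel) =
        (\<integral>\<^sup>+v. (\<integral>\<^sup>+x. indicator W (v + x) \<partial>count_space L) * indicator D v \<partial>lborel)"
      by (rule nn_integral_unfold) measurable
    ultimately have "emeasure lborel W = 0" by simp
    moreover have "ball 0 \<eta> \<subseteq> W" using zero_L by (auto simp: W_def)
    ultimately have "emeasure lborel (ball (0 :: real ^ 'n) \<eta>) \<le> 0"
      using emeasure_mono[of "ball 0 \<eta>" W lborel] by simp
    moreover have "emeasure lborel (ball (0 :: real ^ 'n) \<eta>) > 0"
      using \<eta> emeasure_lborel_ball_finite[of "0 :: real ^ 'n" \<eta>] content_ball_pos[of \<eta> "0 :: real ^ 'n"]
      by (metis emeasure_eq_measure2 ennreal_0 less_irrefl measure_def enn2real_0 not_gr_zero)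
    ultimately show False by simp
  qed
  have ineq: "a / 2 * m * s ^ N \<le> K * cell_volume * r ^ N" for N
  proof -
    have ptw: "a / 2 * s ^ N * indicat_real W v - K * r ^ N \<le> h v * kernel v ^ N" if vD: "v \<in> D" for v
    proof -
      consider "v \<in> W" | "v \<in> U" "v \<notin> W" | "v \<in> Z"
        using vD closure_subset[of D] unfolding Z_def by blast
      moreover have "0 \<le> K * r ^ N" using K r by simp
      ultimately show ?thesis
      proof cases
        case 1
        have "a / 2 * s ^ N \<le> h v * kernel v ^ N"
          using hU[of v] kW[of v] W_U 1 a s by (intro mult_mono power_mono) auto
        then show ?thesis using 1 \<open>0 \<le> K * r ^ N\<close> by simp
      next
        case 2
        then have "0 \<le> h v * kernel v ^ N"
          using hU[of v] a kernel_nonneg[of v] by (intro mult_nonneg_nonneg) auto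
        then show ?thesis using 2 \<open>0 \<le> K * r ^ N\<close> by simp
      next
        case 3
        then have "v \<notin> W" using W_U by (auto simp: Z_def)
        have "- (h v * kernel v ^ N) \<le> \<bar>h v\<bar> * kernel v ^ N"
          using kernel_nonneg[of v] by (metis abs_ge_minus_self abs_mult abs_of_nonneg zero_le_power)
        also have "\<dots> \<le> K * r ^ N"
          using K(2)[of v] r(3)[OF 3] kernel_nonneg[of v] K(1) by (intro mult_mono power_mono) auto
        finally show ?thesis using \<open>v \<notin> W\<close> by simp
      qed
    qed
    have "(LINT v|cell_measure. a / 2 * s ^ N * indicat_real W v - K * r ^ N) \<le> (LINT v|cell_measure. h v * kernel v ^ N)"
    proof (rule integral_mono)
      show "integrable cell_measure (\<lambda>v. a / 2 * s ^ N * indicat_real W v - K * r ^ N)"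
        by (intro Bochner_Integration.integrable_diff integrable_mult_right ind_int integrable_cell continuous_intros)
      show "integrable cell_measure (\<lambda>v. h v * kernel v ^ N)"
        by (intro integrable_cell continuous_intros h kernel_continuous)
    qed (use ptw in \<open>simp add: space_cell_measure\<close>)
    also have "\<dots> = 0" by (rule int)
    also have "(LINT v|cell_measure. a / 2 * s ^ N * indicat_real W v - K * r ^ N) =
        a / 2 * s ^ N * m - K * r ^ N * cell_volume"
    proof (subst Bochner_Integration.integral_diff)
      show "integrable cell_measure (\<lambda>v. a / 2 * s ^ N * indicat_real W v)"
        by (intro integrable_mult_right ind_int)
      show "integrable cell_measure (\<lambda>v. K * r ^ N)"
        by (intro integrable_cell continuous_intros)
    qed (simp add: m_def cell_volume_def)
    finally show ?thesis by (simp add: mult_ac)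
  qed
  have "(\<lambda>N. K * cell_volume * (r / s) ^ N) \<longlonglongrightarrow> K * cell_volume * 0"
    using r s by (intro tendsto_intros LIMSEQ_power_zero) auto
  moreover have "a / 2 * m \<le> K * cell_volume * (r / s) ^ N" for N
    using ineq[of N] s by (simp add: power_divide field_simps)
  ultimately have "a / 2 * m \<le> 0"
    by (intro LIMSEQ_le_const[of "\<lambda>N. K * cell_volume * (r / s) ^ N"]) auto
  then show False using a \<open>m > 0\<close> by (simp add: mult_le_0_iff)
qed

text \<open>Test the translate of \<open>H\<close> by \<open>w\<close> against the powers of the kernel; all these integrals are
  combinations of Fourier coefficients of \<open>H\<close>.\<close>

lemma fourier_uniqueness:
  assumes H: "continuous_on UNIV H" "periodic H"
    and coeff: "\<And>z. z \<in> L \<Longrightarrow> (LINT v|cell_measure. H v * chr z v) = 0"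
  shows "H w = 0"
proof -
  have orth: "(LINT v|cell_measure. H v * p v) = 0" if "trig p" for p
    using that
  proof (induction rule: trig.induct)
    case (trig_chr z)
    then show ?case by (rule coeff)
  next
    case (trig_add p q)
    have "integrable cell_measure (\<lambda>v. H v * p v)" "integrable cell_measure (\<lambda>v. H v * q v)"
      by (intro integrable_cell continuous_intros H trig_continuous trig_add)+
    then show ?case using trig_add by (simp add: distrib_left)
  next
    case (trig_cmult p c)
    have "(LINT v|cell_measure. H v * (c * p v)) = (LINT v|cell_measure. c * (H v * p v))"
      by (simp add: mult.left_commute)
    then show ?case using trig_cmult by simp
  qed
  define G where "G = (\<lambda>v. H (v + w))"
  have G: "continuous_on UNIV G" "periodic G"
    unfolding G_def using H(2)
    by (auto simp: periodic_def add_ac intro!: continuous_on_compose2[OF H(1)] continuous_intros)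
  have G_orth: "(LINT v|cell_measure. G v * of_real (kernel v ^ N)) = 0" for N
  proof -
    let ?p = "\<lambda>v. complex_of_real (kernel v ^ N)"
    have "(LINT v|cell_measure. G v * ?p v) = (LINT v|cell_measure. (\<lambda>v. H v * ?p (v - w)) (v + w))"
      by (simp add: G_def)
    also have "\<dots> = (LINT v|cell_measure. H v * ?p (v - w))"
    proof (rule integral_cell_translate)
      have t: "trig (\<lambda>v. ?p (v - w))" by (rule trig_shift[OF trig_kernel_power])
      show "continuous_on UNIV (\<lambda>v. H v * ?p (v - w))"
        by (intro continuous_on_mult H trig_continuous[OF t])
      show "periodic (\<lambda>v. H v * ?p (v - w))"
        using H(2) trig_periodic[OF t] by (simp add: periodic_def)
    qed
    also have "\<dots> = 0" by (rule orth[OF trig_shift[OF trig_kernel_power]])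
    finally show ?thesis .
  qed
  have c: "continuous_on UNIV (\<lambda>v. G v * of_real (kernel v ^ N))" for N
    by (intro continuous_intros G kernel_continuous)
  have re: "(LINT v|cell_measure. Re (G v) * kernel v ^ N) = 0"
    and im: "(LINT v|cell_measure. Im (G v) * kernel v ^ N) = 0" for N
    using G_orth[of N] unfolding integral_cell_complex[OF c] by (simp_all add: complex_eq_iff)
  have "Re (G 0) \<le> 0" "- Re (G 0) \<le> 0" "Im (G 0) \<le> 0" "- Im (G 0) \<le> 0"
    by (rule kernel_concentrates[of "\<lambda>v. Re (G v)"] kernel_concentrates[of "\<lambda>v. - Re (G v)"]
          kernel_concentrates[of "\<lambda>v. Im (G v)"] kernel_concentrates[of "\<lambda>v. - Im (G v)"];
        use G re im in \<open>auto intro!: continuous_intros simp: periodic_def\<close>)+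
  then have "G 0 = 0" by (simp add: complex_eq_iff)
  then show ?thesis by (simp add: G_def)
qed

text \<open>Both sides are continuous and periodic with the same Fourier coefficients.\<close>

lemma theta_sum_eq_dual_theta_volume:
  assumes "t > 0"
  shows "cell_volume > 0"
    and "of_real (theta_sum t v) = of_real (1 / (cell_volume * sqrt t ^ CARD('n))) * dual_theta t v"
proof -
  let ?c = "1 / sqrt t ^ CARD('n)"
  have theta: "continuous_on UNIV (\<lambda>v. complex_of_real (theta_sum t v))"
    "periodic (\<lambda>v. complex_of_real (theta_sum t v))"
    by (auto intro!: continuous_intros theta_sum_continuous assms simp: periodic_def theta_sum_periodic)
  show V: "cell_volume > 0"
  proof (rule ccontr)
    assume "\<not> cell_volume > 0"
    then have V0: "cell_volume = 0" by (simp add: cell_volume_def less_le)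
    obtain K where K: "\<And>v. norm (complex_of_real (theta_sum t v)) \<le> K"
      by (rule periodic_bounded[OF theta]) blast
    have "norm (LINT v|cell_measure. complex_of_real (theta_sum t v)) \<le> (LINT v|cell_measure. norm (complex_of_real (theta_sum t v)))"
      by (rule integral_norm_bound)
    also have "\<dots> \<le> (LINT v|cell_measure. K)"
      by (intro integral_mono integrable_cell continuous_intros theta_sum_continuous assms K)
    also have "\<dots> = 0" using V0 by (simp add: cell_volume_def)
    finally show False
      using theta_sum_fourier[OF assms zero_L] assms by simp
  qed
  define H where "H = (\<lambda>v. complex_of_real (theta_sum t v) - of_real (?c / cell_volume) * dual_theta t v)"
  have "H v = 0"
  proof (rule fourier_uniqueness)
    show "continuous_on UNIV H"
      unfolding H_def by (intro continuous_intros theta_sum_continuous dual_theta_continuous assms)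
    show "periodic H"
      using theta(2) dual_theta_periodic by (simp add: periodic_def H_def)
    fix z assume z: "z \<in> L"
    have "(LINT v|cell_measure. H v * chr z v) =
      (LINT v|cell_measure. complex_of_real (theta_sum t v) * chr z v -
         of_real (?c / cell_volume) * (dual_theta t v * chr z v))"
      by (simp add: H_def algebra_simps)
    also have "\<dots> = (LINT v|cell_measure. complex_of_real (theta_sum t v) * chr z v) -
         (LINT v|cell_measure. of_real (?c / cell_volume) * (dual_theta t v * chr z v))"
      by (intro Bochner_Integration.integral_diff integrable_cell continuous_intros theta_sum_continuous
          dual_theta_continuous assms continuous_chr)
    also have "\<dots> = 0"
      using V by (simp add: theta_sum_fourier[OF assms z] dual_theta_fourier[OF assms z])
    finally show "(LINT v|cell_measure. H v * chr z v) = 0" .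
  qed
  then show "of_real (theta_sum t v) = of_real (1 / (cell_volume * sqrt t ^ CARD('n))) * dual_theta t v"
    by (simp add: H_def mult.commute)
qed

text \<open>At \<open>t = 1\<close>, \<open>v = 0\<close> the theta sum and its dual are the same positive number; this shows that
  the fundamental domain has volume \<open>1\<close>, with no determinant to be computed.\<close>

lemma poisson_cell:
  assumes "t > 0"
  shows "of_real (theta_sum t v) = of_real (1 / sqrt t ^ CARD('n)) * dual_theta t v"
proof -
  have sum: "(\<lambda>x :: real ^ 'n. exp (- pi * (x \<bullet> x))) summable_on L"
    using gaussian_summable[of pi] by simp
  define S where "S = theta_sum 1 0"
  have "S = (\<Sum>\<^sub>\<infinity>x\<in>L. exp (- pi * (x \<bullet> x)))"
    by (simp add: S_def theta_sum_def)
  moreover have "(\<Sum>x\<in>{0 :: real ^ 'n}. exp (- pi * (x \<bullet> x))) \<le> (\<Sum>\<^sub>\<infinity>x\<in>L. exp (- pi * (x \<bullet> x)))"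
    by (rule finite_sum_le_infsum) (use sum zero_L in auto)
  ultimately have "S > 0" by simp
  have "dual_theta 1 0 = of_real S"
    unfolding dual_theta_def S_def theta_sum_def
    using infsumI[OF has_sum_of_real[where 'a = complex, OF has_sum_infsum[OF sum]]]
    by (simp add: chr_def)
  then have "complex_of_real S = of_real (1 / cell_volume * S)"
    using theta_sum_eq_dual_theta_volume(2)[of 1 0, folded S_def]
    by (simp only: real_sqrt_one power_one mult_1_right of_real_mult)
  then have "S = 1 / cell_volume * S"
    by (simp only: of_real_eq_iff)
  then have "cell_volume = 1"
    using \<open>S > 0\<close> theta_sum_eq_dual_theta_volume(1)[of 1] by (simp add: field_simps)
  then show ?thesis
    using theta_sum_eq_dual_theta_volume(2)[OF assms, of v] by simp
qed

end

lemma unimodular_lattice_cell: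
  assumes "unimodular_lattice L"
  obtains B D where "unimodular_cell L B D"
proof -
  have "lattice_in_space L" and "L = dual_lattice L"
    using assms by (simp_all add: unimodular_lattice_def integral_lattice_def)
  from this(1) obtain B D where "lattice_cell L B D"
    by (rule lattice_fundamental_domain) (rule that, unfold_locales, blast+)
  then have "unimodular_cell L B D"
    using \<open>L = dual_lattice L\<close> by (intro unimodular_cell.intro unimodular_cell_axioms.intro)
  then show ?thesis by (rule that)
qed

theorem poisson_unimodular_lattice:
  fixes L :: "(real ^ 'n::finite) set"
  assumes "unimodular_lattice L" "t > 0"
  shows "of_real (\<Sum>\<^sub>\<infinity>x\<in>L. exp (- pi * t * ((v + x) \<bullet> (v + x)))) =
    of_real (1 / sqrt t ^ CARD('n)) * (\<Sum>\<^sub>\<infinity>y\<in>L. of_real (exp (- pi * (y \<bullet> y) / t)) * cis (2 * pi * (y \<bullet> v)))"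
proof -
  obtain B D where "unimodular_cell L B D"
    using assms(1) by (rule unimodular_lattice_cell)
  then interpret unimodular_cell L B D .
  show ?thesis
    using poisson_cell[OF assms(2), of v] by (simp add: theta_sum_def dual_theta_def chr_def)
qed

lemma unimodular_gaussian_summable:
  assumes "unimodular_lattice L" "s > 0"
  shows "(\<lambda>x. exp (- s * (x \<bullet> x))) summable_on L"
proof -
  obtain B D where "unimodular_cell L B D"
    using assms(1) by (rule unimodular_lattice_cell)
  then interpret unimodular_cell L B D .
  show ?thesis using assms(2) by (rule gaussian_summable)
qed

lemma unimodular_lattice_zero:
  assumes "unimodular_lattice L"
  shows "0 \<in> L"
  using assms by (rule unimodular_lattice_cell)
    (simp add: unimodular_cell_def lattice_cell_def)

lemma unimodular_lattice_minus:
  assumes "unimodular_lattice L" "x \<in> L"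
  shows "- x \<in> L"
  using assms(1) by (rule unimodular_lattice_cell)
    (use assms(2) in \<open>simp add: unimodular_cell_def lattice_cell_def\<close>)

section \<open>Exponential series on the upper half plane\<close>

definition upper_half_plane :: "complex set" where
  "upper_half_plane = {z. Im z > 0}"

lemma in_upper_half_plane [simp]: "z \<in> upper_half_plane \<longleftrightarrow> Im z > 0"
  by (simp add: upper_half_plane_def)

lemma open_upper_half_plane: "open upper_half_plane"
  unfolding upper_half_plane_def by (rule open_halfspace_Im_gt)

lemma convex_upper_half_plane: "convex upper_half_plane"
  unfolding upper_half_plane_def by (rule convex_halfspace_Im_gt)

lemma Im_neg_inverse_pos: "Im z > 0 \<Longrightarrow> Im (- (1 / z)) > 0"
  by (cases "z = 0") (auto simp: Im_divide power2_eq_square sum_power2_gt_zero_iff divide_pos_pos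
      intro!: divide_pos_pos simp flip: power2_eq_square)

text \<open>Transformation laws of holomorphic functions need to be checked on the imaginary axis only,
  where Poisson summation provides them.\<close>

lemma upper_half_plane_identity:
  assumes "f holomorphic_on upper_half_plane" "\<And>t. t > 0 \<Longrightarrow> f (\<i> * of_real t) = 0" "Im z > 0"
  shows "f z = 0"
proof (rule analytic_continuation[OF assms(1) open_upper_half_plane])
  show "connected upper_half_plane"
    using convex_upper_half_plane by (rule convex_connected)
  show "{\<i> * of_real t | t. t > 0} \<subseteq> upper_half_plane" by auto
  show "\<i> islimpt {\<i> * of_real t | t. t > 0}"
    unfolding islimpt_approachable
  proof (intro allI impI)
    fix e :: real assume "e > 0"
    then have "\<i> * of_real (1 + e / 2) \<noteq> \<i> \<and> dist (\<i> * of_real (1 + e / 2)) \<i> < e"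
      by (auto simp: dist_norm algebra_simps norm_mult complex_eq_iff norm_divide)
    moreover have "1 + e / 2 > 0" using \<open>e > 0\<close> by simp
    ultimately show "\<exists>x'\<in>{\<i> * of_real t | t. t > 0}. x' \<noteq> \<i> \<and> dist x' \<i> < e"
      by blast
  qed
qed (use assms in auto)

text \<open>Fourier series with arbitrary real exponents; the Jacobi theta constants and the theta
  series of lattices are of this form.\<close>

definition exp_series :: "'a set \<Rightarrow> ('a \<Rightarrow> complex) \<Rightarrow> ('a \<Rightarrow> real) \<Rightarrow> complex \<Rightarrow> complex" where
  "exp_series A c N z = (\<Sum>\<^sub>\<infinity>x\<in>A. c x * exp (\<i> * of_real (pi * N x) * z))"

definition exp_series_summable :: "'a set \<Rightarrow> ('a \<Rightarrow> complex) \<Rightarrow> ('a \<Rightarrow> real) \<Rightarrow> bool" where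
  "exp_series_summable A c N \<longleftrightarrow> (\<forall>x\<in>A. 0 \<le> N x) \<and>
     (\<forall>t>0. (\<lambda>x. norm (c x) * exp (- pi * t * N x)) summable_on A)"

lemma norm_exp_series_term: "norm (c * exp (\<i> * of_real (pi * N) * z)) = norm c * exp (- pi * Im z * N)"
  by (simp add: norm_mult mult_ac)

lemma exp_series_subset: "exp_series_summable A c N \<Longrightarrow> B \<subseteq> A \<Longrightarrow> exp_series_summable B c N"
  unfolding exp_series_summable_def using summable_on_subset_banach by blast

lemma exp_series_abs_summable:
  assumes "exp_series_summable A c N" "Im z > 0"
  shows "(\<lambda>x. norm (c x * exp (\<i> * of_real (pi * N x) * z))) summable_on A"
  using assms by (simp only: norm_exp_series_term exp_series_summable_def)

lemma exp_series_has_sum: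
  assumes "exp_series_summable A c N" "Im z > 0"
  shows "((\<lambda>x. c x * exp (\<i> * of_real (pi * N x) * z)) has_sum exp_series A c N z) A"
  unfolding exp_series_def
  by (rule has_sum_infsum, rule abs_summable_summable, rule exp_series_abs_summable[OF assms])

lemma exp_series_holomorphic:
  assumes "exp_series_summable A c N"
  shows "exp_series A c N holomorphic_on upper_half_plane"
proof -
  have "\<exists>r>0. exp_series A c N holomorphic_on ball z r" if z: "Im z > 0" for z
  proof -
    define r where "r = Im z / 2"
    have r: "r > 0" using z by (simp add: r_def)
    let ?f = "\<lambda>X z. \<Sum>x\<in>X. c x * exp (\<i> * of_real (pi * N x) * z)"
    have "uniform_limit (cball z r) ?f (\<lambda>z. \<Sum>\<^sub>\<infinity>x\<in>A. c x * exp (\<i> * of_real (pi * N x) * z)) (finite_subsets_at_top A)"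
    proof (rule Weierstrass_m_test_general)
      show "(\<lambda>x. norm (c x) * exp (- pi * r * N x)) summable_on A"
        using assms r by (auto simp: exp_series_summable_def)
      fix x w assume x: "x \<in> A" and "w \<in> cball z r"
      then have "\<bar>Im (z - w)\<bar> \<le> r"
        using abs_Im_le_cmod[of "z - w"] by (simp add: dist_norm)
      then have "r \<le> Im w" unfolding r_def minus_complex.simps by linarith
      moreover have "0 \<le> N x" using assms x by (auto simp: exp_series_summable_def)
      ultimately have "exp (- pi * Im w * N x) \<le> exp (- pi * r * N x)"
        by (auto intro!: mult_right_mono)
      then show "norm (c x * exp (\<i> * of_real (pi * N x) * w)) \<le> norm (c x) * exp (- pi * r * N x)"
        unfolding norm_exp_series_term by (rule mult_left_mono) simp
    qed
    moreover have "\<forall>\<^sub>F X in finite_subsets_at_top A. continuous_on (cball z r) (?f X) \<and> ?f X holomorphic_on ball z r"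
      by (rule always_eventually) (auto intro!: continuous_intros holomorphic_intros)
    ultimately obtain "(\<lambda>z. \<Sum>\<^sub>\<infinity>x\<in>A. c x * exp (\<i> * of_real (pi * N x) * z)) holomorphic_on ball z r"
      using holomorphic_uniform_limit[of z r ?f "finite_subsets_at_top A"] by auto
    then show ?thesis using r by (auto simp: exp_series_def[abs_def])
  qed
  then have "exp_series A c N analytic_on upper_half_plane"
    by (auto simp: analytic_on_def)
  then show ?thesis by (rule analytic_imp_holomorphic)
qed

text \<open>Convergence at the cusp: the imaginary part tends to infinity, uniformly in the real part.\<close>

definition at_cusp :: "complex filter" where
  "at_cusp = filtercomap Im at_top"

lemma eventually_at_cusp: "eventually P at_cusp \<longleftrightarrow> (\<exists>Y. \<forall>z. Im z \<ge> Y \<longrightarrow> P z)"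
  unfolding at_cusp_def eventually_filtercomap_at_top_linorder by blast

lemma eventually_at_cusp_Im_gt: "eventually (\<lambda>z. Im z > Y) at_cusp"
  unfolding eventually_at_cusp by (intro exI[of _ "Y + 1"]) auto

text \<open>Above height \<open>1\<close> every term is dominated by its value at height \<open>1\<close> times an exponential
  factor, the same for all terms.\<close>

lemma exp_series_tail:
  fixes K \<delta> :: real
  assumes "exp_series_summable A c N" "\<delta> > 0" "\<And>x. x \<in> A \<Longrightarrow> N x \<ge> K + \<delta>"
  shows "((\<lambda>z. exp_series A c N z * exp (- \<i> * of_real (pi * K) * z)) \<longlongrightarrow> 0) at_cusp"
proof -
  define S where "S = (\<Sum>\<^sub>\<infinity>x\<in>A. norm (c x) * exp (- pi * 1 * N x))"
  have sum1: "(\<lambda>x. norm (c x) * exp (- pi * 1 * N x)) summable_on A"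
    using assms(1) zero_less_one unfolding exp_series_summable_def by blast
  have bound: "norm (exp_series A c N z * exp (- \<i> * of_real (pi * K) * z)) \<le>
      S * exp (pi * K) * exp (- pi * \<delta> * (Im z - 1))" if z: "Im z \<ge> 1" for z
  proof -
    have "norm (exp_series A c N z) \<le> S * exp (- pi * (K + \<delta>) * (Im z - 1))"
    proof (rule norm_infsum_le)
      show "((\<lambda>x. c x * exp (\<i> * of_real (pi * N x) * z)) has_sum exp_series A c N z) A"
        by (rule exp_series_has_sum[OF assms(1)]) (use z in auto)
      show "((\<lambda>x. norm (c x) * exp (- pi * 1 * N x) * exp (- pi * (K + \<delta>) * (Im z - 1))) has_sum
          S * exp (- pi * (K + \<delta>) * (Im z - 1))) A"
        unfolding S_def by (intro has_sum_cmult_left has_sum_infsum sum1)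
      fix x assume x: "x \<in> A"
      have "(K + \<delta>) * (Im z - 1) \<le> N x * (Im z - 1)"
        using assms(3)[OF x] z by (intro mult_right_mono) auto
      then have "pi * ((K + \<delta>) * (Im z - 1)) \<le> pi * (N x * (Im z - 1))"
        by (intro mult_left_mono) auto
      then have "- pi * Im z * N x \<le> - pi * 1 * N x + - pi * (K + \<delta>) * (Im z - 1)"
        by (simp add: algebra_simps)
      then have "exp (- pi * Im z * N x) \<le> exp (- pi * 1 * N x) * exp (- pi * (K + \<delta>) * (Im z - 1))"
        unfolding exp_add[symmetric] by (simp only: exp_le_cancel_iff)
      then show "norm (c x * exp (\<i> * of_real (pi * N x) * z)) \<le>
          norm (c x) * exp (- pi * 1 * N x) * exp (- pi * (K + \<delta>) * (Im z - 1))"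
        unfolding norm_exp_series_term mult.assoc[of "norm (c x)"] by (intro mult_left_mono) auto
    qed
    then have "norm (exp_series A c N z) * exp (pi * K * Im z) \<le>
        S * exp (- pi * (K + \<delta>) * (Im z - 1)) * exp (pi * K * Im z)"
      by (intro mult_right_mono) auto
    also have "\<dots> = S * exp (pi * K) * exp (- pi * \<delta> * (Im z - 1))"
      unfolding mult.assoc exp_add[symmetric] by (simp add: algebra_simps)
    finally show ?thesis by (simp add: norm_mult)
  qed
  have "((\<lambda>y::real. S * exp (pi * K) * exp (- pi * \<delta> * (y - 1))) \<longlongrightarrow> 0) at_top"
    using assms(2) by real_asymp
  then have "((\<lambda>z. S * exp (pi * K) * exp (- pi * \<delta> * (Im z - 1))) \<longlongrightarrow> 0) at_cusp"
    unfolding at_cusp_def by (rule filterlim_compose) (rule filterlim_filtercomap)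
  then show ?thesis
    by (rule Lim_null_comparison[rotated])
       (use bound eventually_at_cusp_Im_gt[of 1] in \<open>auto elim!: eventually_mono\<close>)
qed

lemma exp_series_expansion:
  fixes K \<delta> :: real
  assumes "exp_series_summable A c N" "\<delta> > 0" "finite {x \<in> A. N x \<le> K}"
    "\<And>x. x \<in> A \<Longrightarrow> N x > K \<Longrightarrow> N x \<ge> K + \<delta>"
  shows "((\<lambda>z. (exp_series A c N z - (\<Sum>x | x \<in> A \<and> N x \<le> K. c x * exp (\<i> * of_real (pi * N x) * z)))
           * exp (- \<i> * of_real (pi * K) * z)) \<longlongrightarrow> 0) at_cusp"
proof -
  have tail: "exp_series_summable {x \<in> A. N x > K} c N"
    by (rule exp_series_subset[OF assms(1)]) auto
  have "exp_series A c N z - (\<Sum>x | x \<in> A \<and> N x \<le> K. c x * exp (\<i> * of_real (pi * N x) * z)) =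
      exp_series {x \<in> A. N x > K} c N z" if "Im z > 0" for z
  proof -
    have "(\<lambda>x. c x * exp (\<i> * of_real (pi * N x) * z)) summable_on {x \<in> A. N x \<le> K}"
      by (rule summable_on_finite) (use assms(3) in auto)
    moreover have "(\<lambda>x. c x * exp (\<i> * of_real (pi * N x) * z)) summable_on {x \<in> A. N x > K}"
      using exp_series_has_sum[OF tail that] by (rule has_sum_imp_summable)
    ultimately have "exp_series ({x \<in> A. N x \<le> K} \<union> {x \<in> A. N x > K}) c N z =
        exp_series {x \<in> A. N x \<le> K} c N z + exp_series {x \<in> A. N x > K} c N z"
      unfolding exp_series_def by (rule infsum_Un_disjoint) auto
    moreover have "{x \<in> A. N x \<le> K} \<union> {x \<in> A. N x > K} = A" by auto
    moreover have "exp_series {x \<in> A. N x \<le> K} c N z = (\<Sum>x | x \<in> A \<and> N x \<le> K. c x * exp (\<i> * of_real (pi * N x) * z))"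
      unfolding exp_series_def using assms(3) by simp
    ultimately show ?thesis by simp
  qed
  then have "\<forall>\<^sub>F z in at_cusp. exp_series {x \<in> A. N x > K} c N z * exp (- \<i> * of_real (pi * K) * z) =
     (exp_series A c N z - (\<Sum>x | x \<in> A \<and> N x \<le> K. c x * exp (\<i> * of_real (pi * N x) * z)))
           * exp (- \<i> * of_real (pi * K) * z)"
    using eventually_at_cusp_Im_gt[of 0] by (auto elim!: eventually_mono)
  then show ?thesis
    by (rule Lim_transform_eventually[rotated])
       (rule exp_series_tail[OF tail assms(2)], use assms(4) in auto)
qed

text \<open>A primitive \<open>g\<close> of \<open>h\<close> satisfies \<open>g(z+1) - g(z) = I\<close> and \<open>g(-1/z) = g(z)\<close>: the first
  difference is constant because \<open>h\<close> has period \<open>1\<close>, the second one because \<open>h(z) dz\<close> is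
  invariant, and it is \<open>0\<close> at \<open>z = \<i>\<close>. At a point with \<open>z + 1 = -1/z\<close> this shows \<open>I = 0\<close>. But \<open>I\<close>
  is the constant term of \<open>h\<close>.\<close>

lemma weight_two_constant_term:
  fixes h :: "complex \<Rightarrow> complex" and a c :: complex
  assumes hol: "h holomorphic_on upper_half_plane"
    and T: "\<And>z. Im z > 0 \<Longrightarrow> h (z + 1) = h z"
    and S: "\<And>z. Im z > 0 \<Longrightarrow> h (- (1 / z)) = z ^ 2 * h z"
    and lim: "((\<lambda>z. h z - a * exp (- 2 * pi * \<i> * z) - c) \<longlongrightarrow> 0) at_cusp"
  shows "c = 0"
proof -
  obtain g where "\<And>z. z \<in> upper_half_plane \<Longrightarrow> (g has_field_derivative h z) (at z within upper_half_plane)"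
    using holomorphic_convex_primitive'[OF convex_upper_half_plane open_upper_half_plane hol] by blast
  then have g: "(g has_field_derivative h z) (at z)" if "Im z > 0" for z
    using that at_within_open[OF _ open_upper_half_plane] by (metis in_upper_half_plane)
  have const: "f z = f w" if "\<And>z. Im z > 0 \<Longrightarrow> (f has_field_derivative 0) (at z)" "Im z > 0" "Im w > 0"
    for f :: "complex \<Rightarrow> complex" and z w
  proof -
    have "\<exists>k. \<forall>z\<in>upper_half_plane. f z = k"
      by (rule has_field_derivative_zero_constant[OF convex_upper_half_plane])
         (use that(1) in \<open>auto intro: has_field_derivative_at_within\<close>)
    then show ?thesis using that(2,3) by auto
  qed
  define I where "I = g (\<i> + 1) - g \<i>"
  have gT: "g (z + 1) - g z = I" if "Im z > 0" for z
    unfolding I_def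
  proof (rule const[of "\<lambda>z. g (z + 1) - g z"])
    fix z :: complex assume z: "Im z > 0"
    have gz: "(g has_field_derivative h (z + 1)) (at (z + 1))"
      by (rule g) (use z in simp)
    have "((\<lambda>z. z + 1) has_field_derivative 1) (at z)"
      by (auto intro!: derivative_eq_intros)
    from DERIV_diff[OF DERIV_chain2[OF gz this] g[OF z]]
    show "((\<lambda>z. g (z + 1) - g z) has_field_derivative 0) (at z)"
      using T[OF z] by simp
  qed (use that in auto)
  have gS: "g (- (1 / z)) - g z = 0" if "Im z > 0" for z
  proof -
    have "g (- (1 / z)) - g z = g (- (1 / \<i>)) - g \<i>"
    proof (rule const[of "\<lambda>z. g (- (1 / z)) - g z"])
      fix z :: complex assume z: "Im z > 0"
      then have z0: "z \<noteq> 0" by auto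
      have "((\<lambda>z. - (1 / z)) has_field_derivative 1 / z ^ 2) (at z)"
        using z0 by (auto intro!: derivative_eq_intros simp: power2_eq_square)
      then have "((\<lambda>z. g (- (1 / z))) has_field_derivative h (- (1 / z)) * (1 / z ^ 2)) (at z)"
        by (rule DERIV_chain2[of g "h (- (1 / z))" "\<lambda>z. - (1 / z)", OF g[OF Im_neg_inverse_pos[OF z]]])
      moreover have "h (- (1 / z)) * (1 / z ^ 2) = h z" using S[OF z] z0 by simp
      ultimately show "((\<lambda>z. g (- (1 / z)) - g z) has_field_derivative 0) (at z)"
        using DERIV_diff[of "\<lambda>z. g (- (1 / z))" "h z" z UNIV g "h z"] g[OF z] by simp
    qed (use that in auto)
    also have "\<dots> = 0" by (simp add: divide_i)
    finally show ?thesis .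
  qed
  \<comment> \<open>The cube root of unity, where \<open>\<rho> + 1 = - 1 / \<rho>\<close>.\<close>
  define \<rho> where "\<rho> = Complex (- 1 / 2) (sqrt 3 / 2)"
  have "\<rho> + 1 = - (1 / \<rho>)"
    by (simp add: \<rho>_def complex_eq_iff Re_divide Im_divide power2_eq_square)
  moreover have \<rho>: "Im \<rho> > 0" by (simp add: \<rho>_def)
  ultimately have I0: "I = 0"
    using gT[OF \<rho>] gS[OF \<rho>] by simp
  \<comment> \<open>A primitive of what is left of \<open>h\<close> without its principal part and constant term; over a unit
    step it changes by \<open>- c\<close>, although its derivative is small near the cusp.\<close>
  define \<Psi> where "\<Psi> = (\<lambda>z. g z - a * exp (- 2 * pi * \<i> * z) / (- 2 * pi * \<i>) - c * z)"
  have \<Psi>: "(\<Psi> has_field_derivative (h z - a * exp (- 2 * pi * \<i> * z) - c)) (at z)" if "Im z > 0" for z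
    unfolding \<Psi>_def using that by (auto intro!: derivative_eq_intros g simp: mult_ac)
  have \<Psi>T: "\<Psi> (z + 1) - \<Psi> z = - c" if "Im z > 0" for z
  proof -
    have "exp (- 2 * pi * \<i> * (z + 1)) = exp (- 2 * pi * \<i> * z) * exp (- 2 * pi * \<i>)"
      by (simp add: distrib_left exp_add[symmetric])
    also have "exp (- 2 * pi * \<i>) = 1"
      by (simp add: exp_minus)
    finally show ?thesis
      using gT[OF that] I0 by (simp add: \<Psi>_def algebra_simps)
  qed
  have "norm c \<le> \<epsilon>" if "\<epsilon> > 0" for \<epsilon>
  proof -
    have "\<forall>\<^sub>F z in at_cusp. norm (h z - a * exp (- 2 * pi * \<i> * z) - c) < \<epsilon>"
      using tendstoD[OF lim that] by simp
    then obtain Y where Y: "\<And>z. Im z \<ge> Y \<Longrightarrow> norm (h z - a * exp (- 2 * pi * \<i> * z) - c) < \<epsilon>"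
      unfolding eventually_at_cusp by blast
    define Y' where "Y' = max Y 1"
    have "norm (\<Psi> (Complex 0 Y' + 1) - \<Psi> (Complex 0 Y')) \<le> \<epsilon> * norm ((Complex 0 Y' + 1) - Complex 0 Y')"
    proof (rule field_differentiable_bound[of "{z. Im z \<ge> Y'}"])
      show "convex {z. Im z \<ge> Y'}" by (rule convex_halfspace_Im_ge)
      fix z assume "z \<in> {z. Im z \<ge> Y'}"
      then have "Im z > 0" "Im z \<ge> Y" by (auto simp: Y'_def)
      then show "(\<Psi> has_field_derivative (h z - a * exp (- 2 * pi * \<i> * z) - c)) (at z within {z. Im z \<ge> Y'})"
        "norm (h z - a * exp (- 2 * pi * \<i> * z) - c) \<le> \<epsilon>"
        using \<Psi> Y by (auto intro: has_field_derivative_at_within less_imp_le)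
    qed auto
    then show ?thesis
      using \<Psi>T[of "Complex 0 Y'"] by (simp add: Y'_def)
  qed
  then have "norm c \<le> 0 + \<epsilon>" if "\<epsilon> > 0" for \<epsilon>
    unfolding add_0 using that by blast
  then have "norm c \<le> 0" by (rule field_le_epsilon)
  then show ?thesis by simp
qed

section \<open>Jacobi theta constants\<close>

text \<open>The lattice of integers as a subset of \<open>real ^ 1\<close>, so that Poisson summation also yields the
  transformation of the Jacobi theta constants.\<close>

definition integer_line :: "(real ^ 1) set" where
  "integer_line = range (\<lambda>n::int. vec (of_int n))"

lemma unimodular_integer_line: "unimodular_lattice integer_line"
proof -
  have span: "span {1 :: real ^ 1} = UNIV"
  proof -
    have "v \<in> span {1}" for v :: "real ^ 1"
    proof -
      have "v = (v $ 1) *\<^sub>R 1" by (simp add: vec_eq_iff)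
      then show ?thesis by (metis span_base span_mul singletonI)
    qed
    then show ?thesis by auto
  qed
  have inner: "vec (of_int m) \<bullet> (vec (of_int n) :: real ^ 1) = of_int (m * n)" for m n
    by (simp add: inner_vec_def)
  have "lattice_in_space integer_line"
    unfolding lattice_in_space_def
  proof (intro exI conjI)
    show "independent {1 :: real ^ 1}"
      by (simp add: dependent_single vec_eq_iff)
    show "integer_line = {\<Sum>b\<in>{1}. of_int (c b) *\<^sub>R b |c :: real ^ 1 \<Rightarrow> int. True}" (is "_ = ?R")
    proof (intro equalityI subsetI)
      fix x assume "x \<in> integer_line"
      then obtain n :: int where "x = vec (of_int n)" by (auto simp: integer_line_def)
      then have "x = (\<Sum>b\<in>{1}. of_int ((\<lambda>_. n) b) *\<^sub>R b)" by (simp add: vec_eq_iff)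
      then show "x \<in> ?R" by (intro CollectI exI[of _ "\<lambda>_. n"] conjI TrueI)
    next
      fix x assume "x \<in> ?R"
      then obtain c :: "real ^ 1 \<Rightarrow> int" where "x = of_int (c 1) *\<^sub>R 1" by auto
      then have "x = vec (of_int (c 1))" by (simp add: vec_eq_iff)
      then show "x \<in> integer_line" by (auto simp: integer_line_def)
    qed
  qed (rule span)
  then have int: "integral_lattice integer_line"
    by (auto simp: integral_lattice_def integer_line_def inner)
  have "dual_lattice integer_line \<subseteq> integer_line"
  proof
    fix y assume "y \<in> dual_lattice integer_line"
    then have "y \<bullet> vec (of_int 1) \<in> \<int>"
      unfolding dual_lattice_def integer_line_def by blast
    then have "y $ 1 \<in> \<int>" by (simp add: inner_vec_def)
    then obtain n :: int where "y $ 1 = of_int n" by (auto elim: Ints_cases)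
    then have "y = vec (of_int n)" by (simp add: vec_eq_iff)
    then show "y \<in> integer_line" by (simp add: integer_line_def)
  qed
  with int show ?thesis
    by (auto simp: unimodular_lattice_def integral_lattice_def dual_lattice_def)
qed

lemma infsum_integer_line: "infsum f integer_line = (\<Sum>\<^sub>\<infinity>n. f (vec (of_int n)))"
  unfolding integer_line_def
  by (subst infsum_reindex) (auto simp: inj_def vec_eq_iff o_def)

lemma gaussian_summable_int:
  fixes s :: real
  assumes "s > 0"
  shows "(\<lambda>n::int. exp (- s * (of_int n)\<^sup>2)) summable_on UNIV"
proof -
  have "(\<lambda>x. exp (- s * (x \<bullet> x))) summable_on integer_line"
    by (rule unimodular_gaussian_summable[OF unimodular_integer_line assms])
  then have "((\<lambda>x. exp (- s * (x \<bullet> x))) \<circ> (\<lambda>n::int. vec (of_int n) :: real ^ 1)) summable_on UNIV"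
    unfolding integer_line_def by (subst (asm) summable_on_reindex) (auto simp: inj_def vec_eq_iff)
  then show ?thesis by (simp add: o_def inner_vec_def power2_eq_square)
qed

lemma poisson_int:
  fixes u t :: real
  assumes "t > 0"
  shows "of_real (\<Sum>\<^sub>\<infinity>n::int. exp (- pi * t * (u + of_int n)\<^sup>2)) =
    of_real (1 / sqrt t) * (\<Sum>\<^sub>\<infinity>n::int. of_real (exp (- pi * (of_int n)\<^sup>2 / t)) * cis (2 * pi * (of_int n * u)))"
  using poisson_unimodular_lattice[OF unimodular_integer_line assms, of "vec u"]
  by (simp add: infsum_integer_line inner_vec_def power2_eq_square)

definition theta2 :: "complex \<Rightarrow> complex" where
  "theta2 = exp_series UNIV (\<lambda>_. 1) (\<lambda>n::int. (1 / 2 + of_int n)\<^sup>2)"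

definition theta3 :: "complex \<Rightarrow> complex" where
  "theta3 = exp_series UNIV (\<lambda>_. 1) (\<lambda>n::int. (of_int n)\<^sup>2)"

text \<open>The signs \<open>(-1)^n\<close> are written as values of a character, the form in which Poisson summation
  produces them from a shift by \<open>1/2\<close>.\<close>

definition theta4 :: "complex \<Rightarrow> complex" where
  "theta4 = exp_series UNIV (\<lambda>n. cis (pi * of_int n)) (\<lambda>n::int. (of_int n)\<^sup>2)"

lemma theta_summable:
  "exp_series_summable UNIV (\<lambda>_. 1) (\<lambda>n::int. (1 / 2 + of_int n)\<^sup>2)"
  "exp_series_summable UNIV (\<lambda>_. 1) (\<lambda>n::int. (of_int n)\<^sup>2)"
  "exp_series_summable UNIV (\<lambda>n. cis (pi * of_int n)) (\<lambda>n::int. (of_int n)\<^sup>2)"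
proof -
  have s: "(\<lambda>n::int. exp (- pi * t * (of_int n)\<^sup>2)) summable_on UNIV" if "t > 0" for t
    using gaussian_summable_int[of "pi * t"] that by simp
  then show "exp_series_summable UNIV (\<lambda>_. 1) (\<lambda>n::int. (of_int n)\<^sup>2)"
    "exp_series_summable UNIV (\<lambda>n. cis (pi * of_int n)) (\<lambda>n::int. (of_int n)\<^sup>2)"
    by (auto simp: exp_series_summable_def)
  have "(\<lambda>n::int. exp (- pi * t * (1 / 2 + of_int n)\<^sup>2)) summable_on UNIV" if t: "t > 0" for t
  proof (rule summable_on_comparison_test)
    show "(\<lambda>n::int. exp (pi * t) * exp (- pi * (t / 2) * (of_int n)\<^sup>2)) summable_on UNIV"
      using s[of "t / 2"] t by (intro summable_on_cmult_right) auto
    fix n :: int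
    have "(of_int n)\<^sup>2 / 2 \<le> 1 + (1 / 2 + real_of_int n)\<^sup>2"
      using zero_le_power2[of "real_of_int n + 1"] by (simp add: power2_eq_square algebra_simps)
    then have "pi * t * ((of_int n)\<^sup>2 / 2) \<le> pi * t * (1 + (1 / 2 + real_of_int n)\<^sup>2)"
      using t by (intro mult_left_mono) auto
    then show "exp (- pi * t * (1 / 2 + of_int n)\<^sup>2) \<le> exp (pi * t) * exp (- pi * (t / 2) * (of_int n)\<^sup>2)"
      unfolding exp_add[symmetric] by (simp add: algebra_simps)
  qed auto
  then show "exp_series_summable UNIV (\<lambda>_. 1) (\<lambda>n::int. (1 / 2 + of_int n)\<^sup>2)"
    by (auto simp: exp_series_summable_def)
qed

lemma theta_holomorphic:
  "theta2 holomorphic_on upper_half_plane"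
  "theta3 holomorphic_on upper_half_plane"
  "theta4 holomorphic_on upper_half_plane"
  unfolding theta2_def theta3_def theta4_def by (intro exp_series_holomorphic theta_summable)+

lemma cis_pi_int: "cis (pi * of_int n) = (if even n then 1 else - 1)"
proof (cases "even n")
  case True
  then obtain m where "n = 2 * m" by (elim evenE)
  then have "pi * of_int n = 2 * pi * of_int m" by simp
  then show ?thesis using True by (simp only: cis_multiple_2pi Ints_of_int if_True)
next
  case False
  then obtain m where m: "n = 2 * m + 1" by (elim oddE)
  then have "pi * of_int n = 2 * pi * of_int m + pi"
    by (simp add: algebra_simps)
  then have "cis (pi * of_int n) = cis (2 * pi * of_int m) * cis pi"
    by (simp only: cis_mult)
  then show ?thesis using False by (simp add: cis_multiple_2pi)
qed

lemma exp_pi_int: "exp (\<i> * of_real (pi * of_int n)) = (if even n then 1 else - 1)"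
  using cis_pi_int[of n] by (simp add: cis_conv_exp)

lemma theta_T:
  "theta2 (z + 1) = exp (\<i> * pi / 4) * theta2 z"
  "theta3 (z + 1) = theta4 z"
  "theta4 (z + 1) = theta3 z"
proof -
  have shift: "exp (\<i> * of_real (pi * N) * (z + 1)) = exp (\<i> * of_real (pi * N) * z) * exp (\<i> * of_real (pi * N))"
    for N by (simp add: distrib_left exp_add)
  have sq: "exp (\<i> * of_real (pi * (of_int n)\<^sup>2)) = cis (pi * of_int n)" for n
    using exp_pi_int[of "n\<^sup>2"] by (simp add: cis_pi_int)
  show "theta3 (z + 1) = theta4 z"
    unfolding theta3_def theta4_def exp_series_def
    by (rule infsum_cong) (simp only: shift sq mult_1_left, rule mult.commute)
  show "theta4 (z + 1) = theta3 z"
    unfolding theta3_def theta4_def exp_series_def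
    by (rule infsum_cong) (simp only: shift sq, simp add: cis_pi_int)
  have "exp (\<i> * of_real (pi * (1 / 2 + of_int n)\<^sup>2)) = exp (\<i> * pi / 4)" for n :: int
  proof -
    have "(1 / 2 + of_int n)\<^sup>2 = (of_int (n * (n + 1)) + 1 / 4 :: real)"
      by (simp add: power2_eq_square algebra_simps)
    then have "exp (\<i> * of_real (pi * (1 / 2 + of_int n)\<^sup>2)) =
        exp (\<i> * of_real (pi * of_int (n * (n + 1))) + \<i> * pi / 4)"
      by (simp add: algebra_simps)
    also have "\<dots> = exp (\<i> * of_real (pi * of_int (n * (n + 1)))) * exp (\<i> * pi / 4)"
      by (rule exp_add)
    also have "exp (\<i> * of_real (pi * of_int (n * (n + 1)))) = 1"
      by (subst exp_pi_int) simp
    finally show ?thesis by simp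
  qed
  then have "theta2 (z + 1) = (\<Sum>\<^sub>\<infinity>n::int. exp (\<i> * pi / 4) * (1 * exp (\<i> * of_real (pi * (1 / 2 + of_int n)\<^sup>2) * z)))"
    unfolding theta2_def exp_series_def
    by (intro infsum_cong) (simp only: shift mult_1_left, rule mult.commute)
  also have "\<dots> = exp (\<i> * pi / 4) * theta2 z"
    unfolding theta2_def exp_series_def by (rule infsum_cmult_right')
  finally show "theta2 (z + 1) = exp (\<i> * pi / 4) * theta2 z" .
qed

lemma exp_imaginary_axis: "exp (\<i> * of_real (pi * N) * (\<i> * of_real t)) = of_real (exp (- pi * t * N))"
  by (simp add: mult_ac exp_of_real flip: of_real_mult of_real_minus)

text \<open>Poisson summation for the integers with the shifts \<open>0\<close> and \<open>1/2\<close>.\<close>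

lemma theta_imaginary_axis:
  assumes "t > 0"
  shows "theta3 (\<i> * of_real (1 / t)) = sqrt t * theta3 (\<i> * of_real t)"
    and "theta4 (\<i> * of_real (1 / t)) = sqrt t * theta2 (\<i> * of_real t)"
proof -
  have real: "(\<Sum>\<^sub>\<infinity>n::int. complex_of_real (exp (- pi * t * (u + of_int n)\<^sup>2))) =
      of_real (\<Sum>\<^sub>\<infinity>n::int. exp (- pi * t * (u + of_int n)\<^sup>2))" if "u = 0 \<or> u = 1 / 2" for u
  proof -
    have "(\<lambda>n::int. exp (- pi * t * (u + of_int n)\<^sup>2)) summable_on UNIV"
    proof (cases "u = 0")
      case True
      then show ?thesis
        using theta_summable(2) assms by (simp add: exp_series_summable_def)
    next
      case False
      with that have u: "u = 1 / 2" by simp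
      show ?thesis
        unfolding u using theta_summable(1) assms by (simp add: exp_series_summable_def)
    qed
    then show ?thesis by (intro infsumI has_sum_of_real has_sum_infsum)
  qed
  have p: "sqrt t * (\<Sum>\<^sub>\<infinity>n::int. complex_of_real (exp (- pi * t * (u + of_int n)\<^sup>2))) =
     (\<Sum>\<^sub>\<infinity>n::int. of_real (exp (- pi * (of_int n)\<^sup>2 / t)) * cis (2 * pi * (of_int n * u)))"
    if "u = 0 \<or> u = 1 / 2" for u
    unfolding real[OF that] poisson_int[OF assms] using assms by (simp flip: of_real_mult mult.assoc)
  show "theta3 (\<i> * of_real (1 / t)) = sqrt t * theta3 (\<i> * of_real t)"
    unfolding theta3_def exp_series_def exp_imaginary_axis using p[of 0] by simp
  show "theta4 (\<i> * of_real (1 / t)) = sqrt t * theta2 (\<i> * of_real t)"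
    unfolding theta4_def theta2_def exp_series_def exp_imaginary_axis using p[of "1 / 2"] by (simp add: mult.commute)
qed

lemma neg_inverse_holomorphic: "(\<lambda>z. - (1 / z)) holomorphic_on upper_half_plane"
  by (intro holomorphic_intros) auto

lemma holomorphic_neg_inverse_comp:
  assumes "f holomorphic_on upper_half_plane"
  shows "(\<lambda>z. f (- (1 / z))) holomorphic_on upper_half_plane"
proof -
  have "(\<lambda>z. - (1 / z)) ` upper_half_plane \<subseteq> upper_half_plane"
    by (intro image_subsetI) (simp only: in_upper_half_plane Im_neg_inverse_pos)
  from holomorphic_on_compose_gen[OF neg_inverse_holomorphic assms this]
  show ?thesis by (simp add: o_def)
qed

lemma neg_inverse_imaginary: "- (1 / (\<i> * of_real t)) = \<i> * of_real (1 / t)"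
  by (simp add: divide_simps)

text \<open>Fourth powers avoid the choice of a square root of \<open>z\<close>.\<close>

lemma theta_S:
  assumes z: "Im z > 0"
  shows "theta3 (- (1 / z)) ^ 4 = - (z\<^sup>2) * theta3 z ^ 4"
    and "theta4 (- (1 / z)) ^ 4 = - (z\<^sup>2) * theta2 z ^ 4"
    and "theta2 (- (1 / z)) ^ 4 = - (z\<^sup>2) * theta4 z ^ 4"
proof -
  have sqrt4: "complex_of_real (sqrt t) ^ 4 = of_real t ^ 2" if "t > 0" for t
  proof -
    have "sqrt t ^ 4 = (sqrt t ^ 2) ^ 2" by (simp flip: power_mult)
    also have "\<dots> = t ^ 2" using that by simp
    finally show ?thesis by (simp flip: of_real_power)
  qed
  have 3: "theta3 (- (1 / z)) ^ 4 + z\<^sup>2 * theta3 z ^ 4 = 0" if "Im z > 0" for z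
  proof (rule upper_half_plane_identity[of "\<lambda>z. theta3 (- (1 / z)) ^ 4 + z\<^sup>2 * theta3 z ^ 4", OF _ _ that])
    show "(\<lambda>z. theta3 (- (1 / z)) ^ 4 + z\<^sup>2 * theta3 z ^ 4) holomorphic_on upper_half_plane"
      by (intro holomorphic_intros holomorphic_neg_inverse_comp theta_holomorphic)
    fix t :: real assume t: "t > 0"
    show "theta3 (- (1 / (\<i> * of_real t))) ^ 4 + (\<i> * of_real t)\<^sup>2 * theta3 (\<i> * of_real t) ^ 4 = 0"
      unfolding neg_inverse_imaginary theta_imaginary_axis[OF t] power_mult_distrib sqrt4[OF t] by simp
  qed
  have 4: "theta4 (- (1 / z)) ^ 4 + z\<^sup>2 * theta2 z ^ 4 = 0" if "Im z > 0" for z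
  proof (rule upper_half_plane_identity[of "\<lambda>z. theta4 (- (1 / z)) ^ 4 + z\<^sup>2 * theta2 z ^ 4", OF _ _ that])
    show "(\<lambda>z. theta4 (- (1 / z)) ^ 4 + z\<^sup>2 * theta2 z ^ 4) holomorphic_on upper_half_plane"
      by (intro holomorphic_intros holomorphic_neg_inverse_comp theta_holomorphic)
    fix t :: real assume t: "t > 0"
    show "theta4 (- (1 / (\<i> * of_real t))) ^ 4 + (\<i> * of_real t)\<^sup>2 * theta2 (\<i> * of_real t) ^ 4 = 0"
      unfolding neg_inverse_imaginary theta_imaginary_axis[OF t] power_mult_distrib sqrt4[OF t] by simp
  qed
  show "theta3 (- (1 / z)) ^ 4 = - (z\<^sup>2) * theta3 z ^ 4"
    "theta4 (- (1 / z)) ^ 4 = - (z\<^sup>2) * theta2 z ^ 4"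
    using 3[OF z] 4[OF z] by (simp_all add: eq_neg_iff_add_eq_0)
  have z0: "z \<noteq> 0" using z by auto
  have "theta4 z ^ 4 + (1 / z)\<^sup>2 * theta2 (- (1 / z)) ^ 4 = 0"
    using 4[OF Im_neg_inverse_pos[OF z]] by simp
  then have "z\<^sup>2 * theta4 z ^ 4 + theta2 (- (1 / z)) ^ 4 = 0"
    using z0 by (simp add: field_simps)
  then show "theta2 (- (1 / z)) ^ 4 = - (z\<^sup>2) * theta4 z ^ 4"
    by (simp add: eq_neg_iff_add_eq_0 add.commute)
qed

text \<open>In the double sum over \<open>(m, n)\<close>, the pairs of opposite parity cancel when \<open>m\<close> and \<open>n\<close> are
  exchanged. The others have the form \<open>(a + b, a - b)\<close>, and \<open>(a+b)^2 + (a-b)^2 = 2 a^2 + 2 b^2\<close>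
  splits the sum into a product again.\<close>

lemma theta3_mult_theta4:
  assumes z: "Im z > 0"
  shows "theta3 z * theta4 z = theta4 (2 * z) ^ 2"
proof -
  define e where "e = (\<lambda>n::int. exp (\<i> * of_real (pi * (of_int n)\<^sup>2) * z))"
  define F where "F = (\<lambda>(m::int, n::int). e m * (cis (pi * of_int n) * e n))"
  define Ev where "Ev = {(m::int, n::int). even (m + n)}"
  have abs: "(\<lambda>n. norm (e n)) summable_on UNIV"
    using exp_series_abs_summable[OF theta_summable(2) z] by (simp add: e_def)
  have abs_prod: "(\<lambda>(m, n). norm (e m) * norm (e n)) summable_on UNIV \<times> UNIV"
    using abs by (intro summable_on_SigmaI[where g = "\<lambda>m. norm (e m) * (\<Sum>\<^sub>\<infinity>n. norm (e n))"])
      (auto intro!: has_sum_cmult_right summable_on_cmult_left)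
  then have absF: "(\<lambda>p. norm (F p)) summable_on UNIV"
    by (simp add: F_def case_prod_unfold norm_mult)
  have sumF: "F summable_on A" for A
    by (rule summable_on_subset_banach[OF abs_summable_summable[OF absF]]) simp
  have "theta3 z * theta4 z = (\<Sum>\<^sub>\<infinity>m. e m * (\<Sum>\<^sub>\<infinity>n. cis (pi * of_int n) * e n))"
    unfolding theta3_def theta4_def exp_series_def e_def
    by (simp add: infsum_cmult_left')
  also have "\<dots> = (\<Sum>\<^sub>\<infinity>m. \<Sum>\<^sub>\<infinity>n. F (m, n))"
    by (simp add: F_def infsum_cmult_right')
  also have "\<dots> = infsum F (UNIV \<times> UNIV)"
    using infsum_Sigma'_banach[of "\<lambda>m n. F (m, n)" UNIV "\<lambda>_. UNIV"] sumF[of UNIV] by simp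
  also have "UNIV \<times> UNIV = Ev \<union> - Ev" by simp
  also have "infsum F (Ev \<union> - Ev) = infsum F Ev + infsum F (- Ev)"
    by (rule infsum_Un_disjoint) (auto intro: sumF)
  also have "infsum F (- Ev) = 0"
  proof -
    have "infsum F (- Ev) = (\<Sum>\<^sub>\<infinity>p\<in>- Ev. - F p)"
    proof (rule infsum_reindex_bij_witness[of _ "\<lambda>(m, n). (n, m)" "\<lambda>(m, n). (n, m)"])
      fix p assume "p \<in> - Ev"
      then obtain a b where p: "p = (a, b)" "odd (a + b)" by (auto simp: Ev_def)
      then have "cis (pi * of_int a) = - cis (pi * of_int b)"
        by (cases "even a") (simp_all add: cis_pi_int)
      then show "- F (case p of (m, n) \<Rightarrow> (n, m)) = F p"
        by (simp add: p F_def mult_ac)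
    qed (auto simp: Ev_def)
    then show ?thesis by (simp add: infsum_uminus)
  qed
  also have "infsum F Ev = (\<Sum>\<^sub>\<infinity>(a, b). F (a + b, a - b))"
  proof -
    have "Ev \<subseteq> range (\<lambda>(a, b). (a + b, a - b))"
    proof
      fix p assume "p \<in> Ev"
      moreover obtain m n where p: "p = (m, n)" by (cases p)
      ultimately have "even (m + n)" by (simp add: Ev_def)
      then obtain k where "m + n = 2 * k" by (elim evenE)
      then have "p = (case (k, m - k) of (a, b) \<Rightarrow> (a + b, a - b))" by (simp add: p)
      then show "p \<in> range (\<lambda>(a, b). (a + b, a - b))" by (rule range_eqI)
    qed
    moreover have "range (\<lambda>(a, b). (a + b, a - b)) \<subseteq> Ev" by (auto simp: Ev_def)
    moreover have "inj (\<lambda>(a :: int, b). (a + b, a - b))" by (auto simp: inj_def)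
    ultimately have "bij_betw (\<lambda>(a, b). (a + b, a - b)) UNIV Ev" by (auto simp: bij_betw_def)
    from infsum_reindex_bij_betw[OF this, of F] show ?thesis by (simp add: case_prod_unfold)
  qed
  also have "\<dots> = (\<Sum>\<^sub>\<infinity>(a, b). (cis (pi * of_int a) * exp (\<i> * of_real (pi * (of_int a)\<^sup>2) * (2 * z))) *
       (cis (pi * of_int b) * exp (\<i> * of_real (pi * (of_int b)\<^sup>2) * (2 * z))))"
  proof (rule infsum_cong, clarify)
    fix a b :: int
    have "e (a + b) * e (a - b) = exp (\<i> * of_real (pi * (of_int a)\<^sup>2) * (2 * z)) * exp (\<i> * of_real (pi * (of_int b)\<^sup>2) * (2 * z))"
      unfolding e_def exp_add[symmetric] by (simp add: power2_eq_square algebra_simps)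
    moreover have "cis (pi * of_int (a - b)) = cis (pi * of_int a) * cis (pi * of_int b)"
      unfolding cis_pi_int by auto
    ultimately show "F (a + b, a - b) = (cis (pi * of_int a) * exp (\<i> * of_real (pi * (of_int a)\<^sup>2) * (2 * z))) *
       (cis (pi * of_int b) * exp (\<i> * of_real (pi * (of_int b)\<^sup>2) * (2 * z)))"
      by (simp add: F_def mult_ac)
  qed
  also have "\<dots> = theta4 (2 * z) ^ 2"
  proof -
    define g where "g = (\<lambda>a::int. cis (pi * of_int a) * exp (\<i> * of_real (pi * (of_int a)\<^sup>2) * (2 * z)))"
    have g: "(\<lambda>n. norm (g n)) summable_on UNIV"
      using exp_series_abs_summable[OF theta_summable(3), of "2 * z"] z by (simp add: g_def)
    have "(\<lambda>(m, n). norm (g m) * norm (g n)) summable_on UNIV \<times> UNIV"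
      using g by (intro summable_on_SigmaI[where g = "\<lambda>m. norm (g m) * (\<Sum>\<^sub>\<infinity>n. norm (g n))"])
        (auto intro!: has_sum_cmult_right summable_on_cmult_left)
    then have "(\<lambda>p. norm (case p of (m, n) \<Rightarrow> g m * g n)) summable_on UNIV \<times> UNIV"
      by (simp add: case_prod_unfold norm_mult)
    then have "(\<lambda>(m, n). g m * g n) summable_on UNIV \<times> UNIV"
      by (rule abs_summable_summable)
    then have "(\<Sum>\<^sub>\<infinity>(a, b)\<in>UNIV \<times> UNIV. g a * g b) = (\<Sum>\<^sub>\<infinity>a. \<Sum>\<^sub>\<infinity>b. g a * g b)"
      by (rule infsum_Sigma'_banach[symmetric])
    also have "\<dots> = (\<Sum>\<^sub>\<infinity>a. g a) * (\<Sum>\<^sub>\<infinity>b. g b)"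
      by (simp add: infsum_cmult_right' infsum_cmult_left')
    finally show ?thesis
      unfolding g_def theta4_def exp_series_def power2_eq_square by simp
  qed
  finally show ?thesis by simp
qed

section \<open>Expansions at the cusp and modular forms\<close>

text \<open>With this normalization of the nome, \<open>e^(\<pi> \<i> z)\<close> and not its square, a lattice vector of
  norm \<open>m\<close> contributes to the \<open>m\<close>-th power.\<close>

definition nome :: "complex \<Rightarrow> complex" where
  "nome z = exp (\<i> * pi * z)"

lemma nome_nonzero [simp]: "nome z \<noteq> 0"
  by (simp add: nome_def)

lemma nome_power: "nome z ^ n = exp (\<i> * of_real (pi * of_nat n) * z)"
  by (simp add: nome_def exp_of_nat_mult[symmetric] mult_ac)

lemma nome_tendsto: "(nome \<longlongrightarrow> 0) at_cusp"
proof (rule tendsto_norm_zero_cancel)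
  have "((\<lambda>y::real. exp (- pi * y)) \<longlongrightarrow> 0) at_top"
    by real_asymp
  then have "((\<lambda>z. exp (- pi * Im z)) \<longlongrightarrow> 0) at_cusp"
    unfolding at_cusp_def by (rule filterlim_compose) (rule filterlim_filtercomap)
  then show "((\<lambda>z. norm (nome z)) \<longlongrightarrow> 0) at_cusp"
    by (simp add: nome_def)
qed

text \<open>The expansion \<open>f = a + b x + c x^2 + o(x^2)\<close> in the nome \<open>x\<close> at the cusp. Two orders beyond
  the leading term are all that the argument needs.\<close>

definition jet :: "(complex \<Rightarrow> complex) \<Rightarrow> complex \<Rightarrow> complex \<Rightarrow> complex \<Rightarrow> bool" where
  "jet f a b c \<longleftrightarrow> ((\<lambda>z. (f z - (a + b * nome z + c * nome z ^ 2)) / nome z ^ 2) \<longlongrightarrow> 0) at_cusp"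

lemma jet_polynomial: "jet (\<lambda>z. a + b * nome z + c * nome z ^ 2) a b c"
  by (simp add: jet_def)

lemma jet_const: "jet (\<lambda>_. a) a 0 0"
  using jet_polynomial[of a 0 0] by simp

lemma jet_nome: "jet nome 0 1 0"
  using jet_polynomial[of 0 1 0] by simp

lemma jet_add:
  assumes "jet f a b c" "jet g a' b' c'"
  shows "jet (\<lambda>z. f z + g z) (a + a') (b + b') (c + c')"
proof -
  have "(f z - (a + b * nome z + c * nome z ^ 2)) / nome z ^ 2 + (g z - (a' + b' * nome z + c' * nome z ^ 2)) / nome z ^ 2 =
      (f z + g z - (a + a' + (b + b') * nome z + (c + c') * nome z ^ 2)) / nome z ^ 2" for z
    by (simp add: field_simps)
  then show ?thesis
    using tendsto_add[OF assms[unfolded jet_def]] by (simp add: jet_def)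
qed

lemma jet_mult:
  assumes "jet f a b c" "jet g a' b' c'"
  shows "jet (\<lambda>z. f z * g z) (a * a') (a * b' + b * a') (a * c' + b * b' + c * a')"
proof -
  define P where "P = (\<lambda>a b c z. a + b * nome z + c * nome z ^ 2)"
  define \<epsilon> where "\<epsilon> = (\<lambda>f a b c z. (f z - P a b c z) / nome z ^ 2)"
  have P: "(P a b c \<longlongrightarrow> a + b * 0 + c * 0 ^ 2) at_cusp" for a b c
    unfolding P_def by (intro tendsto_intros nome_tendsto)
  have \<epsilon>: "(\<epsilon> f a b c \<longlongrightarrow> 0) at_cusp" "(\<epsilon> g a' b' c' \<longlongrightarrow> 0) at_cusp"
    using assms unfolding jet_def \<epsilon>_def P_def .
  have "((\<lambda>z. \<epsilon> f a b c z * (P a' b' c' z + nome z ^ 2 * \<epsilon> g a' b' c' z) + P a b c z * \<epsilon> g a' b' c' z +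
      nome z * (b * c' + c * b' + nome z * (c * c'))) \<longlongrightarrow>
     0 * ((a' + b' * 0 + c' * 0 ^ 2) + 0 ^ 2 * 0) + (a + b * 0 + c * 0 ^ 2) * 0 + 0 * (b * c' + c * b' + 0 * (c * c'))) at_cusp"
    by (intro tendsto_intros nome_tendsto P \<epsilon>)
  moreover have "\<epsilon> f a b c z * (P a' b' c' z + nome z ^ 2 * \<epsilon> g a' b' c' z) + P a b c z * \<epsilon> g a' b' c' z +
      nome z * (b * c' + c * b' + nome z * (c * c')) =
     (f z * g z - (a * a' + (a * b' + b * a') * nome z + (a * c' + b * b' + c * a') * nome z ^ 2)) / nome z ^ 2" for z
  proof -
    have f: "f z = P a b c z + nome z ^ 2 * \<epsilon> f a b c z" and g: "g z = P a' b' c' z + nome z ^ 2 * \<epsilon> g a' b' c' z"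
      by (simp_all add: \<epsilon>_def)
    show ?thesis
      unfolding f g eq_divide_eq by (simp add: P_def power2_eq_square algebra_simps)
  qed
  ultimately show ?thesis by (simp add: jet_def)
qed

lemma jet_tendsto:
  assumes "jet f a b c"
  shows "(f \<longlongrightarrow> a) at_cusp"
proof -
  have "((\<lambda>z. (f z - (a + b * nome z + c * nome z ^ 2)) / nome z ^ 2 * nome z ^ 2 + (a + b * nome z + c * nome z ^ 2)) \<longlongrightarrow>
     0 * 0 ^ 2 + (a + b * 0 + c * 0 ^ 2)) at_cusp"
    by (intro tendsto_intros nome_tendsto assms[unfolded jet_def])
  then show ?thesis by simp
qed

lemma jet_power:
  assumes "jet f 1 0 c"
  shows "jet (\<lambda>z. f z ^ n) 1 0 (of_nat n * c)"
proof (induction n)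
  case 0
  then show ?case using jet_const[of 1] by simp
next
  case (Suc n)
  then show ?case using jet_mult[OF assms Suc] by (simp add: algebra_simps)
qed

lemma jet_inverse:
  assumes "jet f 1 0 c"
  shows "jet (\<lambda>z. inverse (f z)) 1 0 (- c)"
proof -
  have "jet (\<lambda>z. f z * (1 + 0 * nome z + (- c) * nome z ^ 2)) 1 0 0"
    using jet_mult[OF assms jet_polynomial[of 1 0 "- c"]] by simp
  then have "((\<lambda>z. - ((f z * (1 + 0 * nome z + (- c) * nome z ^ 2) - 1) / nome z ^ 2 * inverse (f z))) \<longlongrightarrow> - (0 * inverse 1)) at_cusp"
    unfolding jet_def by (intro tendsto_intros jet_tendsto[OF assms]) simp_all
  moreover have "\<forall>\<^sub>F z in at_cusp. f z \<noteq> 0"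
    using tendsto_imp_eventually_ne[OF jet_tendsto[OF assms], of 0] by simp
  then have "\<forall>\<^sub>F z in at_cusp. - ((f z * (1 + 0 * nome z + (- c) * nome z ^ 2) - 1) / nome z ^ 2 * inverse (f z)) =
      (inverse (f z) - (1 + 0 * nome z + (- c) * nome z ^ 2)) / nome z ^ 2"
    by eventually_elim (simp add: field_simps)
  ultimately show ?thesis
    unfolding jet_def using Lim_transform_eventually by fastforce
qed

lemma int_square_le_2: "{n :: int. (real_of_int n)\<^sup>2 \<le> 2} = {- 1, 0, 1}"
proof (intro equalityI subsetI)
  fix n :: int assume "n \<in> {n. (real_of_int n)\<^sup>2 \<le> 2}"
  then have "n\<^sup>2 \<le> 2" by (metis mem_Collect_eq of_int_le_iff of_int_numeral of_int_power)
  have "\<bar>n\<bar> \<le> 1"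
  proof (rule ccontr)
    assume "\<not> \<bar>n\<bar> \<le> 1"
    then have "2 ^ 2 \<le> \<bar>n\<bar> ^ 2" by (intro power_mono) auto
    then show False using \<open>n\<^sup>2 \<le> 2\<close> by simp
  qed
  then show "n \<in> {- 1, 0, 1}" by auto
qed auto

lemma int_square_gt_2: "(real_of_int n)\<^sup>2 > 2 \<Longrightarrow> (real_of_int n)\<^sup>2 \<ge> 2 + 1"
proof -
  assume "(real_of_int n)\<^sup>2 > 2"
  then have "real_of_int (n\<^sup>2) > of_int 2" by simp
  then have "n\<^sup>2 > 2" unfolding of_int_less_iff .
  then have "n\<^sup>2 \<ge> 3" by simp
  then have "real_of_int 3 \<le> real_of_int (n\<^sup>2)" unfolding of_int_le_iff .
  then show ?thesis by simp
qed

lemma jet_theta34: "jet theta3 1 2 0" "jet theta4 1 (- 2) 0"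
proof -
  have e2: "exp (- \<i> * of_real (pi * 2) * z) = 1 / nome z ^ 2" for z
    by (simp add: nome_power exp_minus field_simps)
  have "{x :: int. x \<in> UNIV \<and> (real_of_int x)\<^sup>2 \<le> 2} = {- 1, 0, 1}"
    using int_square_le_2 by simp
  note exp = exp_series_expansion[OF theta_summable(2) zero_less_one, of 2, unfolded this]
    exp_series_expansion[OF theta_summable(3) zero_less_one, of 2, unfolded this]
  have *: "((\<lambda>z. (theta3 z - (\<Sum>x\<in>{- 1, 0, 1::int}. 1 * exp (\<i> * of_real (pi * (real_of_int x)\<^sup>2) * z)))
           * exp (- \<i> * of_real (pi * 2) * z)) \<longlongrightarrow> 0) at_cusp"
    "((\<lambda>z. (theta4 z - (\<Sum>x\<in>{- 1, 0, 1::int}. cis (pi * of_int x) * exp (\<i> * of_real (pi * (real_of_int x)\<^sup>2) * z)))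
           * exp (- \<i> * of_real (pi * 2) * z)) \<longlongrightarrow> 0) at_cusp"
    unfolding theta3_def theta4_def using exp int_square_gt_2 by auto
  have s: "(\<Sum>x\<in>{- 1, 0, 1::int}. 1 * exp (\<i> * of_real (pi * (real_of_int x)\<^sup>2) * z)) = 1 + 2 * nome z + 0 * nome z ^ 2"
    "(\<Sum>x\<in>{- 1, 0, 1::int}. cis (pi * of_int x) * exp (\<i> * of_real (pi * (real_of_int x)\<^sup>2) * z)) = 1 + (- 2) * nome z + 0 * nome z ^ 2"
    for z
    by (simp_all add: cis_pi_int nome_def)
  show "jet theta3 1 2 0" "jet theta4 1 (- 2) 0"
    using * unfolding s e2 jet_def by simp_all
qed

text \<open>The series of \<open>theta2\<close> starts with the fourth root of the nome, which is divided out.\<close>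

lemma jet_theta2: "jet (\<lambda>z. theta2 z / exp (\<i> * pi * z / 4)) 2 0 2"
proof -
  define r where "r = (\<lambda>z. exp (\<i> * pi * z / 4))"
  have sq: "(1 / 2 + real_of_int n)\<^sup>2 = real_of_int (n * (n + 1)) + 1 / 4" for n
    by (simp add: power2_eq_square algebra_simps)
  have le: "(1 / 2 + real_of_int n)\<^sup>2 \<le> 9 / 4 \<longleftrightarrow> n * (n + 1) \<le> 2" for n
  proof -
    have "(1 / 2 + real_of_int n)\<^sup>2 \<le> 9 / 4 \<longleftrightarrow> real_of_int (n * (n + 1)) \<le> of_int 2"
      unfolding sq by (simp only: of_int_numeral) linarith
    then show ?thesis by (simp only: of_int_le_iff)
  qed
  have set: "{x :: int. x \<in> UNIV \<and> (1 / 2 + real_of_int x)\<^sup>2 \<le> 9 / 4} = {- 2, - 1, 0, 1}"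
  proof (intro equalityI subsetI)
    fix n :: int assume "n \<in> {x. x \<in> UNIV \<and> (1 / 2 + real_of_int x)\<^sup>2 \<le> 9 / 4}"
    then have n: "n * (n + 1) \<le> 2" using le by simp
    have "n < 2"
    proof (rule ccontr)
      assume "\<not> n < 2"
      then have "2 * 3 \<le> n * (n + 1)" by (intro mult_mono) auto
      then show False using n by simp
    qed
    moreover have "n > - 3"
    proof (rule ccontr)
      assume "\<not> n > - 3"
      then have "3 * 2 \<le> (- n) * (- (n + 1))" by (intro mult_mono) auto
      then show False using n unfolding minus_mult_minus by linarith
    qed
    ultimately show "n \<in> {- 2, - 1, 0, 1}" by auto
  qed (auto simp: power2_eq_square)
  have gt: "(1 / 2 + real_of_int n)\<^sup>2 \<ge> 9 / 4 + 1" if "(1 / 2 + real_of_int n)\<^sup>2 > 9 / 4" for n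
  proof -
    have "n * (n + 1) \<ge> 3" using that le[of n] by linarith
    then have "real_of_int 3 \<le> real_of_int (n * (n + 1))" unfolding of_int_le_iff .
    then show ?thesis unfolding sq by simp
  qed
  have "((\<lambda>z. (theta2 z - (\<Sum>x\<in>{- 2, - 1, 0, 1::int}. 1 * exp (\<i> * of_real (pi * (1 / 2 + real_of_int x)\<^sup>2) * z)))
           * exp (- \<i> * of_real (pi * (9 / 4)) * z)) \<longlongrightarrow> 0) at_cusp"
    unfolding theta2_def set[symmetric]
    by (rule exp_series_expansion[OF theta_summable(1) zero_less_one]) (use gt in \<open>auto simp: set[simplified]\<close>)
  moreover have "(theta2 z - (\<Sum>x\<in>{- 2, - 1, 0, 1::int}. 1 * exp (\<i> * of_real (pi * (1 / 2 + real_of_int x)\<^sup>2) * z)))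
           * exp (- \<i> * of_real (pi * (9 / 4)) * z) =
      (theta2 z / r z - (2 + 0 * nome z + 2 * nome z ^ 2)) / nome z ^ 2" for z
  proof -
    have rn: "exp (\<i> * of_real (pi * (1 / 4)) * z) = r z" "exp (\<i> * of_real (pi * (9 / 4)) * z) = r z ^ 9"
      "nome z ^ 2 = r z ^ 8"
      by (simp_all add: r_def nome_power exp_of_nat_mult[symmetric] mult_ac)
    have s: "(\<Sum>x\<in>{- 2, - 1, 0, 1::int}. 1 * exp (\<i> * of_real (pi * (1 / 2 + real_of_int x)\<^sup>2) * z)) =
       2 * r z + 2 * r z ^ 9"
    proof -
      define E where "E = (\<lambda>y. exp (\<i> * of_real (pi * y) * z))"
      have "(\<Sum>x\<in>{- 2, - 1, 0, 1::int}. 1 * E ((1 / 2 + real_of_int x)\<^sup>2)) = 2 * E (1 / 4) + 2 * E (9 / 4)"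
        by (simp add: power2_eq_square)
      then show ?thesis unfolding E_def rn(1,2) .
    qed
    have e: "exp (- \<i> * of_real (pi * (9 / 4)) * z) = 1 / r z ^ 9"
      unfolding rn(2)[symmetric] by (simp add: exp_minus field_simps)
    have "r z \<noteq> 0" by (simp add: r_def)
    then show ?thesis
      unfolding s e rn(3) by (simp add: field_simps eval_nat_numeral)
  qed
  ultimately show ?thesis by (simp add: jet_def r_def)
qed

text \<open>If \<open>theta3\<close> vanishes at \<open>w\<close>, then \<open>theta4\<close> vanishes at \<open>2 w\<close> by the product formula, so
  \<open>theta3\<close> vanishes at \<open>2 w + 1\<close>. Iteration moves the zero up to the cusp, where \<open>theta3\<close> tends to
  \<open>1\<close>.\<close>

lemma theta3_nonzero:
  assumes "Im z > 0"
  shows "theta3 z \<noteq> 0"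
proof
  assume zero: "theta3 z = 0"
  have step: "theta3 (2 * w + 1) = 0" if "Im w > 0" "theta3 w = 0" for w
    using theta3_mult_theta4[OF that(1)] that(2) by (simp add: theta_T)
  have "\<exists>w. Im w \<ge> 2 ^ n * Im z \<and> Im w > 0 \<and> theta3 w = 0" for n
  proof (induction n)
    case 0
    then show ?case using assms zero by auto
  next
    case (Suc n)
    then obtain w where "Im w \<ge> 2 ^ n * Im z" "Im w > 0" "theta3 w = 0" by blast
    then show ?case using step[of w] by (intro exI[of _ "2 * w + 1"]) auto
  qed
  moreover have "\<forall>\<^sub>F z in at_cusp. theta3 z \<noteq> 0"
    using tendsto_imp_eventually_ne[OF jet_tendsto[OF jet_theta34(1)], of 0] by simp
  then obtain Y where Y: "\<And>z. Im z \<ge> Y \<Longrightarrow> theta3 z \<noteq> 0"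
    unfolding eventually_at_cusp by blast
  obtain n :: nat where "Y / Im z < 2 ^ n"
    using real_arch_pow[of 2 "Y / Im z"] by auto
  then have "Y < 2 ^ n * Im z" using assms by (simp add: field_simps)
  ultimately show False using Y by (meson less_imp_le order_trans)
qed

lemma theta4_nonzero: "Im z > 0 \<Longrightarrow> theta4 z \<noteq> 0"
  using theta3_nonzero[of "z + 1"] by (simp add: theta_T)

lemma theta2_nonzero:
  assumes "Im z > 0"
  shows "theta2 z \<noteq> 0"
proof
  assume "theta2 z = 0"
  then have "theta4 (- (1 / z)) ^ 4 = 0" using theta_S(2)[OF assms] by simp
  then show False using theta4_nonzero[OF Im_neg_inverse_pos[OF assms]] by simp
qed

text \<open>Weakly modular of weight \<open>k\<close> for the full modular group. There is no condition at the cusp,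
  and \<open>k\<close> may be negative, so that division by powers of \<open>Delta\<close> is allowed.\<close>

definition modular :: "int \<Rightarrow> (complex \<Rightarrow> complex) \<Rightarrow> bool" where
  "modular k f \<longleftrightarrow> f holomorphic_on upper_half_plane \<and>
     (\<forall>z. Im z > 0 \<longrightarrow> f (z + 1) = f z \<and> f (- (1 / z)) = z powi k * f z)"

lemma nonzero_of_Im_pos: "Im z > 0 \<Longrightarrow> z \<noteq> 0"
  by auto

lemma modular_mult: "modular k f \<Longrightarrow> modular l g \<Longrightarrow> modular (k + l) (\<lambda>z. f z * g z)"
  unfolding modular_def
  by (auto intro!: holomorphic_intros simp: power_int_add[OF disjI1[OF nonzero_of_Im_pos]])

lemma modular_power: "modular k f \<Longrightarrow> modular (int n * k) (\<lambda>z. f z ^ n)"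
proof (induction n)
  case 0
  then show ?case by (simp add: modular_def)
next
  case (Suc n)
  then show ?case
    using modular_mult[OF Suc.prems Suc.IH[OF Suc.prems]] by (simp add: distrib_right)
qed

lemma modular_inverse:
  "modular k f \<Longrightarrow> (\<And>z. Im z > 0 \<Longrightarrow> f z \<noteq> 0) \<Longrightarrow> modular (- k) (\<lambda>z. inverse (f z))"
  unfolding modular_def by (auto intro!: holomorphic_intros simp: power_int_minus)

lemma modular_diff_mult: "modular k f \<Longrightarrow> modular k g \<Longrightarrow> modular k (\<lambda>z. f z - c * g z)"
  unfolding modular_def by (auto intro!: holomorphic_intros simp: algebra_simps)

text \<open>The Eisenstein series of weight \<open>4\<close> as a polynomial in theta constants, for which modularity
  becomes an algebraic identity.\<close>

definition eis4 :: "complex \<Rightarrow> complex" where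
  "eis4 z = ((theta2 z ^ 4) ^ 2 + (theta3 z ^ 4) ^ 2 + (theta4 z ^ 4) ^ 2) / 2"

text \<open>The Eisenstein series of weight \<open>6\<close>.\<close>

definition eis6 :: "complex \<Rightarrow> complex" where
  "eis6 z = (theta2 z ^ 4 + theta3 z ^ 4) * (theta3 z ^ 4 + theta4 z ^ 4) * (theta4 z ^ 4 - theta2 z ^ 4) / 2"

text \<open>The discriminant form; as a product of theta constants it visibly has no zeros.\<close>

definition Delta :: "complex \<Rightarrow> complex" where
  "Delta z = (theta2 z ^ 4 * theta3 z ^ 4 * theta4 z ^ 4) ^ 2 / 256"

lemma theta2_T4: "theta2 (z + 1) ^ 4 = - (theta2 z ^ 4)"
proof -
  have "exp (\<i> * pi / 4) ^ 4 = exp (\<i> * pi)"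
    by (simp flip: exp_of_nat_mult)
  then show ?thesis by (simp add: theta_T power_mult_distrib)
qed

lemma modular_eis4: "modular 4 eis4"
  unfolding modular_def
proof (intro conjI allI impI)
  show "eis4 holomorphic_on upper_half_plane"
    unfolding eis4_def[abs_def] by (intro holomorphic_intros theta_holomorphic) auto
  fix z assume z: "Im z > 0"
  show "eis4 (z + 1) = eis4 z"
    unfolding eis4_def theta2_T4 by (simp add: theta_T)
  show "eis4 (- (1 / z)) = z powi 4 * eis4 z"
    unfolding eis4_def theta_S[OF z] by (simp add: power2_eq_square power4_eq_xxxx algebra_simps add_divide_distrib)
qed

lemma modular_eis6: "modular 6 eis6"
  unfolding modular_def
proof (intro conjI allI impI)
  show "eis6 holomorphic_on upper_half_plane"
    unfolding eis6_def[abs_def] by (intro holomorphic_intros theta_holomorphic) auto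
  fix z assume z: "Im z > 0"
  show "eis6 (z + 1) = eis6 z"
    unfolding eis6_def theta2_T4 theta_T(2,3) by (simp add: algebra_simps)
  have "z powi 6 = (z\<^sup>2) ^ 3" by (simp flip: power_mult)
  then show "eis6 (- (1 / z)) = z powi 6 * eis6 z"
    unfolding eis6_def theta_S[OF z] by (simp add: power3_eq_cube) (simp add: algebra_simps)
qed

lemma modular_Delta: "modular 12 Delta"
  unfolding modular_def
proof (intro conjI allI impI)
  show "Delta holomorphic_on upper_half_plane"
    unfolding Delta_def[abs_def] by (intro holomorphic_intros theta_holomorphic) auto
  fix z assume z: "Im z > 0"
  show "Delta (z + 1) = Delta z"
    unfolding Delta_def theta2_T4 theta_T(2,3) by (simp add: algebra_simps)
  have "z powi 12 = (z\<^sup>2) ^ 6" by (simp flip: power_mult)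
  then show "Delta (- (1 / z)) = z powi 12 * Delta z"
    unfolding Delta_def theta_S[OF z] by (simp add: power_mult_distrib eval_nat_numeral algebra_simps)
qed

lemma Delta_nonzero: "Im z > 0 \<Longrightarrow> Delta z \<noteq> 0"
  by (simp add: Delta_def theta2_nonzero theta3_nonzero theta4_nonzero)

lemma jet_theta_fourth_powers:
  "jet (\<lambda>z. theta2 z ^ 4 / nome z) 16 0 64"
  "jet (\<lambda>z. theta3 z ^ 4) 1 8 24"
  "jet (\<lambda>z. theta4 z ^ 4) 1 (- 8) 24"
  "jet (\<lambda>z. theta2 z ^ 4) 0 16 0"
proof -
  have p4: "jet (\<lambda>z. f z ^ 4) (a ^ 4) (4 * a ^ 3 * b) (4 * a ^ 3 * c + 6 * a ^ 2 * b ^ 2)" if "jet f a b c" for f a b c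
  proof -
    have "(\<lambda>z. f z ^ 4) = (\<lambda>z. (f z * f z) * (f z * f z))" by (simp add: power4_eq_xxxx mult_ac)
    moreover have "a * a * (a * a) = a ^ 4" "a * a * (a * b + b * a) + (a * b + b * a) * (a * a) = 4 * a ^ 3 * b"
      "a * a * (a * c + b * b + c * a) + (a * b + b * a) * (a * b + b * a) + (a * c + b * b + c * a) * (a * a) =
        4 * a ^ 3 * c + 6 * a ^ 2 * b ^ 2"
      by (simp_all add: power2_eq_square power3_eq_cube power4_eq_xxxx algebra_simps)
    ultimately show ?thesis
      using jet_mult[OF jet_mult[OF that that] jet_mult[OF that that]] by (simp only:)
  qed
  show "jet (\<lambda>z. theta3 z ^ 4) 1 8 24" "jet (\<lambda>z. theta4 z ^ 4) 1 (- 8) 24"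
    using p4[OF jet_theta34(1)] p4[OF jet_theta34(2)] by simp_all
  have "(\<lambda>z. (theta2 z / exp (\<i> * pi * z / 4)) ^ 4) = (\<lambda>z. theta2 z ^ 4 / nome z)"
    by (simp add: power_divide nome_def flip: exp_of_nat_mult)
  with p4[OF jet_theta2] show 1: "jet (\<lambda>z. theta2 z ^ 4 / nome z) 16 0 64"
    by simp
  show "jet (\<lambda>z. theta2 z ^ 4) 0 16 0"
    using jet_mult[OF 1 jet_nome] by simp
qed

lemma jet_eis4: "jet eis4 1 0 240"
proof -
  note J = jet_theta_fourth_powers
  have "jet (\<lambda>z. (theta2 z ^ 4 * theta2 z ^ 4 + theta3 z ^ 4 * theta3 z ^ 4 + theta4 z ^ 4 * theta4 z ^ 4) * (1 / 2)) 1 0 240"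
    using jet_mult[OF jet_add[OF jet_add[OF jet_mult[OF J(4) J(4)] jet_mult[OF J(2) J(2)]] jet_mult[OF J(3) J(3)]] jet_const[of "1 / 2"]]
    by simp
  then show ?thesis by (simp add: eis4_def[abs_def] power2_eq_square)
qed

lemma jet_eis6: "jet eis6 1 0 (- 504)"
proof -
  note J = jet_theta_fourth_powers
  have "jet (\<lambda>z. (theta2 z ^ 4 + theta3 z ^ 4) * (theta3 z ^ 4 + theta4 z ^ 4) * (theta4 z ^ 4 + (- 1) * theta2 z ^ 4) * (1 / 2)) 1 0 (- 504)"
    using jet_mult[OF jet_mult[OF jet_mult[OF jet_add[OF J(4) J(2)] jet_add[OF J(2) J(3)]]
      jet_add[OF J(3) jet_mult[OF jet_const[of "- 1"] J(4)]]] jet_const[of "1 / 2"]]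
    by simp
  then show ?thesis by (simp add: eis6_def[abs_def])
qed

lemma jet_Delta: "jet (\<lambda>z. Delta z / nome z ^ 2) 1 0 (- 24)"
proof -
  note J = jet_theta_fourth_powers
  let ?p = "\<lambda>z. theta2 z ^ 4 / nome z * theta3 z ^ 4 * theta4 z ^ 4"
  have "jet ?p 16 0 (- 192)"
    using jet_mult[OF jet_mult[OF J(1) J(2)] J(3)] by simp
  then have "jet (\<lambda>z. ?p z * ?p z * (1 / 256)) 1 0 (- 24)"
    using jet_mult[OF jet_mult[of ?p 16 0 "- 192" ?p 16 0 "- 192"] jet_const[of "1 / 256"]] by simp
  moreover have "(\<lambda>z. ?p z * ?p z * (1 / 256)) = (\<lambda>z. Delta z / nome z ^ 2)"
    by (simp add: Delta_def power2_eq_square mult_ac)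
  ultimately show ?thesis by simp
qed

text \<open>The function \<open>h\<close> has the expansion \<open>a x^(-2) + b + o(1)\<close> in the nome \<open>x\<close>, so \<open>b\<close> is its
  constant term.\<close>

lemma weight_two_jet:
  assumes h: "modular 2 h" and G: "jet G a 0 b" and eq: "\<And>z. Im z > 0 \<Longrightarrow> h z = G z / nome z ^ 2"
  shows "b = 0"
proof (rule weight_two_constant_term[of h a])
  have "\<forall>\<^sub>F z in at_cusp. (G z - (a + 0 * nome z + b * nome z ^ 2)) / nome z ^ 2 = h z - a * exp (- 2 * pi * \<i> * z) - b"
    using eventually_at_cusp_Im_gt[of 0]
  proof eventually_elim
    case (elim z)
    have "exp (- 2 * pi * \<i> * z) = 1 / nome z ^ 2"
      by (simp add: nome_power exp_minus field_simps)
    then show ?case by (simp add: eq[OF elim] field_simps)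
  qed
  then show "((\<lambda>z. h z - a * exp (- 2 * pi * \<i> * z) - b) \<longlongrightarrow> 0) at_cusp"
    using G unfolding jet_def by (rule Lim_transform_eventually[rotated])
qed (use h in \<open>auto simp: modular_def\<close>)

lemma inverse_Delta_power:
  "inverse (Delta z / nome z ^ 2) ^ 11 = nome z ^ 20 * nome z ^ 2 * inverse (Delta z) ^ 11"
  by (simp add: power_divide divide_inverse power_mult_distrib flip: power_mult power_add)

text \<open>In \<open>f E_4 E_6 / \<Delta>^11\<close> the coefficient \<open>a\<close> contributes \<open>(240 - 504 + 11 * 24) a = 0\<close> to the
  constant term.\<close>

lemma modular_124_coefficient:
  assumes f: "modular 124 f" and jet: "jet (\<lambda>z. f z / nome z ^ 20) a 0 b"
  shows "b = 0"
proof (rule weight_two_jet)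
  show "modular 2 (\<lambda>z. f z * eis4 z * eis6 z * inverse (Delta z) ^ 11)"
    using modular_mult[OF modular_mult[OF modular_mult[OF f modular_eis4] modular_eis6]
      modular_power[OF modular_inverse[OF modular_Delta Delta_nonzero], of 11]] by simp
  let ?G = "\<lambda>z. f z / nome z ^ 20 * eis4 z * eis6 z * inverse (Delta z / nome z ^ 2) ^ 11"
  show "jet ?G a 0 b"
    using jet_mult[OF jet_mult[OF jet_mult[OF jet jet_eis4] jet_eis6] jet_power[OF jet_inverse[OF jet_Delta], of 11]]
    by simp
  show "f z * eis4 z * eis6 z * inverse (Delta z) ^ 11 = ?G z / nome z ^ 2" for z
  proof -
    have "x / p * b * c * (p * q * I) / q = x * b * c * I" if "p \<noteq> 0" "q \<noteq> 0" for x p b c q I :: complex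
      using that by simp
    then show ?thesis unfolding inverse_Delta_power by simp
  qed
qed

text \<open>In \<open>f (E_4^3 - 984 \<Delta>) / \<Delta>^11\<close> the coefficient \<open>a\<close> contributes
  \<open>(3 * 240 - 984 + 11 * 24) a = 0\<close> to the constant term; this determines the number \<open>984\<close>.\<close>

lemma modular_122_coefficient:
  assumes f: "modular 122 f" and jet: "jet (\<lambda>z. f z / nome z ^ 20) a 0 b"
  shows "b = 0"
proof (rule weight_two_jet)
  show "modular 2 (\<lambda>z. f z * (eis4 z ^ 3 - 984 * Delta z) * inverse (Delta z) ^ 11)"
    using modular_mult[OF modular_mult[OF f modular_diff_mult[OF modular_power[OF modular_eis4, of 3, simplified] modular_Delta]]
      modular_power[OF modular_inverse[OF modular_Delta Delta_nonzero], of 11]] modular_Delta by simp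
  have D: "jet (\<lambda>z. (- 984) * (Delta z / nome z ^ 2 * (nome z * nome z))) 0 0 (- 984)"
    using jet_mult[OF jet_const[of "- 984"] jet_mult[OF jet_Delta jet_mult[OF jet_nome jet_nome]]] by simp
  let ?G = "\<lambda>z. f z / nome z ^ 20 * (eis4 z ^ 3 + (- 984) * (Delta z / nome z ^ 2 * (nome z * nome z))) *
      inverse (Delta z / nome z ^ 2) ^ 11"
  show "jet ?G a 0 b"
    using jet_mult[OF jet_mult[OF jet jet_add[OF jet_power[OF jet_eis4, of 3] D]] jet_power[OF jet_inverse[OF jet_Delta], of 11]]
    by simp
  show "f z * (eis4 z ^ 3 - 984 * Delta z) * inverse (Delta z) ^ 11 = ?G z / nome z ^ 2" for z
  proof -
    have "x / p * (e + (- 984) * (D / q * q)) * (p * q * I) / q = x * (e - 984 * D) * I"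
      if "p \<noteq> 0" "q \<noteq> 0" for x p e D q I :: complex
      using that by simp
    then show ?thesis
      unfolding inverse_Delta_power power2_eq_square[of "nome z", symmetric] by simp
  qed
qed

section \<open>Theta series weighted by power sums\<close>

lemma power_le_fact_exp: "0 \<le> y \<Longrightarrow> y ^ m \<le> fact m * exp y" for y :: real
proof -
  assume y: "0 \<le> y"
  have "(\<Sum>n\<in>{m}. y ^ n /\<^sub>R fact n) \<le> exp y"
    unfolding exp_def by (rule sum_le_suminf[OF summable_exp_generic]) (use y in auto)
  then show ?thesis by (simp add: field_simps)
qed

lemma gaussian_moment_summable:
  fixes L :: "(real ^ 'n::finite) set"
  assumes "unimodular_lattice L" "t > 0"
  shows "(\<lambda>x. norm x ^ m * exp (r * norm x) * exp (- t * (x \<bullet> x))) summable_on L"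
proof (rule summable_on_comparison_test)
  \<comment> \<open>One additional \<open>norm x\<close> in the exponent absorbs the factor \<open>norm x ^ m\<close>; the square is
    completed.\<close>
  define r' where "r' = r + 1"
  show "(\<lambda>x. fact m * exp (r'\<^sup>2 / (2 * t)) * exp (- (t / 2) * (x \<bullet> x))) summable_on L"
    by (intro summable_on_cmult_right unimodular_gaussian_summable[OF assms(1)]) (use assms in auto)
  fix x :: "real ^ 'n"
  have "0 \<le> (r' - t * norm x)\<^sup>2 / (2 * t)"
    using assms(2) by simp
  also have "\<dots> = r'\<^sup>2 / (2 * t) - r' * norm x + t / 2 * (norm x)\<^sup>2"
    using assms(2) by (simp add: power2_eq_square field_simps)
  finally have "r' * norm x - t * (x \<bullet> x) \<le> r'\<^sup>2 / (2 * t) - t / 2 * (x \<bullet> x)"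
    by (simp add: dot_square_norm)
  then have "exp (norm x + r * norm x - t * (x \<bullet> x)) \<le> exp (r'\<^sup>2 / (2 * t) - t / 2 * (x \<bullet> x))"
    by (simp add: r'_def algebra_simps)
  then have "fact m * exp (norm x + r * norm x - t * (x \<bullet> x)) \<le> fact m * exp (r'\<^sup>2 / (2 * t) - t / 2 * (x \<bullet> x))"
    by (intro mult_left_mono) auto
  moreover have "norm x ^ m * exp (r * norm x) * exp (- t * (x \<bullet> x)) \<le>
      (fact m * exp (norm x)) * exp (r * norm x) * exp (- t * (x \<bullet> x))"
    by (intro mult_right_mono power_le_fact_exp) auto
  moreover have "(fact m * exp (norm x)) * exp (r * norm x) * exp (- t * (x \<bullet> x)) =
      fact m * exp (norm x + r * norm x - t * (x \<bullet> x))"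
    "fact m * exp (r'\<^sup>2 / (2 * t)) * exp (- (t / 2) * (x \<bullet> x)) = fact m * exp (r'\<^sup>2 / (2 * t) - t / 2 * (x \<bullet> x))"
    by (simp_all only: mult.assoc mult_exp_exp) (simp_all add: algebra_simps)
  ultimately show "norm x ^ m * exp (r * norm x) * exp (- t * (x \<bullet> x)) \<le>
      fact m * exp (r'\<^sup>2 / (2 * t)) * exp (- (t / 2) * (x \<bullet> x))"
    by linarith
qed auto

lemma has_sum_finite_sum:
  fixes f :: "'i \<Rightarrow> 'a \<Rightarrow> 'b::topological_comm_monoid_add"
  assumes "finite I" "\<And>i. i \<in> I \<Longrightarrow> (f i has_sum S i) A"
  shows "((\<lambda>x. \<Sum>i\<in>I. f i x) has_sum (\<Sum>i\<in>I. S i)) A"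
  using assms by (induction I rule: finite_induct) (auto intro!: has_sum_add)

text \<open>A linear combination, with coefficients \<open>\<epsilon> j\<close>, of the functions \<open>(x \<bullet> \<alpha> j)^k\<close> for unit
  vectors \<open>\<alpha> j\<close>. If it is orthogonal to lower degrees, its \<open>k\<close>-th power sum plays the role of a
  harmonic polynomial of degree \<open>k\<close>.\<close>

locale lattice_moments =
  fixes L :: "(real ^ 'n::finite) set" and J :: "'j set" and \<epsilon> :: "'j \<Rightarrow> real" and \<alpha> :: "'j \<Rightarrow> real ^ 'n"
  assumes unimodular: "unimodular_lattice L" and finite_J: "finite J"
    and unit: "\<And>j. j \<in> J \<Longrightarrow> norm (\<alpha> j) = 1"
begin

definition power_sum :: "nat \<Rightarrow> real ^ 'n \<Rightarrow> real" where
  "power_sum k x = (\<Sum>j\<in>J. \<epsilon> j * (x \<bullet> \<alpha> j) ^ k)"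

definition moment :: "nat \<Rightarrow> real \<Rightarrow> real" where
  "moment k t = (\<Sum>\<^sub>\<infinity>x\<in>L. power_sum k x * exp (- t * (x \<bullet> x)))"

definition total_weight where "total_weight = (\<Sum>j\<in>J. \<bar>\<epsilon> j\<bar>)"

lemma abs_inner_le: "j \<in> J \<Longrightarrow> \<bar>x \<bullet> \<alpha> j\<bar> \<le> norm x"
  using Cauchy_Schwarz_ineq2[of x "\<alpha> j"] unit by simp

lemma abs_power_sum_le: "\<bar>power_sum k x\<bar> \<le> total_weight * norm x ^ k"
proof -
  have "\<bar>power_sum k x\<bar> \<le> (\<Sum>j\<in>J. \<bar>\<epsilon> j\<bar> * norm x ^ k)"
    unfolding power_sum_def
    by (rule order_trans[OF sum_abs])
       (auto intro!: sum_mono mult_left_mono power_mono simp: abs_mult power_abs abs_inner_le)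
  then show ?thesis by (simp add: total_weight_def sum_distrib_right)
qed

lemma moment_abs_summable:
  assumes "t > 0"
  shows "(\<lambda>x. norm (power_sum k x * exp (- t * (x \<bullet> x)))) summable_on L"
proof (rule summable_on_comparison_test)
  show "(\<lambda>x. total_weight * (norm x ^ k * exp (0 * norm x) * exp (- t * (x \<bullet> x)))) summable_on L"
    by (intro summable_on_cmult_right gaussian_moment_summable unimodular assms)
  show "norm (power_sum k x * exp (- t * (x \<bullet> x))) \<le> total_weight * (norm x ^ k * exp (0 * norm x) * exp (- t * (x \<bullet> x)))" for x
    using mult_right_mono[OF abs_power_sum_le[of k x], of "exp (- t * (x \<bullet> x))"] by (simp add: abs_mult mult.assoc)
qed auto

lemma moment_has_sum:
  assumes "t > 0"
  shows "((\<lambda>x. power_sum k x * exp (- t * (x \<bullet> x))) has_sum moment k t) L"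
  unfolding moment_def
  by (rule has_sum_infsum, rule abs_summable_summable, rule moment_abs_summable[OF assms])

lemma odd_moment:
  assumes "odd k"
  shows "moment k t = 0"
proof -
  have "moment k t = (\<Sum>\<^sub>\<infinity>x\<in>L. power_sum k (- x) * exp (- t * (- x \<bullet> - x)))"
    unfolding moment_def
    by (rule infsum_reindex_bij_betw[symmetric, of uminus L L "\<lambda>x. power_sum k x * exp (- t * (x \<bullet> x))"])
       (rule bij_betwI[of _ _ _ uminus]; use unimodular_lattice_minus[OF unimodular] in auto)
  also have "\<dots> = (\<Sum>\<^sub>\<infinity>x\<in>L. - (power_sum k x * exp (- t * (x \<bullet> x))))"
    using assms by (intro infsum_cong) (simp add: power_sum_def sum_negf)
  also have "\<dots> = - moment k t" by (simp add: moment_def infsum_uminus)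
  finally show ?thesis by simp
qed

text \<open>The generating function of the moments: the coefficient of \<open>s^i\<close> is \<open>w^i / fact i\<close> times the
  \<open>i\<close>-th moment.\<close>

definition moment_gf :: "real \<Rightarrow> complex \<Rightarrow> real \<Rightarrow> complex" where
  "moment_gf t w s = (\<Sum>\<^sub>\<infinity>x\<in>L. (\<Sum>j\<in>J. of_real (\<epsilon> j) * exp (w * of_real s * of_real (x \<bullet> \<alpha> j))) * of_real (exp (- t * (x \<bullet> x))))"

lemma moment_gf_term_bound:
  fixes w :: complex
  assumes "\<bar>s\<bar> \<le> 1"
  shows "norm ((\<Sum>j\<in>J. of_real (\<epsilon> j) * (exp (w * of_real s * of_real (x \<bullet> \<alpha> j)) -
            (\<Sum>i\<le>k. (w * of_real s * of_real (x \<bullet> \<alpha> j)) ^ i / fact i))) * of_real (exp (- t * (x \<bullet> x)))) \<le>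
     \<bar>s\<bar> ^ Suc k * (total_weight * norm w ^ Suc k * (norm x ^ Suc k * exp (norm w * norm x) * exp (- t * (x \<bullet> x))))"
proof -
  have "norm (exp u - (\<Sum>i\<le>k. u ^ i / fact i)) \<le> \<bar>s\<bar> ^ Suc k * norm w ^ Suc k * norm x ^ Suc k * exp (norm w * norm x)"
    if j: "j \<in> J" and u: "u = w * of_real s * of_real (x \<bullet> \<alpha> j)" for j u
  proof -
    have "norm u = \<bar>s\<bar> * norm w * \<bar>x \<bullet> \<alpha> j\<bar>"
      unfolding u by (simp only: norm_mult norm_of_real mult_ac)
    also have "\<dots> \<le> \<bar>s\<bar> * norm w * norm x"
      by (intro mult_left_mono abs_inner_le j) auto
    finally have nu: "norm u \<le> \<bar>s\<bar> * norm w * norm x" .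
    also have "\<dots> \<le> 1 * norm w * norm x"
      using assms by (intro mult_right_mono) auto
    finally have nu': "norm u \<le> norm w * norm x" by simp
    have "norm (exp u - (\<Sum>i\<le>k. u ^ i / fact i)) \<le> exp \<bar>Re u\<bar> * norm u ^ Suc k / fact k"
      by (rule Taylor_exp)
    also have "\<dots> \<le> exp \<bar>Re u\<bar> * norm u ^ Suc k"
      by (intro divide_left_mono[of 1 _ _, simplified] mult_nonneg_nonneg) (auto simp: fact_ge_1)
    also have "\<dots> \<le> exp (norm w * norm x) * (\<bar>s\<bar> * norm w * norm x) ^ Suc k"
      using nu nu' abs_Re_le_cmod[of u] by (intro mult_mono power_mono) auto
    finally show ?thesis by (simp add: power_mult_distrib mult_ac)
  qed
  then have "norm (\<Sum>j\<in>J. of_real (\<epsilon> j) * (exp (w * of_real s * of_real (x \<bullet> \<alpha> j)) -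
            (\<Sum>i\<le>k. (w * of_real s * of_real (x \<bullet> \<alpha> j)) ^ i / fact i))) \<le>
      (\<Sum>j\<in>J. \<bar>\<epsilon> j\<bar> * (\<bar>s\<bar> ^ Suc k * norm w ^ Suc k * norm x ^ Suc k * exp (norm w * norm x)))"
    by (intro order_trans[OF norm_sum] sum_mono) (auto simp: norm_mult intro!: mult_left_mono)
  also have "\<dots> = total_weight * (\<bar>s\<bar> ^ Suc k * norm w ^ Suc k * norm x ^ Suc k * exp (norm w * norm x))"
    by (simp only: total_weight_def sum_distrib_right)
  finally have "norm (\<Sum>j\<in>J. of_real (\<epsilon> j) * (exp (w * of_real s * of_real (x \<bullet> \<alpha> j)) -
            (\<Sum>i\<le>k. (w * of_real s * of_real (x \<bullet> \<alpha> j)) ^ i / fact i))) * exp (- t * (x \<bullet> x)) \<le>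
      total_weight * (\<bar>s\<bar> ^ Suc k * norm w ^ Suc k * norm x ^ Suc k * exp (norm w * norm x)) * exp (- t * (x \<bullet> x))"
    by (rule mult_right_mono) simp
  then show ?thesis by (simp only: norm_mult norm_of_real abs_exp_cancel mult_ac)
qed

lemma moment_gf_taylor:
  assumes t: "t > 0"
  obtains K where "\<And>s. \<bar>s\<bar> \<le> 1 \<Longrightarrow>
    norm (moment_gf t w s - (\<Sum>i\<le>k. (w * of_real s) ^ i / fact i * of_real (moment i t))) \<le> K * \<bar>s\<bar> ^ Suc k"
proof -
  let ?B = "\<lambda>x. total_weight * norm w ^ Suc k * (norm x ^ Suc k * exp (norm w * norm x) * exp (- t * (x \<bullet> x)))"
  have B: "?B summable_on L"
    by (intro summable_on_cmult_right gaussian_moment_summable unimodular t)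
  have "norm (moment_gf t w s - (\<Sum>i\<le>k. (w * of_real s) ^ i / fact i * of_real (moment i t))) \<le> infsum ?B L * \<bar>s\<bar> ^ Suc k"
    if s: "\<bar>s\<bar> \<le> 1" for s
  proof -
    let ?D = "\<lambda>x. (\<Sum>j\<in>J. of_real (\<epsilon> j) * (exp (w * of_real s * of_real (x \<bullet> \<alpha> j)) -
            (\<Sum>i\<le>k. (w * of_real s * of_real (x \<bullet> \<alpha> j)) ^ i / fact i))) * complex_of_real (exp (- t * (x \<bullet> x)))"
    let ?P = "\<lambda>x. \<Sum>i\<le>k. (w * of_real s) ^ i / fact i * complex_of_real (power_sum i x * exp (- t * (x \<bullet> x)))"
    have sB: "(\<lambda>x. \<bar>s\<bar> ^ Suc k * ?B x) summable_on L"
      by (intro summable_on_cmult_right B)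
    have "(\<lambda>x. norm (?D x)) summable_on L"
      by (rule summable_on_comparison_test[OF sB moment_gf_term_bound[OF s]]) auto
    then have D: "?D summable_on L" by (rule abs_summable_summable)
    have P: "(?P has_sum (\<Sum>i\<le>k. (w * of_real s) ^ i / fact i * of_real (moment i t))) L"
      by (intro has_sum_finite_sum finite_atMost has_sum_cmult_right has_sum_of_real moment_has_sum t)
    have split: "(\<Sum>j\<in>J. of_real (\<epsilon> j) * exp (w * of_real s * of_real (x \<bullet> \<alpha> j))) * of_real (exp (- t * (x \<bullet> x))) = ?D x + ?P x" for x
    proof -
      have "(\<Sum>j\<in>J. of_real (\<epsilon> j) * (\<Sum>i\<le>k. (w * of_real s * of_real (x \<bullet> \<alpha> j)) ^ i / fact i)) =
          (\<Sum>i\<le>k. (w * of_real s) ^ i / fact i * complex_of_real (power_sum i x))"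
        unfolding power_sum_def of_real_sum sum_distrib_left
        by (subst sum.swap) (simp add: power_mult_distrib mult_ac)
      then show ?thesis
        by (simp add: right_diff_distrib sum_subtractf left_diff_distrib sum_distrib_right mult.assoc)
    qed
    have "moment_gf t w s = infsum ?D L + (\<Sum>i\<le>k. (w * of_real s) ^ i / fact i * of_real (moment i t))"
      unfolding moment_gf_def split
      by (simp only: infsum_add[OF D has_sum_imp_summable[OF P]] infsumI[OF P])
    then have "moment_gf t w s - (\<Sum>i\<le>k. (w * of_real s) ^ i / fact i * of_real (moment i t)) = infsum ?D L"
      by simp
    moreover have "norm (infsum ?D L) \<le> (\<Sum>\<^sub>\<infinity>x\<in>L. \<bar>s\<bar> ^ Suc k * ?B x)"
      by (rule norm_infsum_le[OF has_sum_infsum[OF D] has_sum_infsum[OF sB] moment_gf_term_bound[OF s]])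
    moreover have "(\<Sum>\<^sub>\<infinity>x\<in>L. \<bar>s\<bar> ^ Suc k * ?B x) = \<bar>s\<bar> ^ Suc k * infsum ?B L"
      by (rule infsum_cmult_right'[of "\<bar>s\<bar> ^ Suc k" ?B L])
    ultimately show ?thesis by (simp only: mult.commute)
  qed
  then show ?thesis using that by blast
qed

text \<open>When the lower moments vanish, the Taylor expansion of the generating function starts with
  the \<open>k\<close>-th moment.\<close>

lemma moment_gf_limit:
  assumes t: "t > 0" and "\<And>i. i < k \<Longrightarrow> moment i t = 0"
  shows "((\<lambda>s. moment_gf t w s / of_real s ^ k) \<longlongrightarrow> w ^ k / fact k * of_real (moment k t)) (at 0)"
proof -
  obtain K where K: "\<And>s. \<bar>s\<bar> \<le> 1 \<Longrightarrow>
    norm (moment_gf t w s - (\<Sum>i\<le>k. (w * of_real s) ^ i / fact i * of_real (moment i t))) \<le> K * \<bar>s\<bar> ^ Suc k"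
    by (rule moment_gf_taylor[OF t]) blast
  have sum: "(\<Sum>i\<le>k. (w * of_real s) ^ i / fact i * of_real (moment i t)) = (w * of_real s) ^ k / fact k * of_real (moment k t)" for s
    by (subst sum.mono_neutral_right[of _ "{k}"]) (use assms(2) in auto)
  have "\<forall>\<^sub>F s in at 0. norm (moment_gf t w s / of_real s ^ k - w ^ k / fact k * of_real (moment k t)) \<le> K * \<bar>s\<bar>"
  proof -
    have "\<forall>\<^sub>F s :: real in at 0. s \<noteq> 0 \<and> dist s 0 < 1"
      unfolding eventually_at by (intro exI[of _ 1]) auto
    then show ?thesis
    proof eventually_elim
      case (elim s)
      have "norm (moment_gf t w s / of_real s ^ k - w ^ k / fact k * of_real (moment k t)) * \<bar>s\<bar> ^ k =
          norm ((moment_gf t w s / of_real s ^ k - w ^ k / fact k * of_real (moment k t)) * of_real s ^ k)"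
        by (simp add: norm_mult norm_power)
      also have "\<dots> = norm (moment_gf t w s - (w * of_real s) ^ k / fact k * of_real (moment k t))"
        using elim by (simp add: power_mult_distrib algebra_simps)
      also have "\<dots> \<le> K * \<bar>s\<bar> * \<bar>s\<bar> ^ k"
        using K[of s] elim unfolding sum by (simp add: dist_real_def mult.assoc)
      finally show ?case using elim by (simp add: mult_le_cancel_right)
    qed
  qed
  moreover have "((\<lambda>s::real. K * \<bar>s\<bar>) \<longlongrightarrow> K * \<bar>0\<bar>) (at 0)"
    by (intro tendsto_intros)
  then have "((\<lambda>s::real. K * \<bar>s\<bar>) \<longlongrightarrow> 0) (at 0)" by simp
  ultimately have "((\<lambda>s. moment_gf t w s / of_real s ^ k - w ^ k / fact k * of_real (moment k t)) \<longlongrightarrow> 0) (at 0)"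
    by (rule Lim_null_comparison)
  then show ?thesis by (simp add: LIM_zero_iff)
qed

text \<open>Poisson summation for the Gaussian centred at \<open>s \<alpha>_j\<close>. Since all \<open>\<alpha>_j\<close> are unit vectors, the
  factor \<open>e^(-\<pi> t s^2)\<close> is common to all \<open>j\<close>.\<close>

lemma moment_gf_poisson:
  assumes t: "t > 0"
  shows "of_real (exp (- pi * t * s\<^sup>2)) * moment_gf (pi * t) (of_real (- 2 * pi * t)) s =
     of_real (1 / sqrt t ^ CARD('n)) * moment_gf (pi / t) (2 * pi * \<i>) s"
proof -
  have sum_exp: "(\<lambda>x. of_real (\<epsilon> j) * exp (w * of_real s * of_real (x \<bullet> \<alpha> j)) * complex_of_real (exp (- u * (x \<bullet> x)))) summable_on L"
    if j: "j \<in> J" and u: "u > 0" for j w u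
  proof (rule abs_summable_summable, rule summable_on_comparison_test)
    show "(\<lambda>x. \<bar>\<epsilon> j\<bar> * (norm x ^ 0 * exp (norm w * \<bar>s\<bar> * norm x) * exp (- u * (x \<bullet> x)))) summable_on L"
      by (intro summable_on_cmult_right gaussian_moment_summable unimodular u)
    fix x :: "real ^ 'n"
    have "Re (w * of_real s * of_real (x \<bullet> \<alpha> j)) \<le> norm (w * of_real s * of_real (x \<bullet> \<alpha> j))"
      by (rule complex_Re_le_cmod)
    also have "\<dots> \<le> norm w * \<bar>s\<bar> * norm x"
      unfolding norm_mult norm_of_real by (intro mult_left_mono abs_inner_le j) auto
    finally have "norm (exp (w * of_real s * of_real (x \<bullet> \<alpha> j))) \<le> exp (norm w * \<bar>s\<bar> * norm x)"
      by (simp only: norm_exp_eq_Re exp_le_cancel_iff)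
    then have "\<bar>\<epsilon> j\<bar> * (norm (exp (w * of_real s * of_real (x \<bullet> \<alpha> j))) * exp (- u * (x \<bullet> x))) \<le>
        \<bar>\<epsilon> j\<bar> * (exp (norm w * \<bar>s\<bar> * norm x) * exp (- u * (x \<bullet> x)))"
      by (intro mult_left_mono mult_right_mono) auto
    then show "norm (of_real (\<epsilon> j) * exp (w * of_real s * of_real (x \<bullet> \<alpha> j)) * complex_of_real (exp (- u * (x \<bullet> x)))) \<le>
       \<bar>\<epsilon> j\<bar> * (norm x ^ 0 * exp (norm w * \<bar>s\<bar> * norm x) * exp (- u * (x \<bullet> x)))"
      by (simp only: norm_mult norm_of_real abs_exp_cancel power_0 mult_1_left mult.assoc)
  qed auto
  have swap: "moment_gf u w s = (\<Sum>j\<in>J. of_real (\<epsilon> j) * (\<Sum>\<^sub>\<infinity>x\<in>L. exp (w * of_real s * of_real (x \<bullet> \<alpha> j)) * of_real (exp (- u * (x \<bullet> x)))))"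
    if u: "u > 0" for u w
  proof -
    have "moment_gf u w s = (\<Sum>j\<in>J. \<Sum>\<^sub>\<infinity>x\<in>L. of_real (\<epsilon> j) * exp (w * of_real s * of_real (x \<bullet> \<alpha> j)) * of_real (exp (- u * (x \<bullet> x))))"
      unfolding moment_gf_def sum_distrib_right
      by (intro infsumI has_sum_finite_sum has_sum_infsum sum_exp u finite_J)
    then show ?thesis by (simp add: mult.assoc infsum_cmult_right')
  qed
  have single: "of_real (exp (- pi * t * s\<^sup>2)) * (\<Sum>\<^sub>\<infinity>x\<in>L. exp (of_real (- 2 * pi * t) * of_real s * of_real (x \<bullet> \<alpha> j)) * of_real (exp (- (pi * t) * (x \<bullet> x)))) =
     of_real (1 / sqrt t ^ CARD('n)) * (\<Sum>\<^sub>\<infinity>x\<in>L. exp (2 * pi * \<i> * of_real s * of_real (x \<bullet> \<alpha> j)) * of_real (exp (- (pi / t) * (x \<bullet> x))))"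
    if j: "j \<in> J" for j
  proof -
    let ?v = "s *\<^sub>R \<alpha> j"
    have aa: "\<alpha> j \<bullet> \<alpha> j = 1" using unit[OF j] by (simp add: dot_square_norm)
    have "exp (- pi * t * ((?v + x) \<bullet> (?v + x))) =
        exp (- pi * t * s\<^sup>2) * (exp (- 2 * pi * t * s * (x \<bullet> \<alpha> j)) * exp (- (pi * t) * (x \<bullet> x)))" for x
      unfolding exp_add[symmetric]
      by (simp add: inner_add_left inner_add_right aa inner_commute power2_eq_square algebra_simps)
    then have l: "(\<Sum>\<^sub>\<infinity>x\<in>L. exp (- pi * t * ((?v + x) \<bullet> (?v + x)))) =
        exp (- pi * t * s\<^sup>2) * (\<Sum>\<^sub>\<infinity>x\<in>L. exp (- 2 * pi * t * s * (x \<bullet> \<alpha> j)) * exp (- (pi * t) * (x \<bullet> x)))"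
      by (simp only: infsum_cmult_right')
    have "(\<lambda>x. exp (- 2 * pi * t * s * (x \<bullet> \<alpha> j)) * exp (- (pi * t) * (x \<bullet> x))) summable_on L"
    proof (rule summable_on_comparison_test)
      show "(\<lambda>x. norm x ^ 0 * exp (2 * pi * t * \<bar>s\<bar> * norm x) * exp (- (pi * t) * (x \<bullet> x))) summable_on L"
        by (intro gaussian_moment_summable unimodular) (use t in auto)
      fix x :: "real ^ 'n"
      have "- 2 * pi * t * s * (x \<bullet> \<alpha> j) \<le> \<bar>- 2 * pi * t * s * (x \<bullet> \<alpha> j)\<bar>" by (rule abs_ge_self)
      also have "\<dots> = 2 * pi * t * \<bar>s\<bar> * \<bar>x \<bullet> \<alpha> j\<bar>" using t by (simp add: abs_mult)
      also have "\<dots> \<le> 2 * pi * t * \<bar>s\<bar> * norm x"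
        using t by (intro mult_left_mono abs_inner_le j) auto
      finally have "exp (- 2 * pi * t * s * (x \<bullet> \<alpha> j)) \<le> exp (2 * pi * t * \<bar>s\<bar> * norm x)"
        unfolding exp_le_cancel_iff .
      then show "exp (- 2 * pi * t * s * (x \<bullet> \<alpha> j)) * exp (- (pi * t) * (x \<bullet> x)) \<le>
          norm x ^ 0 * exp (2 * pi * t * \<bar>s\<bar> * norm x) * exp (- (pi * t) * (x \<bullet> x))"
        unfolding power_0 mult_1_left by (rule mult_right_mono) simp
    qed auto
    then have l2: "of_real (\<Sum>\<^sub>\<infinity>x\<in>L. exp (- 2 * pi * t * s * (x \<bullet> \<alpha> j)) * exp (- (pi * t) * (x \<bullet> x))) =
       (\<Sum>\<^sub>\<infinity>x\<in>L. complex_of_real (exp (- 2 * pi * t * s * (x \<bullet> \<alpha> j)) * exp (- (pi * t) * (x \<bullet> x))))"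
      by (intro infsumI[symmetric] has_sum_of_real has_sum_infsum)
    have term_eq: "complex_of_real (exp (- 2 * pi * t * s * (x \<bullet> \<alpha> j)) * exp (- (pi * t) * (x \<bullet> x))) =
        exp (of_real (- 2 * pi * t) * of_real s * of_real (x \<bullet> \<alpha> j)) * of_real (exp (- (pi * t) * (x \<bullet> x)))" for x
      by (simp flip: exp_of_real)
    have r: "(\<Sum>\<^sub>\<infinity>y\<in>L. of_real (exp (- pi * (y \<bullet> y) / t)) * cis (2 * pi * (y \<bullet> ?v))) =
        (\<Sum>\<^sub>\<infinity>x\<in>L. exp (2 * pi * \<i> * of_real s * of_real (x \<bullet> \<alpha> j)) * of_real (exp (- (pi / t) * (x \<bullet> x))))"
      by (intro infsum_cong) (simp add: cis_conv_exp mult_ac)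
    show ?thesis
      using poisson_unimodular_lattice[OF unimodular t, of ?v]
      unfolding l r of_real_mult[of "exp (- pi * t * s\<^sup>2)"] l2 term_eq .
  qed
  have "pi * t > 0" "pi / t > 0" using t by auto
  then show ?thesis
    unfolding swap[OF \<open>pi * t > 0\<close>] swap[OF \<open>pi / t > 0\<close>] sum_distrib_left
    using single by (intro sum.cong refl) (simp only: mult.left_commute[of _ "complex_of_real (\<epsilon> _)"])
qed

text \<open>The leading coefficients at \<open>s = 0\<close> of the two sides of \<open>moment_gf_poisson\<close>. Vanishing of
  the lower moments replaces harmonicity of the \<open>k\<close>-th power sum.\<close>

lemma moment_functional_equation:
  assumes t: "t > 0" and zero: "\<And>i u. i < k \<Longrightarrow> u > 0 \<Longrightarrow> moment i u = 0"
  shows "\<i> ^ k * of_real (moment k (pi / t)) = of_real (sqrt t ^ CARD('n) * (- t) ^ k * moment k (pi * t))"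
proof -
  let ?c = "complex_of_real (1 / sqrt t ^ CARD('n))"
  have "((\<lambda>s. of_real (exp (- pi * t * s\<^sup>2)) * (moment_gf (pi * t) (of_real (- 2 * pi * t)) s / of_real s ^ k)) \<longlongrightarrow>
      of_real (exp (- pi * t * 0\<^sup>2)) * (of_real (- 2 * pi * t) ^ k / fact k * of_real (moment k (pi * t)))) (at 0)"
    by (intro tendsto_intros moment_gf_limit zero) (use t in auto)
  moreover have "((\<lambda>s. ?c * (moment_gf (pi / t) (2 * pi * \<i>) s / of_real s ^ k)) \<longlongrightarrow>
      ?c * ((2 * pi * \<i>) ^ k / fact k * of_real (moment k (pi / t)))) (at 0)"
    by (intro tendsto_intros moment_gf_limit zero) (use t in auto)
  moreover have "(\<lambda>s. of_real (exp (- pi * t * s\<^sup>2)) * (moment_gf (pi * t) (of_real (- 2 * pi * t)) s / of_real s ^ k)) =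
      (\<lambda>s. ?c * (moment_gf (pi / t) (2 * pi * \<i>) s / of_real s ^ k))"
    using moment_gf_poisson[OF t] by (simp only: times_divide_eq_right)
  ultimately have "of_real (exp (- pi * t * 0\<^sup>2)) * (of_real (- 2 * pi * t) ^ k / fact k * of_real (moment k (pi * t))) =
      ?c * ((2 * pi * \<i>) ^ k / fact k * of_real (moment k (pi / t)))"
    using tendsto_unique[of "at (0 :: real)"] by (metis (no_types, lifting) trivial_limit_at)
  then have eq: "of_real (- 2 * pi * t) ^ k * of_real (moment k (pi * t)) =
      ?c * ((2 * pi * \<i>) ^ k * of_real (moment k (pi / t)))"
    by (simp add: field_simps)
  have "complex_of_real (- 2 * pi * t) ^ k = complex_of_real (2 * pi) ^ k * of_real ((- t) ^ k)"
  proof -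
    have "- 2 * pi * t = (2 * pi) * (- t)" by simp
    then show ?thesis by (simp only: of_real_mult[of "2 * pi"] power_mult_distrib of_real_power)
  qed
  moreover have "(complex_of_real (2 * pi) * \<i>) ^ k = complex_of_real (2 * pi) ^ k * \<i> ^ k"
    by (rule power_mult_distrib)
  ultimately have "complex_of_real (2 * pi) ^ k * (of_real ((- t) ^ k) * of_real (moment k (pi * t))) =
      complex_of_real (2 * pi) ^ k * (?c * (\<i> ^ k * complex_of_real (moment k (pi / t))))"
    using eq by (simp only: mult_ac)
  moreover have "complex_of_real (2 * pi) ^ k \<noteq> 0" by simp
  ultimately have "of_real ((- t) ^ k) * of_real (moment k (pi * t)) = ?c * (\<i> ^ k * complex_of_real (moment k (pi / t)))"
    by (simp only: mult_cancel_left simp_thms)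
  then show ?thesis using t by (simp add: field_simps)
qed

definition harmonic_theta :: "nat \<Rightarrow> complex \<Rightarrow> complex" where
  "harmonic_theta k = exp_series L (\<lambda>x. of_real (power_sum k x)) (\<lambda>x. x \<bullet> x)"

lemma harmonic_theta_summable: "exp_series_summable L (\<lambda>x. of_real (power_sum k x)) (\<lambda>x. x \<bullet> x)"
  unfolding exp_series_summable_def
proof (intro conjI ballI allI impI)
  fix t :: real assume "t > 0"
  then have "(\<lambda>x. norm (power_sum k x * exp (- (pi * t) * (x \<bullet> x)))) summable_on L"
    using moment_abs_summable[of "pi * t" k] by simp
  then show "(\<lambda>x. norm (complex_of_real (power_sum k x)) * exp (- pi * t * (x \<bullet> x))) summable_on L"
    by (simp add: abs_mult)
qed simp

lemma harmonic_theta_imaginary: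
  assumes "t > 0"
  shows "harmonic_theta k (\<i> * of_real t) = of_real (moment k (pi * t))"
proof -
  have "((\<lambda>x. complex_of_real (power_sum k x * exp (- (pi * t) * (x \<bullet> x)))) has_sum of_real (moment k (pi * t))) L"
    by (intro has_sum_of_real moment_has_sum) (use assms in auto)
  from infsumI[OF this] show ?thesis
    unfolding harmonic_theta_def exp_series_def exp_imaginary_axis by simp
qed

text \<open>Evenness of the lattice gives the period \<open>1\<close>; the functional equation of the moments gives
  the inversion on the imaginary axis, hence everywhere.\<close>

lemma modular_harmonic_theta:
  assumes n: "CARD('n) = 8 * m" and k: "even k"
    and even: "even_lattice L" and zero: "\<And>i u. i < k \<Longrightarrow> u > 0 \<Longrightarrow> moment i u = 0"
  shows "modular (4 * int m + int k) (harmonic_theta k)"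
  unfolding modular_def
proof (intro conjI allI impI)
  show hol: "harmonic_theta k holomorphic_on upper_half_plane"
    unfolding harmonic_theta_def by (rule exp_series_holomorphic[OF harmonic_theta_summable])
  fix z assume z: "Im z > 0"
  show "harmonic_theta k (z + 1) = harmonic_theta k z"
    unfolding harmonic_theta_def exp_series_def
  proof (rule infsum_cong)
    fix x assume "x \<in> L"
    then obtain a :: int where "x \<bullet> x = 2 * of_int a"
      using even by (auto simp: even_lattice_def)
    then have "exp (\<i> * of_real (pi * (x \<bullet> x))) = 1"
      using exp_pi_int[of "2 * a"] by simp
    then show "of_real (power_sum k x) * exp (\<i> * of_real (pi * (x \<bullet> x)) * (z + 1)) =
        of_real (power_sum k x) * exp (\<i> * of_real (pi * (x \<bullet> x)) * z)"
      by (simp only: distrib_left exp_add mult_1_right)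
  qed
  have "harmonic_theta k (- (1 / z)) - z ^ (4 * m + k) * harmonic_theta k z = 0"
  proof (rule upper_half_plane_identity[of "\<lambda>z. harmonic_theta k (- (1 / z)) - z ^ (4 * m + k) * harmonic_theta k z", OF _ _ z])
    show "(\<lambda>z. harmonic_theta k (- (1 / z)) - z ^ (4 * m + k) * harmonic_theta k z) holomorphic_on upper_half_plane"
      by (intro holomorphic_intros holomorphic_neg_inverse_comp hol)
    fix t :: real assume t: "t > 0"
    have "sqrt t ^ (8 * m) = (sqrt t ^ 2) ^ (4 * m)"
      by (simp flip: power_mult)
    also have "\<dots> = t ^ (4 * m)" using t by simp
    finally have eq: "\<i> ^ k * of_real (moment k (pi / t)) = of_real (t ^ (4 * m + k) * moment k (pi * t))"
      using moment_functional_equation[of t k, OF t zero] k n by (simp add: power_add power_minus_even)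
    have ik: "\<i> ^ k * \<i> ^ k = 1"
      using k by (auto elim!: evenE simp: power_mult simp flip: power_mult_distrib)
    have i4: "\<i> ^ (4 * m) = 1" by (simp add: power_mult)
    have "of_real (moment k (pi / t)) = \<i> ^ k * (\<i> ^ k * complex_of_real (moment k (pi / t)))"
      using ik by (simp flip: mult.assoc)
    also have "\<dots> = (\<i> * of_real t) ^ (4 * m + k) * of_real (moment k (pi * t))"
      unfolding eq power_mult_distrib power_add i4 by simp
    finally have "of_real (moment k (pi * (1 / t))) = (\<i> * of_real t) ^ (4 * m + k) * complex_of_real (moment k (pi * t))"
      by simp
    then show "harmonic_theta k (- (1 / (\<i> * of_real t))) - (\<i> * of_real t) ^ (4 * m + k) * harmonic_theta k (\<i> * of_real t) = 0"
      using t by (simp only: neg_inverse_imaginary harmonic_theta_imaginary zero_less_divide_1_iff diff_self)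
  qed
  moreover have "4 * int m + int k = int (4 * m + k)" by simp
  ultimately show "harmonic_theta k (- (1 / z)) = z powi (4 * int m + int k) * harmonic_theta k z"
    by (simp only: power_int_of_nat) simp
qed

end

text \<open>Each vector of the ball contributes at least \<open>e^(-K)\<close> to a convergent sum.\<close>

lemma finite_lattice_ball:
  assumes "unimodular_lattice L"
  shows "finite {x \<in> L. x \<bullet> x \<le> K}"
proof (rule ccontr)
  assume inf: "infinite {x \<in> L. x \<bullet> x \<le> K}"
  have sum: "(\<lambda>x. exp (- 1 * (x \<bullet> x))) summable_on L"
    by (rule unimodular_gaussian_summable[OF assms]) simp
  define S where "S = (\<Sum>\<^sub>\<infinity>x\<in>L. exp (- 1 * (x \<bullet> x)))"
  obtain N :: nat where N: "S * exp K < of_nat N" using reals_Archimedean2 by blast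
  obtain F where F: "finite F" "card F = N" "F \<subseteq> {x \<in> L. x \<bullet> x \<le> K}"
    using infinite_arbitrarily_large[OF inf, of N] by blast
  have "of_nat N * exp (- K) = (\<Sum>x\<in>F. exp (- K))" using F by simp
  also have "\<dots> \<le> (\<Sum>x\<in>F. exp (- 1 * (x \<bullet> x)))" using F by (intro sum_mono) auto
  also have "\<dots> \<le> S" unfolding S_def by (rule finite_sum_le_infsum[OF sum]) (use F in auto)
  finally have "of_nat N \<le> S * exp K" by (simp add: exp_minus field_simps)
  with N show False by simp
qed

text \<open>The norms below \<open>24\<close> are \<open>0\<close>, \<open>20\<close> and \<open>22\<close>, and the zero vector has weight \<open>0\<close>; so the
  theta series starts with the sums over the shells of norm \<open>20\<close> and \<open>22\<close>.\<close>

lemma (in lattice_moments) shell_sum_vanishes: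
  assumes n: "CARD('n) = 240" and k: "k = 2 \<or> k = 4"
    and even: "even_lattice L" and min: "has_minimum_norm L 20"
    and zero: "\<And>i u. i < k \<Longrightarrow> u > 0 \<Longrightarrow> moment i u = 0"
  shows "(\<Sum>x\<in>shell L 22. power_sum k x) = 0"
proof -
  have norms: "x = 0 \<or> x \<in> shell L 20 \<or> x \<in> shell L 22 \<or> x \<bullet> x \<ge> 24" if x: "x \<in> L" for x
  proof -
    obtain a :: int where a: "x \<bullet> x = 2 * of_int a"
      using even x by (auto simp: even_lattice_def)
    have "x = 0 \<or> 20 \<le> x \<bullet> x" using min x by (auto simp: has_minimum_norm_def)
    moreover have "a = 10 \<or> a = 11 \<or> a \<ge> 12 \<or> x \<bullet> x < 20" unfolding a by linarith
    ultimately show ?thesis using x a unfolding shell_def by auto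
  qed
  have set: "{x. x \<in> L \<and> x \<bullet> x \<le> 22} = {0} \<union> (shell L 20 \<union> shell L 22)"
    using norms unimodular_lattice_zero[OF unimodular] by (force simp: shell_def)
  have fin: "finite {x \<in> L. x \<bullet> x \<le> 22}" by (rule finite_lattice_ball[OF unimodular])
  then have fin': "finite (shell L 20)" "finite (shell L 22)" by (simp_all add: set)
  define a b where "a = complex_of_real (\<Sum>x\<in>shell L 20. power_sum k x)" and "b = complex_of_real (\<Sum>x\<in>shell L 22. power_sum k x)"
  have p0: "power_sum k 0 = 0" using k by (auto simp: power_sum_def)
  have finsum: "(\<Sum>x | x \<in> L \<and> x \<bullet> x \<le> 22. of_real (power_sum k x) * exp (\<i> * of_real (pi * (x \<bullet> x)) * z)) =
      a * nome z ^ 20 + b * nome z ^ 22" for z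
  proof -
    have e: "exp (\<i> * of_real (pi * 20) * z) = nome z ^ 20" "exp (\<i> * of_real (pi * 22) * z) = nome z ^ 22"
      by (simp_all add: nome_power)
    have "(\<Sum>x | x \<in> L \<and> x \<bullet> x \<le> 22. of_real (power_sum k x) * exp (\<i> * of_real (pi * (x \<bullet> x)) * z)) =
      (\<Sum>x\<in>shell L 20 \<union> shell L 22. of_real (power_sum k x) * exp (\<i> * of_real (pi * (x \<bullet> x)) * z))"
      unfolding set using fin' p0 by (intro sum.mono_neutral_right) auto
    also have "\<dots> = (\<Sum>x\<in>shell L 20. of_real (power_sum k x) * exp (\<i> * of_real (pi * (x \<bullet> x)) * z)) +
        (\<Sum>x\<in>shell L 22. of_real (power_sum k x) * exp (\<i> * of_real (pi * (x \<bullet> x)) * z))"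
      using fin' by (intro sum.union_disjoint) (auto simp: shell_def)
    also have "(\<Sum>x\<in>shell L 20. of_real (power_sum k x) * exp (\<i> * of_real (pi * (x \<bullet> x)) * z)) = (\<Sum>x\<in>shell L 20. of_real (power_sum k x) * nome z ^ 20)"
      by (rule sum.cong) (auto simp: shell_def e[symmetric])
    also have "(\<Sum>x\<in>shell L 22. of_real (power_sum k x) * exp (\<i> * of_real (pi * (x \<bullet> x)) * z)) = (\<Sum>x\<in>shell L 22. of_real (power_sum k x) * nome z ^ 22)"
      by (rule sum.cong) (auto simp: shell_def e[symmetric])
    finally show ?thesis by (simp add: a_def b_def sum_distrib_right)
  qed
  have "((\<lambda>z. (harmonic_theta k z - (\<Sum>x | x \<in> L \<and> x \<bullet> x \<le> 22. of_real (power_sum k x) * exp (\<i> * of_real (pi * (x \<bullet> x)) * z)))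
           * exp (- \<i> * of_real (pi * 22) * z)) \<longlongrightarrow> 0) at_cusp"
    unfolding harmonic_theta_def
  proof (rule exp_series_expansion[OF harmonic_theta_summable, of 2])
    show "22 + 2 \<le> x \<bullet> x" if "x \<in> L" "22 < x \<bullet> x" for x
      using norms[OF that(1)] that(2) by (auto simp: shell_def)
  qed (use fin in auto)
  moreover have "(harmonic_theta k z - (a * nome z ^ 20 + b * nome z ^ 22)) * exp (- \<i> * of_real (pi * 22) * z) =
      (harmonic_theta k z / nome z ^ 20 - (a + 0 * nome z + b * nome z ^ 2)) / nome z ^ 2" for z
  proof -
    have e1: "exp (- \<i> * of_real (pi * 22) * z) = 1 / nome z ^ 22"
      by (simp add: nome_power exp_minus field_simps)
    have e2: "nome z ^ 22 = nome z ^ 20 * nome z ^ 2" by (simp flip: power_add)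
    have gen: "(h - (a * u + b * (u * v))) * (1 / (u * v)) = (h / u - (a + 0 * nome z + b * v)) / v"
      if "u \<noteq> 0" "v \<noteq> 0" for h u v :: complex
      using that by (simp add: field_simps)
    show ?thesis unfolding e1 e2 by (rule gen) simp_all
  qed
  ultimately have jet: "jet (\<lambda>z. harmonic_theta k z / nome z ^ 20) a 0 b"
    unfolding finsum jet_def by simp
  have "b = 0"
  proof (cases "k = 2")
    case True
    have "modular (4 * int 30 + int k) (harmonic_theta k)"
      by (rule modular_harmonic_theta) (use n even zero True in auto)
    then show ?thesis using modular_122_coefficient[OF _ jet] True by simp
  next
    case False
    with k have k: "k = 4" by simp
    have "modular (4 * int 30 + int k) (harmonic_theta k)"
      by (rule modular_harmonic_theta) (use n even zero k in auto)
    then show ?thesis using modular_124_coefficient[OF _ jet] k by simp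
  qed
  then show ?thesis unfolding b_def by (simp only: of_real_eq_0_iff)
qed

text \<open>The combination \<open>(x \<bullet> \<alpha>)^k - (x \<bullet> \<beta>)^k\<close> has vanishing moments for \<open>k = 0\<close> trivially and for
  \<open>k = 1\<close> by symmetry.\<close>

theorem shell_quadratic_sums:
  fixes L :: "(real ^ 'n::finite) set" and \<alpha> \<beta> :: "real ^ 'n"
  assumes "CARD('n) = 240" "even_lattice L" "unimodular_lattice L" "has_minimum_norm L 20"
    and "norm \<alpha> = 1" "norm \<beta> = 1"
  shows "(\<Sum>x\<in>shell L 22. (x \<bullet> \<alpha>)\<^sup>2) = (\<Sum>x\<in>shell L 22. (x \<bullet> \<beta>)\<^sup>2)"
proof -
  interpret M: lattice_moments L UNIV "\<lambda>b. if b then 1 else - 1" "\<lambda>b. if b then \<alpha> else \<beta>"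
    using assms by unfold_locales auto
  have p: "M.power_sum k x = (x \<bullet> \<alpha>) ^ k - (x \<bullet> \<beta>) ^ k" for k x
    unfolding M.power_sum_def by (simp add: UNIV_bool)
  have "M.moment i u = 0" if "i < 2" for i u
  proof (cases "i = 0")
    case True
    then show ?thesis by (simp add: M.moment_def p)
  next
    case False
    with that have "odd i" by (cases i) auto
    then show ?thesis by (rule M.odd_moment)
  qed
  then have "(\<Sum>x\<in>shell L 22. M.power_sum 2 x) = 0"
    by (intro M.shell_sum_vanishes assms) auto
  then show ?thesis by (simp add: p sum_subtractf)
qed

text \<open>The hypothesis on the squares makes the second power sum of the combination identically \<open>0\<close>,
  so its first nontrivial moment is the fourth.\<close>

theorem shell_quartic_sums:
  fixes L :: "(real ^ 'n::finite) set" and \<alpha> \<beta> \<gamma> \<delta> :: "real ^ 'n"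
  assumes "CARD('n) = 240" "even_lattice L" "unimodular_lattice L" "has_minimum_norm L 20"
    and "norm \<alpha> = 1" "norm \<beta> = 1" "norm \<gamma> = 1" "norm \<delta> = 1"
    and sq: "\<And>x. (x \<bullet> \<alpha>)\<^sup>2 + (x \<bullet> \<beta>)\<^sup>2 = (x \<bullet> \<gamma>)\<^sup>2 + (x \<bullet> \<delta>)\<^sup>2"
  shows "(\<Sum>x\<in>shell L 22. (x \<bullet> \<alpha>) ^ 4) + (\<Sum>x\<in>shell L 22. (x \<bullet> \<beta>) ^ 4) =
         (\<Sum>x\<in>shell L 22. (x \<bullet> \<gamma>) ^ 4) + (\<Sum>x\<in>shell L 22. (x \<bullet> \<delta>) ^ 4)"
proof -
  interpret M: lattice_moments L UNIV "\<lambda>(a, b). if a then 1 else - 1"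
    "\<lambda>(a, b). if a then (if b then \<alpha> else \<beta>) else (if b then \<gamma> else \<delta>)"
    using assms by unfold_locales auto
  have U: "(UNIV :: (bool \<times> bool) set) = {(True, True), (True, False), (False, True), (False, False)}"
    by auto
  have p: "M.power_sum k x = (x \<bullet> \<alpha>) ^ k + (x \<bullet> \<beta>) ^ k - (x \<bullet> \<gamma>) ^ k - (x \<bullet> \<delta>) ^ k" for k x
    unfolding M.power_sum_def unfolding U by simp
  have "M.moment i u = 0" if "i < 4" for i u
  proof -
    consider "i = 0" | "odd i" | "i = 2"
    proof -
      from \<open>i < 4\<close> have "i = 0 \<or> i = 1 \<or> i = 2 \<or> i = 3" by arith
      then show ?thesis using that by (elim disjE) auto
    qed
    then show ?thesis
    proof cases
      case 2
      then show ?thesis by (rule M.odd_moment)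
    next
      case 3
      then have "M.power_sum i x = 0" for x using sq[of x] by (simp add: p)
      then show ?thesis by (simp add: M.moment_def)
    qed (simp add: M.moment_def p)
  qed
  then have "(\<Sum>x\<in>shell L 22. M.power_sum 4 x) = 0"
    by (intro M.shell_sum_vanishes assms) auto
  then show ?thesis by (simp add: p sum_subtractf sum.distrib)
qed

section \<open>Spherical designs from second and fourth moments\<close>

lemma lborel_orthogonal_transformation:
  fixes T :: "(real, 'n::{finite,wellorder}) vec \<Rightarrow> (real, 'n) vec"
  assumes T: "orthogonal_transformation T"
  shows "distr lborel borel T = lborel"
proof (rule lborel_eqI[symmetric])
  have lin: "linear T" using T by (rule orthogonal_transformation_linear)
  have cont: "continuous_on UNIV T"
    using lin by (intro linear_continuous_on) (simp add: linear_conv_bounded_linear)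
  have [measurable]: "T \<in> borel_measurable borel"
    using cont by (rule borel_measurable_continuous_onI)
  fix l u :: "(real, 'n) vec" assume le: "\<And>b. b \<in> Basis \<Longrightarrow> l \<bullet> b \<le> u \<bullet> b"
  have bij: "bij T" using T by (rule orthogonal_transformation_bij)
  have T': "orthogonal_transformation (inv T)" using T by (rule orthogonal_transformation_inv)
  have pre: "T -` box l u = inv T ` box l u"
    using bij by (simp add: bij_vimage_eq_inv_image)
  have op: "open (T -` box l u)" using open_vimage[OF open_box cont] .
  have bd: "bounded (T -` box l u)"
    unfolding pre using orthogonal_transformation_linear[OF T'] bounded_box
    by (intro bounded_linear_image) (simp_all add: linear_conv_bounded_linear)
  have meas: "T -` box l u \<in> sets borel" "emeasure lborel (T -` box l u) < \<infinity>"
    by (rule borel_open[OF op], rule emeasure_bounded_finite[OF bd])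
  have "emeasure (distr lborel borel T) (box l u) = emeasure lborel (T -` box l u)"
    by (subst emeasure_distr) auto
  also have "\<dots> = ennreal (measure lborel (T -` box l u))"
    using meas(2) by (intro emeasure_eq_ennreal_measure) auto
  also have "measure lborel (T -` box l u) = measure lebesgue (inv T ` box l u)"
    unfolding pre[symmetric] using meas(1) by (simp add: measure_completion)
  also have "\<dots> = measure lebesgue (box l u)"
    by (rule measure_orthogonal_image[OF T']) simp
  also have "ennreal \<dots> = (\<Prod>b\<in>Basis. (u - l) \<bullet> b)"
    using le by (simp add: measure_completion measure_lborel_box_eq)
  finally show "emeasure (distr lborel borel T) (box l u) = (\<Prod>b\<in>Basis. (u - l) \<bullet> b)" .
qed simp

text \<open>Integration over the sphere in polar coordinates.\<close>

lemma integral_sphere_measure: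
  fixes f :: "'a::euclidean_space \<Rightarrow> real"
  assumes f: "f \<in> borel_measurable borel"
  shows "(LINT x|sphere_measure. f x) = DIM('a) * (LINT x|lborel. indicator (ball 0 1 - {0}) x * f (sgn x))"
proof -
  have f': "f \<in> borel_measurable (restrict_space borel (sphere 0 1))"
    using f by (rule measurable_restrict_space1)
  have "(LINT x|sphere_measure. f x) = DIM('a) * (LINT x|distr (restrict_space lborel (ball 0 1 - {0})) (restrict_space borel (sphere 0 1)) sgn. f x)"
  proof -
    let ?M = "distr (restrict_space lborel (ball 0 1 - {0})) (restrict_space borel (sphere 0 1)) sgn :: 'a measure"
    have eq: "sphere_measure = density ?M (\<lambda>_. ennreal (real DIM('a)))"
      unfolding sphere_measure_def
      by (rule measure_eqI) (simp_all add: emeasure_density_const ennreal_of_nat_eq_real_of_nat)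
    show ?thesis
      unfolding eq by (subst integral_density) (use f' in auto)
  qed
  also have "(LINT x|distr (restrict_space lborel (ball 0 1 - {0})) (restrict_space borel (sphere 0 1)) sgn. f x) =
      (LINT x|restrict_space lborel (ball 0 1 - {0}). f (sgn x))"
    by (rule integral_distr[OF measurable_sgn_punctured_ball f'])
  also have "\<dots> = (LINT x|lborel. indicator (ball 0 1 - {0}) x * f (sgn x))"
    by (subst integral_restrict_space) auto
  finally show ?thesis .
qed

lemma finite_measure_sphere_measure: "finite_measure (sphere_measure :: 'a::euclidean_space measure)"
proof
  have "emeasure (sphere_measure :: 'a measure) (sphere 0 1) =
      of_nat DIM('a) * emeasure lborel {x \<in> ball 0 1 - {0::'a}. sgn x \<in> sphere 0 1}"
    by (rule emeasure_sphere_measure) auto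
  also have "\<dots> \<le> of_nat DIM('a) * emeasure lborel (ball (0::'a) 1)"
    by (intro mult_left_mono emeasure_mono) auto
  also have "\<dots> < \<infinity>"
    using emeasure_bounded_finite[OF bounded_ball[of "0::'a" 1]]
    by (simp add: ennreal_mult_less_top of_nat_less_top)
  finally show "emeasure (sphere_measure :: 'a measure) (space sphere_measure) \<noteq> \<infinity>"
    by simp
qed

lemma integrable_sphere_measure:
  fixes f :: "'a::euclidean_space \<Rightarrow> real"
  assumes "continuous_on UNIV f"
  shows "integrable sphere_measure f"
proof -
  have "bounded (f ` sphere 0 1)"
    by (intro compact_imp_bounded compact_continuous_image continuous_on_subset[OF assms]) auto
  then obtain K where K: "\<And>x. x \<in> sphere 0 1 \<Longrightarrow> norm (f x) \<le> K"
    unfolding bounded_iff by blast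
  have "f \<in> borel_measurable sphere_measure"
    using borel_measurable_continuous_onI[OF assms]
    by (subst measurable_cong_sets[OF sets_sphere_measure refl]) (rule measurable_restrict_space1)
  then show ?thesis
    by (intro finite_measure.integrable_const_bound[OF finite_measure_sphere_measure, of _ K])
       (use K in \<open>auto intro!: AE_I2\<close>)
qed

lemma sphere_average_orthogonal_transformation:
  fixes f :: "(real, 'n::{finite,wellorder}) vec \<Rightarrow> real" and T :: "(real, 'n) vec \<Rightarrow> (real, 'n) vec"
  assumes T: "orthogonal_transformation T" and f: "continuous_on UNIV f"
  shows "sphere_average (\<lambda>x. f (T x)) = sphere_average f"
proof -
  have lin: "linear T" using T by (rule orthogonal_transformation_linear)
  have cont: "continuous_on UNIV T"
    using lin by (intro linear_continuous_on) (simp add: linear_conv_bounded_linear)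
  have [measurable]: "T \<in> borel_measurable borel" "f \<in> borel_measurable borel"
    using cont f by (auto intro: borel_measurable_continuous_onI)
  have meas_sgn: "(sgn :: (real, 'n) vec \<Rightarrow> (real, 'n) vec) \<in> borel_measurable borel"
    unfolding sgn_div_norm[abs_def] by measurable
  have sgn_T: "sgn (T x) = T (sgn x)" for x
    using lin orthogonal_transformation_norm[OF T, of x] by (simp add: sgn_div_norm linear_scale)
  have in_ball: "T x \<in> ball 0 1 - {0} \<longleftrightarrow> x \<in> ball 0 1 - {0}" for x
  proof -
    have "norm (T x) = norm x" by (rule orthogonal_transformation_norm[OF T])
    moreover from this have "T x = 0 \<longleftrightarrow> x = 0" by (metis norm_eq_zero)
    ultimately show ?thesis by simp
  qed
  have "(LINT x|lborel. indicator (ball 0 1 - {0}) x * f (sgn x)) =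
      (LINT x|distr lborel borel T. indicator (ball 0 1 - {0}) x * f (sgn x))"
    by (simp add: lborel_orthogonal_transformation[OF T])
  also have "\<dots> = (LINT x|lborel. indicator (ball 0 1 - {0}) (T x) * f (sgn (T x)))"
  proof (rule integral_distr)
    have "ball 0 1 - {0 :: (real, 'n) vec} \<in> sets borel" by simp
    then show "(\<lambda>x. indicator (ball 0 1 - {0}) x * f (sgn x)) \<in> borel_measurable borel"
      by (intro borel_measurable_times borel_measurable_indicator measurable_compose[OF meas_sgn]) measurable
  qed measurable
  also have "\<dots> = (LINT x|lborel. indicator (ball 0 1 - {0}) x * f (T (sgn x)))"
    unfolding sgn_T using in_ball by (simp add: indicator_def)
  finally show ?thesis
    unfolding sphere_average_def
    by (subst (1 2) integral_sphere_measure) simp_all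
qed

text \<open>An abstract average of continuous functions over the unit sphere. The average over a finite
  subset and the one over the surface measure are treated alike.\<close>

locale sphere_mean =
  fixes A :: "(real ^ 'n::finite \<Rightarrow> real) \<Rightarrow> real"
  assumes mean_add: "\<And>f g. continuous_on UNIV f \<Longrightarrow> continuous_on UNIV g \<Longrightarrow> A (\<lambda>x. f x + g x) = A f + A g"
    and mean_cmult: "\<And>c f. continuous_on UNIV f \<Longrightarrow> A (\<lambda>x. c * f x) = c * A f"
    and mean_cong: "\<And>f g. (\<And>x. norm x = 1 \<Longrightarrow> f x = g x) \<Longrightarrow> A f = A g"
    and mean_one: "A (\<lambda>_. 1) = 1"
begin

lemma mean_sum:
  assumes "finite I" "\<And>i. i \<in> I \<Longrightarrow> continuous_on UNIV (f i)"
  shows "A (\<lambda>x. \<Sum>i\<in>I. f i x) = (\<Sum>i\<in>I. A (f i))"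
  using assms
proof (induction I rule: finite_induct)
  case empty
  then show ?case using mean_cmult[of "\<lambda>_. 1" 0] by (simp add: continuous_on_const)
next
  case (insert i I)
  then show ?case
    by (subst sum.insert[OF insert.hyps], subst sum.insert[OF insert.hyps], subst mean_add)
       (auto intro!: continuous_on_sum)
qed

end

text \<open>The relations that rotations impose on the moments of the surface measure, reduced to the
  ones that can be derived for the shell of a lattice as well.\<close>

locale sphere_mean_4 = sphere_mean A for A :: "(real ^ 'n::finite \<Rightarrow> real) \<Rightarrow> real" +
  assumes odd: "\<And>\<alpha> k. odd k \<Longrightarrow> A (\<lambda>x. (x \<bullet> \<alpha>) ^ k) = 0"
    and quadratic: "\<And>\<alpha> \<beta>. norm \<alpha> = 1 \<Longrightarrow> norm \<beta> = 1 \<Longrightarrow> A (\<lambda>x. (x \<bullet> \<alpha>)\<^sup>2) = A (\<lambda>x. (x \<bullet> \<beta>)\<^sup>2)"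
    and quartic: "\<And>\<alpha> \<beta> \<gamma> \<delta>. \<lbrakk>norm \<alpha> = 1; norm \<beta> = 1; norm \<gamma> = 1; norm \<delta> = 1;
      \<And>x. (x \<bullet> \<alpha>)\<^sup>2 + (x \<bullet> \<beta>)\<^sup>2 = (x \<bullet> \<gamma>)\<^sup>2 + (x \<bullet> \<delta>)\<^sup>2\<rbrakk> \<Longrightarrow>
      A (\<lambda>x. (x \<bullet> \<alpha>) ^ 4) + A (\<lambda>x. (x \<bullet> \<beta>) ^ 4) = A (\<lambda>x. (x \<bullet> \<gamma>) ^ 4) + A (\<lambda>x. (x \<bullet> \<delta>) ^ 4)"
begin

text \<open>Rotate the orthonormal pair by 45 degrees and expand the fourth powers.\<close>

lemma fourth_moment_pair:
  assumes b: "norm b = 1" and c: "norm c = 1" and bc: "b \<bullet> c = 0"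
  shows "A (\<lambda>x. (x \<bullet> b) ^ 4) + A (\<lambda>x. (x \<bullet> c) ^ 4) = 6 * A (\<lambda>x. (x \<bullet> b)\<^sup>2 * (x \<bullet> c)\<^sup>2)"
proof -
  define g where "g = (1 / sqrt 2) *\<^sub>R (b + c)"
  define d where "d = (1 / sqrt 2) *\<^sub>R (b - c)"
  have bb: "b \<bullet> b = 1" "c \<bullet> c = 1" "c \<bullet> b = 0" using b c bc by (simp_all add: norm_eq_1 inner_commute)
  have gd: "norm g = 1" "norm d = 1"
    unfolding norm_eq_1 g_def d_def by (simp_all add: inner_add_left inner_add_right inner_diff_left inner_diff_right bb bc)
  have sg: "(x \<bullet> g)\<^sup>2 = ((x \<bullet> b) + (x \<bullet> c))\<^sup>2 / 2" and sd: "(x \<bullet> d)\<^sup>2 = ((x \<bullet> b) - (x \<bullet> c))\<^sup>2 / 2" for x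
    by (simp_all add: g_def d_def inner_add_right inner_diff_right power_divide)
  have sq: "(x \<bullet> b)\<^sup>2 + (x \<bullet> c)\<^sup>2 = (x \<bullet> g)\<^sup>2 + (x \<bullet> d)\<^sup>2" for x
    unfolding sg sd by (simp add: power2_eq_square field_simps)
  have "A (\<lambda>x. (x \<bullet> b) ^ 4) + A (\<lambda>x. (x \<bullet> c) ^ 4) = A (\<lambda>x. (x \<bullet> g) ^ 4) + A (\<lambda>x. (x \<bullet> d) ^ 4)"
    by (rule quartic[OF b c gd sq])
  also have "\<dots> = A (\<lambda>x. (x \<bullet> g) ^ 4 + (x \<bullet> d) ^ 4)"
    by (rule mean_add[symmetric]) (intro continuous_intros)+
  also have "(\<lambda>x. (x \<bullet> g) ^ 4 + (x \<bullet> d) ^ 4) =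
      (\<lambda>x. 1 / 2 * ((x \<bullet> b) ^ 4 + (x \<bullet> c) ^ 4) + 3 * ((x \<bullet> b)\<^sup>2 * (x \<bullet> c)\<^sup>2))"
  proof
    fix x
    have "(x \<bullet> g) ^ 4 + (x \<bullet> d) ^ 4 = ((x \<bullet> g)\<^sup>2)\<^sup>2 + ((x \<bullet> d)\<^sup>2)\<^sup>2"
      by (simp flip: power_mult)
    then show "(x \<bullet> g) ^ 4 + (x \<bullet> d) ^ 4 = 1 / 2 * ((x \<bullet> b) ^ 4 + (x \<bullet> c) ^ 4) + 3 * ((x \<bullet> b)\<^sup>2 * (x \<bullet> c)\<^sup>2)"
      unfolding sg sd by (simp add: power2_eq_square power4_eq_xxxx field_simps)
  qed
  also have "A (\<lambda>x. 1 / 2 * ((x \<bullet> b) ^ 4 + (x \<bullet> c) ^ 4) + 3 * ((x \<bullet> b)\<^sup>2 * (x \<bullet> c)\<^sup>2)) =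
      1 / 2 * (A (\<lambda>x. (x \<bullet> b) ^ 4) + A (\<lambda>x. (x \<bullet> c) ^ 4)) + 3 * A (\<lambda>x. (x \<bullet> b)\<^sup>2 * (x \<bullet> c)\<^sup>2)"
    by (subst mean_add mean_cmult, (intro continuous_intros)+)+ (rule refl)
  finally show ?thesis by (simp add: field_simps)
qed

text \<open>Complete \<open>\<alpha>\<close> to an orthonormal basis of \<open>n\<close> vectors. Parseval's identity gives \<open>n q = 1\<close> for
  the second moment \<open>q\<close>. Summing \<open>fourth_moment_pair\<close> over all \<open>c \<noteq> b\<close> expresses the mixed moments
  by \<open>q\<close> and yields a linear system for the fourth moments, with a unique solution.\<close>

lemma moments_unit:
  assumes \<alpha>: "norm \<alpha> = 1"
  shows "A (\<lambda>x. (x \<bullet> \<alpha>)\<^sup>2) = 1 / CARD('n)"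
    and "A (\<lambda>x. (x \<bullet> \<alpha>) ^ 4) = 3 / (CARD('n) * (CARD('n) + 2))"
proof -
  obtain S where S: "\<alpha> \<in> S" "pairwise orthogonal S" "\<And>x. x \<in> S \<Longrightarrow> norm x = 1"
    "independent S" "card S = DIM(real ^ 'n)" "span S = UNIV"
    using vector_in_orthonormal_basis[OF \<alpha>] by metis
  have fin: "finite S" using S(4) by (rule independent_imp_finite)
  have parseval: "(\<Sum>b\<in>S. (x \<bullet> b)\<^sup>2) = x \<bullet> x" for x
  proof -
    have "x \<bullet> x = x \<bullet> (\<Sum>b\<in>S. (x \<bullet> b) *\<^sub>R b)"
      using orthonormal_basis_expand[OF S(2,3) _ fin, of x] S(6) by simp
    then show ?thesis by (simp add: inner_sum_right power2_eq_square)
  qed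
  define n where "n = real CARD('n)"
  have n: "n > 0" by (simp add: n_def)
  have card: "real (card S) = n" using S(5) by (simp add: n_def)
  define q where "q = A (\<lambda>x. (x \<bullet> \<alpha>)\<^sup>2)"
  have q: "A (\<lambda>x. (x \<bullet> b)\<^sup>2) = q" if "b \<in> S" for b
    unfolding q_def by (rule quadratic) (use S that in auto)
  have "n * q = (\<Sum>b\<in>S. A (\<lambda>x. (x \<bullet> b)\<^sup>2))"
    using q card by simp
  also have "\<dots> = A (\<lambda>x. \<Sum>b\<in>S. (x \<bullet> b)\<^sup>2)"
    by (rule mean_sum[symmetric]) (auto intro!: continuous_intros fin)
  also have "\<dots> = A (\<lambda>_. 1)"
    by (rule mean_cong) (simp add: parseval norm_eq_1)
  finally have nq: "n * q = 1" by (simp add: mean_one)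
  then show "A (\<lambda>x. (x \<bullet> \<alpha>)\<^sup>2) = 1 / CARD('n)"
    using n unfolding q_def[symmetric] n_def[symmetric] by (simp add: field_simps)
  define M where "M = (\<lambda>b. A (\<lambda>x. (x \<bullet> b) ^ 4))"
  \<comment> \<open>The sum over \<open>c \<noteq> b\<close> of the mixed moments is \<open>q - M b\<close>, again by Parseval.\<close>
  have row: "(n + 4) * M b + sum M S = 6 * q" if b: "b \<in> S" for b
  proof -
    have "(\<Sum>c\<in>S - {b}. M b + M c) = (\<Sum>c\<in>S - {b}. 6 * A (\<lambda>x. (x \<bullet> b)\<^sup>2 * (x \<bullet> c)\<^sup>2))"
    proof (rule sum.cong)
      fix c assume c: "c \<in> S - {b}"
      then have "b \<bullet> c = 0" using S(2) b by (auto simp: pairwise_def orthogonal_def)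
      then show "M b + M c = 6 * A (\<lambda>x. (x \<bullet> b)\<^sup>2 * (x \<bullet> c)\<^sup>2)"
        unfolding M_def using S(3) b c by (intro fourth_moment_pair) auto
    qed simp
    also have "\<dots> = 6 * A (\<lambda>x. \<Sum>c\<in>S - {b}. (x \<bullet> b)\<^sup>2 * (x \<bullet> c)\<^sup>2)"
      unfolding sum_distrib_left[symmetric]
      by (subst mean_sum[symmetric]) (auto intro!: continuous_intros simp: fin sum_distrib_left)
    also have "A (\<lambda>x. \<Sum>c\<in>S - {b}. (x \<bullet> b)\<^sup>2 * (x \<bullet> c)\<^sup>2) = A (\<lambda>x. (x \<bullet> b)\<^sup>2 + (- 1) * (x \<bullet> b) ^ 4)"
    proof (rule mean_cong)
      fix x :: "real ^ 'n" assume "norm x = 1"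
      then have "(\<Sum>c\<in>S - {b}. (x \<bullet> c)\<^sup>2) = 1 - (x \<bullet> b)\<^sup>2"
        using parseval[of x] b fin by (simp add: sum_diff1 norm_eq_1)
      then show "(\<Sum>c\<in>S - {b}. (x \<bullet> b)\<^sup>2 * (x \<bullet> c)\<^sup>2) = (x \<bullet> b)\<^sup>2 + (- 1) * (x \<bullet> b) ^ 4"
        unfolding sum_distrib_left[symmetric] by (simp add: power2_eq_square power4_eq_xxxx right_diff_distrib)
    qed
    also have "\<dots> = q - M b"
    proof -
      have "A (\<lambda>x. (x \<bullet> b)\<^sup>2 + (- 1) * (x \<bullet> b) ^ 4) = A (\<lambda>x. (x \<bullet> b)\<^sup>2) + A (\<lambda>x. (- 1) * (x \<bullet> b) ^ 4)"
        by (rule mean_add) (intro continuous_intros)+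
      also have "A (\<lambda>x. (- 1) * (x \<bullet> b) ^ 4) = - 1 * M b"
        unfolding M_def by (rule mean_cmult) (intro continuous_intros)
      finally show ?thesis using q[OF b] by simp
    qed
    finally have "(\<Sum>c\<in>S - {b}. M b + M c) = 6 * (q - M b)" .
    moreover have "(\<Sum>c\<in>S - {b}. M b + M c) = (n - 1) * M b + (sum M S - M b)"
      using b fin card card_gt_0_iff[of S]
      by (auto simp: sum.distrib sum_diff1 card_Diff_singleton of_nat_diff Suc_leI)
    ultimately show ?thesis by (simp add: algebra_simps)
  qed
  have "(\<Sum>b\<in>S. (n + 4) * M b + sum M S) = (\<Sum>b\<in>S. 6 * q)"
    by (rule sum.cong) (use row in auto)
  then have "(n + 4) * sum M S + n * sum M S = n * (6 * q)"
    using card by (simp add: sum.distrib sum_distrib_left)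
  then have total: "(2 * n + 4) * sum M S = 6" using nq by (simp add: algebra_simps)
  have "(2 * n + 4) * ((n + 4) * M \<alpha>) + 6 = (2 * n + 4) * (6 * q)"
    using row[OF S(1)] unfolding total[symmetric] by (simp add: distrib_left[symmetric])
  then have "n * ((2 * n + 4) * ((n + 4) * M \<alpha>) + 6) = n * ((2 * n + 4) * (6 * q))"
    by (rule arg_cong)
  then have "(n + 4) * (n * (2 * (n + 2)) * M \<alpha>) + 6 * n = 6 * (n * q) * (2 * n + 4)"
    by (simp only: distrib_left distrib_right mult_ac)
  then have "(n + 4) * (n * (n + 2) * M \<alpha>) = (n + 4) * 3"
    using nq by (simp add: algebra_simps)
  then have "n * (n + 2) * M \<alpha> = 3"
    by (rule mult_left_cancel[THEN iffD1, rotated]) (use n in simp)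
  then have "M \<alpha> = 3 / (n * (n + 2))" using n by (simp add: eq_divide_eq mult_ac)
  then show "A (\<lambda>x. (x \<bullet> \<alpha>) ^ 4) = 3 / (CARD('n) * (CARD('n) + 2))"
    by (simp add: M_def n_def algebra_simps)
qed

definition sphere_moment :: "nat \<Rightarrow> real" where
  "sphere_moment k = (if k = 0 then 1 else if k = 2 then 1 / CARD('n) else if k = 4 then 3 / (CARD('n) * (CARD('n) + 2)) else 0)"

lemma power_mean:
  assumes "k \<le> 5"
  shows "A (\<lambda>x. (x \<bullet> \<alpha>) ^ k) = sphere_moment k * norm \<alpha> ^ k"
proof -
  have "k = 0 \<or> k = 2 \<or> k = 4 \<or> odd k"
  proof -
    have "k = 0 \<or> k = 1 \<or> k = 2 \<or> k = 3 \<or> k = 4 \<or> k = 5" using assms by arith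
    then show ?thesis by auto
  qed
  moreover have "A (\<lambda>x. (x \<bullet> \<alpha>) ^ k) = sphere_moment k * norm \<alpha> ^ k" if k: "k = 2 \<or> k = 4"
  proof (cases "\<alpha> = 0")
    case True
    then show ?thesis using k mean_cmult[of "\<lambda>_. 1" 0] by (auto simp: continuous_on_const)
  next
    case False
    define \<beta> where "\<beta> = (1 / norm \<alpha>) *\<^sub>R \<alpha>"
    have \<beta>: "norm \<beta> = 1" using False by (simp add: \<beta>_def)
    have "\<alpha> = norm \<alpha> *\<^sub>R \<beta>" using False by (simp add: \<beta>_def)
    then have "(\<lambda>x. (x \<bullet> \<alpha>) ^ k) = (\<lambda>x. norm \<alpha> ^ k * (x \<bullet> \<beta>) ^ k)"
      by (metis inner_scaleR_right power_mult_distrib)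
    then have "A (\<lambda>x. (x \<bullet> \<alpha>) ^ k) = norm \<alpha> ^ k * A (\<lambda>x. (x \<bullet> \<beta>) ^ k)"
      by (simp only: mean_cmult continuous_on_power continuous_on_inner continuous_on_id continuous_on_const)
    then show ?thesis using k moments_unit[OF \<beta>] by (auto simp: sphere_moment_def)
  qed
  moreover have ?thesis if "odd k"
    using odd[OF that, of \<alpha>] that odd_pos[OF that] by (auto simp: sphere_moment_def)
  ultimately show ?thesis using mean_one by (auto simp: sphere_moment_def)
qed

end

text \<open>Polarization: for \<open>\<alpha> + s b\<close> in place of \<open>\<alpha>\<close> both averages are polynomials in \<open>s\<close>, and the
  coefficient of \<open>s\<close> has one factor \<open>x \<bullet> \<alpha>\<close> replaced by \<open>x \<bullet> b\<close>.\<close>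

lemma power_means_determine_products:
  fixes A A' :: "(real ^ 'n::finite \<Rightarrow> real) \<Rightarrow> real"
  assumes A: "sphere_mean A" and A': "sphere_mean A'"
    and pow: "\<And>k \<alpha>. k \<le> t \<Longrightarrow> A (\<lambda>x. (x \<bullet> \<alpha>) ^ k) = A' (\<lambda>x. (x \<bullet> \<alpha>) ^ k)"
  shows "length bs + m \<le> t \<Longrightarrow>
    A (\<lambda>x. (\<Prod>b\<leftarrow>bs. x \<bullet> b) * (x \<bullet> \<alpha>) ^ m) = A' (\<lambda>x. (\<Prod>b\<leftarrow>bs. x \<bullet> b) * (x \<bullet> \<alpha>) ^ m)"
proof (induction bs arbitrary: m \<alpha>)
  case Nil
  then show ?case using pow by simp
next
  case (Cons b bs)
  let ?P = "\<lambda>x. \<Prod>b\<leftarrow>bs. x \<bullet> b"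
  have contP: "continuous_on UNIV ?P"
    by (induction bs) (auto intro!: continuous_intros)
  let ?f = "\<lambda>j x. ?P x * ((x \<bullet> b) ^ j * (x \<bullet> \<alpha>) ^ (Suc m - j))"
  have cont: "continuous_on UNIV (?f j)" for j
    by (intro continuous_intros contP)
  have expand: "F (\<lambda>x. ?P x * (x \<bullet> (\<alpha> + s *\<^sub>R b)) ^ Suc m) = (\<Sum>j\<le>Suc m. (of_nat (Suc m choose j) * F (?f j)) * s ^ j)"
    if F: "sphere_mean F" for F s
  proof -
    interpret F: sphere_mean F by fact
    have "(\<lambda>x. ?P x * (x \<bullet> (\<alpha> + s *\<^sub>R b)) ^ Suc m) = (\<lambda>x. \<Sum>j\<le>Suc m. (of_nat (Suc m choose j) * s ^ j) * ?f j x)"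
    proof
      fix x
      have "(x \<bullet> (\<alpha> + s *\<^sub>R b)) ^ Suc m = (s * (x \<bullet> b) + x \<bullet> \<alpha>) ^ Suc m"
        by (simp add: inner_add_right add.commute)
      also have "\<dots> = (\<Sum>j\<le>Suc m. of_nat (Suc m choose j) * (s * (x \<bullet> b)) ^ j * (x \<bullet> \<alpha>) ^ (Suc m - j))"
        by (rule binomial_ring)
      finally show "?P x * (x \<bullet> (\<alpha> + s *\<^sub>R b)) ^ Suc m = (\<Sum>j\<le>Suc m. (of_nat (Suc m choose j) * s ^ j) * ?f j x)"
        by (simp only: sum_distrib_left power_mult_distrib mult_ac)
    qed
    then have "F (\<lambda>x. ?P x * (x \<bullet> (\<alpha> + s *\<^sub>R b)) ^ Suc m) = (\<Sum>j\<le>Suc m. F (\<lambda>x. (of_nat (Suc m choose j) * s ^ j) * ?f j x))"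
      by (simp only: F.mean_sum[OF finite_atMost continuous_on_mult[OF continuous_on_const cont]])
    also have "\<dots> = (\<Sum>j\<le>Suc m. (of_nat (Suc m choose j) * F (?f j)) * s ^ j)"
      by (rule sum.cong[OF refl], subst F.mean_cmult[OF cont], simp only: mult_ac)
    finally show ?thesis .
  qed
  have "(\<Sum>j\<le>Suc m. (of_nat (Suc m choose j) * (A (?f j) - A' (?f j))) * s ^ j) = 0" for s
    using Cons.IH[of "Suc m" "\<alpha> + s *\<^sub>R b"] Cons.prems expand[OF A, of s] expand[OF A', of s]
    by (simp add: right_diff_distrib left_diff_distrib sum_subtractf)
  then have "of_nat (Suc m choose 1) * (A (?f 1) - A' (?f 1)) = 0"
    using polyfun_eq_0[of "\<lambda>j. of_nat (Suc m choose j) * (A (?f j) - A' (?f j))" "Suc m"] by auto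
  then have "A (?f 1) = A' (?f 1)" by simp
  moreover have "?f 1 = (\<lambda>x. (\<Prod>b\<leftarrow>b # bs. x \<bullet> b) * (x \<bullet> \<alpha>) ^ m)"
    by (simp add: mult_ac)
  ultimately show ?case by simp
qed

lemma monomial_as_product_of_inner:
  fixes a :: "'n::finite \<Rightarrow> nat"
  obtains bs :: "(real ^ 'n) list" where "length bs = (\<Sum>i\<in>UNIV. a i)" "\<And>x. (\<Prod>i\<in>UNIV. x $ i ^ a i) = (\<Prod>b\<leftarrow>bs. x \<bullet> b)"
proof -
  have "\<exists>bs :: (real ^ 'n) list. length bs = (\<Sum>i\<in>I. a i) \<and> (\<forall>x. (\<Prod>i\<in>I. x $ i ^ a i) = (\<Prod>b\<leftarrow>bs. x \<bullet> b))"
    if "finite I" for I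
    using that
  proof (induction I rule: finite_induct)
    case empty
    then show ?case by (intro exI[of _ "[]"]) simp
  next
    case (insert i I)
    then obtain bs :: "(real ^ 'n) list" where "length bs = (\<Sum>i\<in>I. a i)" "\<forall>x. (\<Prod>i\<in>I. x $ i ^ a i) = (\<Prod>b\<leftarrow>bs. x \<bullet> b)"
      by blast
    then show ?case
      using insert.hyps by (intro exI[of _ "replicate (a i) (axis i 1) @ bs"])
        (simp add: inner_axis prod_list_replicate map_replicate_const)
  qed
  from this[of UNIV] that show ?thesis by auto
qed

lemma means_agree_on_polynomials:
  fixes A A' :: "(real ^ 'n::finite \<Rightarrow> real) \<Rightarrow> real"
  assumes A: "sphere_mean A" and A': "sphere_mean A'"
    and pow: "\<And>k \<alpha>. k \<le> t \<Longrightarrow> A (\<lambda>x. (x \<bullet> \<alpha>) ^ k) = A' (\<lambda>x. (x \<bullet> \<alpha>) ^ k)"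
    and f: "poly_fun_degree_le t f"
  shows "A f = A' f"
proof -
  obtain c where f: "f = (\<lambda>x. \<Sum>a | (\<Sum>i\<in>UNIV. a i) \<le> t. c a * (\<Prod>i\<in>UNIV. x $ i ^ a i))"
    using f by (auto simp: poly_fun_degree_le_def)
  have cont: "continuous_on UNIV (\<lambda>x :: real ^ 'n. \<Prod>i\<in>UNIV. x $ i ^ a i)" for a
    by (intro continuous_intros)
  have eq: "F f = (\<Sum>a | (\<Sum>i\<in>UNIV. a i) \<le> t. c a * F (\<lambda>x. \<Prod>i\<in>UNIV. x $ i ^ a i))" if "sphere_mean F" for F
  proof -
    interpret F: sphere_mean F by fact
    show ?thesis
      unfolding f
      by (simp only: F.mean_sum[OF finite_exponents continuous_on_mult[OF continuous_on_const cont]] F.mean_cmult[OF cont])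
  qed
  show ?thesis
    unfolding eq[OF A] eq[OF A']
  proof (rule sum.cong)
    fix a :: "'n \<Rightarrow> nat" assume "a \<in> {a. (\<Sum>i\<in>UNIV. a i) \<le> t}"
    then have a: "(\<Sum>i\<in>UNIV. a i) \<le> t" by simp
    obtain bs :: "(real ^ 'n) list" where bs: "length bs = (\<Sum>i\<in>UNIV. a i)"
      "\<And>x. (\<Prod>i\<in>UNIV. x $ i ^ a i) = (\<Prod>b\<leftarrow>bs. x \<bullet> b)"
      using monomial_as_product_of_inner[of a] by metis
    show "c a * A (\<lambda>x. \<Prod>i\<in>UNIV. x $ i ^ a i) = c a * A' (\<lambda>x. \<Prod>i\<in>UNIV. x $ i ^ a i)"
      using power_means_determine_products[OF A A' pow, of t bs 0] a bs by simp
  qed simp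
qed

lemma sphere_mean_sphere_average:
  "sphere_mean (sphere_average :: (real ^ 'n::finite \<Rightarrow> real) \<Rightarrow> real)"
proof
  fix f g :: "real ^ 'n \<Rightarrow> real" and c :: real
  show "sphere_average (\<lambda>x. f x + g x) = sphere_average f + sphere_average g"
    if "continuous_on UNIV f" "continuous_on UNIV g"
    using that by (simp add: sphere_average_def integrable_sphere_measure distrib_left)
  show "sphere_average (\<lambda>x. c * f x) = c * sphere_average f"
    by (simp add: sphere_average_def)
  show "sphere_average f = sphere_average g" if "\<And>x. norm x = 1 \<Longrightarrow> f x = g x"
    unfolding sphere_average_def
    by (intro arg_cong2[where f = "(*)"] refl Bochner_Integration.integral_cong) (use that in auto)
  have "measure (sphere_measure :: (real ^ 'n) measure) (sphere 0 1) > 0"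
    unfolding measure_sphere_measure_sphere using content_ball_pos[of 1 "0 :: real ^ 'n"] by simp
  then show "sphere_average (\<lambda>_ :: real ^ 'n. 1) = 1"
    by (simp add: sphere_average_def)
qed

text \<open>A rotation takes any unit vector to any other, so single powers of \<open>x \<bullet> \<alpha>\<close> have the same
  average for all unit vectors \<open>\<alpha>\<close>.\<close>

lemma sphere_mean_4_sphere_average:
  "sphere_mean_4 (sphere_average :: ((real, 'n::{finite,wellorder}) vec \<Rightarrow> real) \<Rightarrow> real)"
proof -
  interpret sphere_mean "sphere_average :: ((real, 'n) vec \<Rightarrow> real) \<Rightarrow> real"
    by (rule sphere_mean_sphere_average)
  have inv: "sphere_average (\<lambda>x. (x \<bullet> \<alpha>) ^ k) = sphere_average (\<lambda>x. (x \<bullet> \<beta>) ^ k)"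
    if unit: "norm \<alpha> = 1" "norm \<beta> = 1" for \<alpha> \<beta> :: "(real, 'n) vec" and k
  proof -
    obtain T where T: "orthogonal_transformation T" "T \<alpha> = \<beta>"
      using orthogonal_transformation_exists_1[OF unit] by metis
    have "sphere_average (\<lambda>x. (T x \<bullet> \<beta>) ^ k) = sphere_average (\<lambda>x. (x \<bullet> \<beta>) ^ k)"
      by (rule sphere_average_orthogonal_transformation[OF T(1)]) (intro continuous_intros)
    then show ?thesis using T by (auto simp: orthogonal_transformation_def)
  qed
  show ?thesis
  proof
    fix \<alpha> :: "(real, 'n) vec" and k :: nat assume k: "odd k"
    have "orthogonal_transformation (uminus :: (real, 'n) vec \<Rightarrow> (real, 'n) vec)"
      by (simp add: orthogonal_transformation_neg)
    then have "sphere_average (\<lambda>x. (- x \<bullet> \<alpha>) ^ k) = sphere_average (\<lambda>x. (x \<bullet> \<alpha>) ^ k)"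
      by (rule sphere_average_orthogonal_transformation) (intro continuous_intros)
    moreover have "sphere_average (\<lambda>x. (- x \<bullet> \<alpha>) ^ k) = sphere_average (\<lambda>x. (- 1) * (x \<bullet> \<alpha>) ^ k)"
      using k by simp
    moreover have "\<dots> = (- 1) * sphere_average (\<lambda>x. (x \<bullet> \<alpha>) ^ k)"
      by (rule mean_cmult) (intro continuous_intros)
    ultimately show "sphere_average (\<lambda>x. (x \<bullet> \<alpha>) ^ k) = 0" by simp
  qed (use inv in metis)+
qed

text \<open>The average over \<open>X\<close> and the average over the sphere have the same moments up to degree \<open>5\<close>:
  the odd ones vanish, and the even ones are determined by the relations.\<close>

lemma spherical_5_design_if_moments:
  fixes X :: "((real, 'n::{finite,wellorder}) vec) set"
  assumes X: "finite X" "X \<noteq> {}" "X \<subseteq> sphere 0 1" "\<And>x. x \<in> X \<Longrightarrow> - x \<in> X"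
    and quadratic: "\<And>\<alpha> \<beta>. norm \<alpha> = 1 \<Longrightarrow> norm \<beta> = 1 \<Longrightarrow> (\<Sum>x\<in>X. (x \<bullet> \<alpha>)\<^sup>2) = (\<Sum>x\<in>X. (x \<bullet> \<beta>)\<^sup>2)"
    and quartic: "\<And>\<alpha> \<beta> \<gamma> \<delta>. \<lbrakk>norm \<alpha> = 1; norm \<beta> = 1; norm \<gamma> = 1; norm \<delta> = 1;
      \<And>x. (x \<bullet> \<alpha>)\<^sup>2 + (x \<bullet> \<beta>)\<^sup>2 = (x \<bullet> \<gamma>)\<^sup>2 + (x \<bullet> \<delta>)\<^sup>2\<rbrakk> \<Longrightarrow>
      (\<Sum>x\<in>X. (x \<bullet> \<alpha>) ^ 4) + (\<Sum>x\<in>X. (x \<bullet> \<beta>) ^ 4) = (\<Sum>x\<in>X. (x \<bullet> \<gamma>) ^ 4) + (\<Sum>x\<in>X. (x \<bullet> \<delta>) ^ 4)"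
  shows "spherical_design 5 X"
proof -
  define A where "A = (\<lambda>f. (1 / card X) * (\<Sum>x\<in>X. f x :: real))"
  have card: "card X > 0" using X by (simp add: card_gt_0_iff)
  interpret A: sphere_mean A
  proof
    show "A f = A g" if "\<And>x. norm x = 1 \<Longrightarrow> f x = g x" for f g
      unfolding A_def using that X(3) by (intro arg_cong2[where f = "(*)"] sum.cong refl) auto
  qed (use card in \<open>simp_all add: A_def sum.distrib add_divide_distrib sum_distrib_left[symmetric]\<close>)
  interpret A: sphere_mean_4 A
  proof
    fix \<alpha> :: "(real, 'n) vec" and k :: nat assume k: "odd k"
    have "(\<Sum>x\<in>X. (x \<bullet> \<alpha>) ^ k) = (\<Sum>x\<in>X. (- x \<bullet> \<alpha>) ^ k)"
      by (rule sum.reindex_bij_witness[of _ uminus uminus]) (use X(4) in auto)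
    also have "\<dots> = - (\<Sum>x\<in>X. (x \<bullet> \<alpha>) ^ k)" using k by (simp add: sum_negf)
    finally show "A (\<lambda>x. (x \<bullet> \<alpha>) ^ k) = 0" by (simp add: A_def)
  next
    fix \<alpha> \<beta> :: "(real, 'n) vec" assume "norm \<alpha> = 1" "norm \<beta> = 1"
    from quadratic[OF this] show "A (\<lambda>x. (x \<bullet> \<alpha>)\<^sup>2) = A (\<lambda>x. (x \<bullet> \<beta>)\<^sup>2)"
      by (simp add: A_def)
  next
    fix \<alpha> \<beta> \<gamma> \<delta> :: "(real, 'n) vec"
    assume "norm \<alpha> = 1" "norm \<beta> = 1" "norm \<gamma> = 1" "norm \<delta> = 1"
      "\<And>x. (x \<bullet> \<alpha>)\<^sup>2 + (x \<bullet> \<beta>)\<^sup>2 = (x \<bullet> \<gamma>)\<^sup>2 + (x \<bullet> \<delta>)\<^sup>2"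
    from quartic[OF this] show "A (\<lambda>x. (x \<bullet> \<alpha>) ^ 4) + A (\<lambda>x. (x \<bullet> \<beta>) ^ 4) = A (\<lambda>x. (x \<bullet> \<gamma>) ^ 4) + A (\<lambda>x. (x \<bullet> \<delta>) ^ 4)"
      unfolding A_def distrib_left[symmetric] by simp
  qed
  interpret S: sphere_mean_4 "sphere_average :: ((real, 'n) vec \<Rightarrow> real) \<Rightarrow> real"
    by (rule sphere_mean_4_sphere_average)
  have "A f = sphere_average f" if "poly_fun_degree_le 5 f" for f
    by (rule means_agree_on_polynomials[OF A.sphere_mean_axioms S.sphere_mean_axioms _ that])
       (simp add: A.power_mean S.power_mean A.sphere_moment_def S.sphere_moment_def)
  then show ?thesis
    using X by (simp add: spherical_design_def A_def)
qed

section \<open>The designs\<close>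

lemma spherical_5_design_shell_22:
  fixes L :: "((real, 'n::{finite,wellorder}) vec) set"
  assumes n: "CARD('n) = 240"
    and L: "even_lattice L" "unimodular_lattice L" "has_minimum_norm L 20"
    and nonempty: "shell L 22 \<noteq> {}"
  shows "supports_spherical_design 5 L 22"
proof -
  define r where "r = 1 / sqrt (22 :: real)"
  have r: "r > 0" "r * (r * 22) = 1" by (simp_all add: r_def flip: power2_eq_square)
  have inj: "inj_on (\<lambda>x. r *\<^sub>R x) (shell L 22)"
    using r by (auto intro: inj_onI)
  have sum_X: "(\<Sum>x\<in>(\<lambda>x. r *\<^sub>R x) ` shell L 22. (x \<bullet> \<alpha>) ^ k) = r ^ k * (\<Sum>x\<in>shell L 22. (x \<bullet> \<alpha>) ^ k)" for \<alpha> k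
    by (simp add: sum.reindex[OF inj] power_mult_distrib sum_distrib_left)
  have "spherical_design 5 ((\<lambda>x. r *\<^sub>R x) ` shell L 22)"
  proof (rule spherical_5_design_if_moments)
    have "shell L 22 \<subseteq> {x \<in> L. x \<bullet> x \<le> 22}" by (auto simp: shell_def)
    then show "finite ((\<lambda>x. r *\<^sub>R x) ` shell L 22)"
      using finite_lattice_ball[OF L(2)] by (auto intro: finite_subset)
    show "(\<lambda>x. r *\<^sub>R x) ` shell L 22 \<noteq> {}" using nonempty by simp
    show "(\<lambda>x. r *\<^sub>R x) ` shell L 22 \<subseteq> sphere 0 1"
    proof
      fix y assume "y \<in> (\<lambda>x. r *\<^sub>R x) ` shell L 22"
      then have "y \<bullet> y = 1" using r(2) by (auto simp: shell_def)
      then show "y \<in> sphere 0 1" by (simp add: norm_eq_1)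
    qed
    show "- y \<in> (\<lambda>x. r *\<^sub>R x) ` shell L 22" if "y \<in> (\<lambda>x. r *\<^sub>R x) ` shell L 22" for y
    proof -
      obtain x where x: "x \<in> shell L 22" "y = r *\<^sub>R x" using \<open>y \<in> _\<close> by blast
      have "- x \<in> L"
        using unimodular_lattice_minus[OF L(2)] x(1) by (simp add: shell_def)
      then have "- x \<in> shell L 22" using x(1) by (simp add: shell_def)
      then have "r *\<^sub>R (- x) \<in> (\<lambda>x. r *\<^sub>R x) ` shell L 22" by (rule imageI)
      then show ?thesis using x(2) by simp
    qed
    show "(\<Sum>x\<in>(\<lambda>x. r *\<^sub>R x) ` shell L 22. (x \<bullet> \<alpha>)\<^sup>2) = (\<Sum>x\<in>(\<lambda>x. r *\<^sub>R x) ` shell L 22. (x \<bullet> \<beta>)\<^sup>2)"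
      if "norm \<alpha> = 1" "norm \<beta> = 1" for \<alpha> \<beta>
      unfolding sum_X using shell_quadratic_sums[OF n L that] by simp
    show "(\<Sum>x\<in>(\<lambda>x. r *\<^sub>R x) ` shell L 22. (x \<bullet> \<alpha>) ^ 4) + (\<Sum>x\<in>(\<lambda>x. r *\<^sub>R x) ` shell L 22. (x \<bullet> \<beta>) ^ 4) =
        (\<Sum>x\<in>(\<lambda>x. r *\<^sub>R x) ` shell L 22. (x \<bullet> \<gamma>) ^ 4) + (\<Sum>x\<in>(\<lambda>x. r *\<^sub>R x) ` shell L 22. (x \<bullet> \<delta>) ^ 4)"
      if "norm \<alpha> = 1" "norm \<beta> = 1" "norm \<gamma> = 1" "norm \<delta> = 1"
        "\<And>x. (x \<bullet> \<alpha>)\<^sup>2 + (x \<bullet> \<beta>)\<^sup>2 = (x \<bullet> \<gamma>)\<^sup>2 + (x \<bullet> \<delta>)\<^sup>2" for \<alpha> \<beta> \<gamma> \<delta>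
      unfolding sum_X using shell_quartic_sums[OF n L that] by (simp flip: distrib_left)
  qed
  then show ?thesis by (simp add: supports_spherical_design_def r_def)
qed

theorem theorem1p3:
  shows "(\<forall>C :: (bit ^ 96) set.
            linear_code C \<and> doubly_even_code C \<and> self_dual_code C \<and> has_minimum_weight C 16 \<longrightarrow>
            is_combinatorial_design 2 (codewords_of_weight C 20) \<and>
            is_combinatorial_design 2 (codewords_of_weight C 76)) \<and>
         (\<forall>L :: (real ^ 240) set.
            lattice_in_space L \<and> even_lattice L \<and> unimodular_lattice L \<and> has_minimum_norm L 20 \<and>
            shell L 22 \<noteq> {} \<longrightarrow>
            supports_spherical_design 5 L 22)"
proof (intro conjI allI impI; elim conjE)
  fix C :: "(bit ^ 96) set"
  assume "linear_code C" "doubly_even_code C" "self_dual_code C" "has_minimum_weight C 16"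
  then interpret self_dual_code_96_16 C by unfold_locales
  show "is_combinatorial_design 2 (codewords_of_weight C 20)"
    "is_combinatorial_design 2 (codewords_of_weight C 76)"
    by (rule two_designs)+
next
  fix L :: "(real ^ 240) set"
  assume "even_lattice L" "unimodular_lattice L" "has_minimum_norm L 20" "shell L 22 \<noteq> {}"
  then show "supports_spherical_design 5 L 22"
    by (intro spherical_5_design_shell_22) simp_all
qed

end
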